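(* Let $r\geq t\geq 2$ and $k\geq 2$ be integers. There exists $n_0=n_0(r,t,k)$ such that for every $n\geq n_0$ and every $kK_{r+1}$-free graph $G$ on $n$ vertices, $$\rho_t(G)\leq \rho_t\big(K_{k-1}\vee T_r(n-k+1)\big),$$ with equality if and only if $G\cong K_{k-1}\vee T_r(n-k+1)$.
   Context: All graphs are finite and simple. $kK_{r+1}$ denotes the disjoint union of $k$ copies of the complete graph $K_{r+1}$; a graph is $F$-free if it contains no copy of $F$ as a subgraph. $T_r(m)$ is the Turán graph: the complete $r$-partite graph on $m$ vertices whose part sizes differ by at most one. For disjoint graphs $G_1,G_2$, the join $G_1\vee G_2$ is obtained from $G_1\cup G_2$ by adding all edges between $V(G_1)$ and $V(G_2)$. For a graph $G$ on vertex set $[n]$, let $C_t(G)$ be the set of vertex sets of $t$-cliques of $G$. The $t$-clique tensor $\mathcal{A}_t(G)=(a_{i_1\cdots i_t})$ is the order-$t$, dimension-$n$ tensor with $a_{i_1\cdots i_t}=\frac{1}{(t-1)!}$ if $\{i_1,\ldots,i_t\}\in C_t(G)$ and $0$ otherwise. A number $\lambda\in\mathbb{C}$ is an eigenvalue of an order-$t$ tensor $\mathcal{A}$ if there is a nonzero $x\in\mathbb{C}^n$ with $(\mathcal{A}x^{t-1})_j:=\sum_{i_2,\ldots,i_t}a_{j i_2\cdots i_t}x_{i_2}\cdots x_{i_t}=\lambda x_j^{t-1}$ for all $j$. The $t$-clique spectral radius $\rho_t(G)$ is the maximum modulus of the eigenvalues of $\mathcal{A}_t(G)$; equivalently $\rho_t(G)=\max\{t\sum_{\{i_1,\ldots,i_t\}\in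 C_t(G)}x_{i_1}\cdots x_{i_t}: x\in\mathbb{R}^n_{\ge 0},\ \sum_i x_i^t=1\}$. For $t=2$ this is the usual adjacency spectral radius. *)

theory Defs
  imports Complex_Main "Graph_Theory.Graph_Theory"
begin

text \<open>
  A finite simple graph is a \<^locale>\<open>pair_graph\<close>: finite vertex set, and a symmetric, irreflexive
  arc relation in which every edge occurs in both directions.
\<close>

definition complete_graph :: "nat \<Rightarrow> nat pair_pre_digraph" where
  "complete_graph m = \<lparr> pverts = {..<m}, parcs = {(u, v). u < m \<and> v < m \<and> u \<noteq> v} \<rparr>"

definition disjoint_copies :: "nat \<Rightarrow> 'a pair_pre_digraph \<Rightarrow> (nat \<times> 'a) pair_pre_digraph" where
  "disjoint_copies k G =
    \<lparr> pverts = {..<k} \<times> pverts G,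
      parcs = {((i, u), (j, v)). i < k \<and> i = j \<and> (u, v) \<in> parcs G} \<rparr>"

text \<open>Part \<open>i\<close> of the Turan graph (\<open>i < r\<close>) consists of the vertices congruent to \<open>i\<close> modulo \<open>r\<close>.\<close>

definition turan_graph :: "nat \<Rightarrow> nat \<Rightarrow> nat pair_pre_digraph" where
  "turan_graph r m =
    \<lparr> pverts = {..<m}, parcs = {(u, v). u < m \<and> v < m \<and> u mod r \<noteq> v mod r} \<rparr>"

text \<open>The sum type makes the two vertex sets disjoint.\<close>

definition graph_join ::
    "'a pair_pre_digraph \<Rightarrow> 'b pair_pre_digraph \<Rightarrow> ('a + 'b) pair_pre_digraph" where
  "graph_join G H =
    \<lparr> pverts = pverts G <+> pverts H,
      parcs = {(Inl u, Inl v) | u v. (u, v) \<in> parcs G}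
            \<union> {(Inr u, Inr v) | u v. (u, v) \<in> parcs H}
            \<union> {(Inl u, Inr v) | u v. u \<in> pverts G \<and> v \<in> pverts H}
            \<union> {(Inr v, Inl u) | u v. u \<in> pverts G \<and> v \<in> pverts H} \<rparr>"

definition isomorphic :: "'a pair_pre_digraph \<Rightarrow> 'b pair_pre_digraph \<Rightarrow> bool" where
  "isomorphic G H \<longleftrightarrow> digraph_iso (with_proj G) (with_proj H)"

definition free_of :: "'a pair_pre_digraph \<Rightarrow> 'b pair_pre_digraph \<Rightarrow> bool" where
  "free_of F G \<longleftrightarrow> \<not> (\<exists>H. subgraph H (with_proj G) \<and> digraph_iso (with_proj F) H)"

lemma complete_digraph_complete_graph: "complete_digraph m (with_proj (complete_graph m))"
  unfolding complete_digraph_pair_def by (auto simp: complete_graph_def)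

lemma pair_graph_complete_graph: "pair_graph (complete_graph m)"
proof
  have "parcs (complete_graph m) \<subseteq> {..<m} \<times> {..<m}"
    by (auto simp: complete_graph_def)
  then show "finite (parcs (complete_graph m))"
    by (rule finite_subset) simp
  show "symmetric (with_proj (complete_graph m))"
    by (auto simp: complete_graph_def symmetric_def sym_def)
qed (auto simp: complete_graph_def)

lemma pair_graph_turan_graph: "pair_graph (turan_graph r m)"
proof
  have "parcs (turan_graph r m) \<subseteq> {..<m} \<times> {..<m}"
    by (auto simp: turan_graph_def)
  then show "finite (parcs (turan_graph r m))"
    by (rule finite_subset) simp
  show "symmetric (with_proj (turan_graph r m))"
    by (auto simp: turan_graph_def symmetric_def sym_def)
qed (auto simp: turan_graph_def)

lemma turan_graph_balanced:
  assumes "i < r" "j < r"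
  shows "card {v \<in> pverts (turan_graph r m). v mod r = i}
       \<le> card {v \<in> pverts (turan_graph r m). v mod r = j} + 1"
proof -
  let ?A = "\<lambda>i. {v. v < m \<and> v mod r = i}"
  have inj: "inj_on (\<lambda>v. v - r - i + j) (?A i - {i})"
  proof (rule inj_onI)
    fix v w assume v: "v \<in> ?A i - {i}" and w: "w \<in> ?A i - {i}"
      and eq: "v - r - i + j = w - r - i + j"
    have ge: "r + i \<le> x" if "x \<in> ?A i - {i}" for x
    proof -
      have "x div r \<noteq> 0"
      proof
        assume "x div r = 0"
        then have "x mod r = x" by (metis add_0 div_mult_mod_eq mult_0)
        with that show False by auto
      qed
      then have "r \<le> x div r * r" by simp
      then have "r + x mod r \<le> x div r * r + x mod r" by (rule add_le_mono1)
      then have "r + x mod r \<le> x" by (simp only: div_mult_mod_eq)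
      with that show ?thesis by simp
    qed
    show "v = w" using ge[OF v] ge[OF w] eq by linarith
  qed
  have sub: "(\<lambda>v. v - r - i + j) ` (?A i - {i}) \<subseteq> ?A j"
  proof clarify
    fix v assume v: "v < m" "i = v mod r" "v \<noteq> v mod r"
    define q where "q = v div r"
    have vq: "v = q * r + i" using v(2) by (simp add: q_def)
    have "q \<noteq> 0" using v vq by (metis add_0 mult_0)
    then obtain p where p: "q = Suc p" using not0_implies_Suc by blast
    have e: "v - r - i + j = p * r + j" using vq p by simp
    moreover have "p * r + j < m" using vq p v(1) assms by simp
    ultimately show "v - r - v mod r + j < m \<and> (v - r - v mod r + j) mod r = j"
      using assms v(2) by simp
  qed
  have "card (?A i) \<le> card (?A i - {i}) + 1"
    by (auto simp: card_Diff_singleton_if)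
  also have "card (?A i - {i}) \<le> card (?A j)"
    by (rule card_inj_on_le[OF inj sub]) simp
  finally show ?thesis by (simp add: turan_graph_def)
qed

lemma pair_graph_graph_join:
  assumes "pair_graph G" "pair_graph H"
  shows "pair_graph (graph_join G H)"
proof -
  interpret G: pair_graph G by fact
  interpret H: pair_graph H by fact
  have wf: "parcs (graph_join G H) \<subseteq> pverts (graph_join G H) \<times> pverts (graph_join G H)"
    by (auto simp: graph_join_def dest: G.wellformed' H.wellformed')
  have fin: "finite (pverts (graph_join G H))"
    by (simp add: graph_join_def)
  show ?thesis
  proof
    show "finite (parcs (graph_join G H))"
      using finite_subset[OF wf] fin by blast
    show "symmetric (with_proj (graph_join G H))"
      by (auto simp: symmetric_def sym_def graph_join_def
          intro: G.arcs_symmetric H.arcs_symmetric)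
  qed (use fin in \<open>auto simp: graph_join_def
        dest: G.pair_no_loops H.pair_no_loops G.wellformed' H.wellformed'\<close>)
qed

lemma pair_graph_disjoint_copies:
  assumes "pair_graph G"
  shows "pair_graph (disjoint_copies k G)"
proof -
  interpret G: pair_graph G by fact
  have wf: "parcs (disjoint_copies k G) \<subseteq> pverts (disjoint_copies k G) \<times> pverts (disjoint_copies k G)"
    by (auto simp: disjoint_copies_def dest: G.wellformed')
  have fin: "finite (pverts (disjoint_copies k G))"
    by (simp add: disjoint_copies_def)
  show ?thesis
  proof
    show "finite (parcs (disjoint_copies k G))"
      using finite_subset[OF wf] fin by blast
    show "symmetric (with_proj (disjoint_copies k G))"
      by (auto simp: symmetric_def sym_def disjoint_copies_def intro: G.arcs_symmetric)
  qed (use fin in \<open>auto simp: disjoint_copies_def dest: G.pair_no_loops G.wellformed'\<close>)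
qed

lemma digraph_iso_image:
  assumes G: "pair_graph G" and f: "inj_on f (pverts G)"
    and H: "pverts H = f ` pverts G" "parcs H = map_prod f f ` parcs G"
  shows "digraph_iso (with_proj G) (with_proj H)"
proof -
  interpret pair_graph G by fact
  let ?h = "\<lparr> iso_verts = f, iso_arcs = map_prod f f, iso_head = snd, iso_tail = fst \<rparr>"
  have "parcs G \<subseteq> pverts G \<times> pverts G" by (auto dest: wellformed')
  then have "inj_on (map_prod f f) (parcs G)"
    using map_prod_inj_on[OF f f] inj_on_subset by blast
  then have "pre_digraph.digraph_isomorphism (with_proj G) ?h"
    using f wf_digraph_axioms by (simp add: pre_digraph.digraph_isomorphism_def)
  moreover have "with_proj H = app_iso ?h (with_proj G)"
    by (simp add: app_iso_def with_proj_def H)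
  ultimately show ?thesis unfolding digraph_iso_def by blast
qed

lemma digraph_iso_imageD:
  assumes "digraph_iso (with_proj G) H" "tail H = fst" "head H = snd"
  obtains f where "inj_on f (pverts G)" "verts H = f ` pverts G" "arcs H = map_prod f f ` parcs G"
proof -
  obtain h where h: "pre_digraph.digraph_isomorphism (with_proj G) h" "H = app_iso h (with_proj G)"
    using assms(1) unfolding digraph_iso_def by blast
  have th: "iso_tail h = fst" "iso_head h = snd" using h(2) assms(2,3) by (auto simp: app_iso_def)
  have "iso_arcs h a = map_prod (iso_verts h) (iso_verts h) a" if "a \<in> parcs G" for a
    using h(1) that unfolding pre_digraph.digraph_isomorphism_def
    by (simp add: th map_prod_def prod_eq_iff split: prod.split)
  then have "arcs H = map_prod (iso_verts h) (iso_verts h) ` parcs G"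
    using h(2) by simp
  moreover have "inj_on (iso_verts h) (pverts G)" "verts H = iso_verts h ` pverts G"
    using h by (auto simp: pre_digraph.digraph_isomorphism_def)
  ultimately show thesis using that by blast
qed

lemma isomorphic_iff:
  assumes "pair_graph G" "pair_graph H"
  shows "isomorphic G H \<longleftrightarrow>
    (\<exists>f. bij_betw f (pverts G) (pverts H) \<and>
      (\<forall>u \<in> pverts G. \<forall>v \<in> pverts G. (u, v) \<in> parcs G \<longleftrightarrow> (f u, f v) \<in> parcs H))"
proof -
  interpret G: pair_graph G by fact
  interpret H: pair_graph H by fact
  show ?thesis
  proof
    assume "isomorphic G H"
    then obtain f where f: "inj_on f (pverts G)" "pverts H = f ` pverts G"
      "parcs H = map_prod f f ` parcs G"
      unfolding isomorphic_def by (rule digraph_iso_imageD) simp_all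
    have "(u, v) \<in> parcs G \<longleftrightarrow> (f u, f v) \<in> parcs H" if "u \<in> pverts G" "v \<in> pverts G" for u v
    proof
      assume "(f u, f v) \<in> parcs H"
      then obtain a b where ab: "(a, b) \<in> parcs G" "f u = f a" "f v = f b"
        unfolding f(3) by auto
      then show "(u, v) \<in> parcs G"
        using that f(1) G.wellformed'[OF ab(1)] by (metis inj_onD)
    qed (force simp: f(3))
    then show "\<exists>f. bij_betw f (pverts G) (pverts H) \<and>
      (\<forall>u \<in> pverts G. \<forall>v \<in> pverts G. (u, v) \<in> parcs G \<longleftrightarrow> (f u, f v) \<in> parcs H)"
      using f by (auto simp: bij_betw_def)
  next
    assume "\<exists>f. bij_betw f (pverts G) (pverts H) \<and>
      (\<forall>u \<in> pverts G. \<forall>v \<in> pverts G. (u, v) \<in> parcs G \<longleftrightarrow> (f u, f v) \<in> parcs H)"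
    then obtain f where f: "inj_on f (pverts G)" "f ` pverts G = pverts H"
      and e: "\<And>u v. u \<in> pverts G \<Longrightarrow> v \<in> pverts G \<Longrightarrow> (u, v) \<in> parcs G \<longleftrightarrow> (f u, f v) \<in> parcs H"
      by (auto simp: bij_betw_def)
    have "parcs H = map_prod f f ` parcs G"
    proof (intro equalityI subsetI)
      fix a assume a: "a \<in> parcs H"
      obtain x y where xy: "a = (x, y)" by (cases a)
      then have "x \<in> f ` pverts G" "y \<in> f ` pverts G"
        using a H.wellformed' f(2) by auto
      then obtain u v where "u \<in> pverts G" "v \<in> pverts G" "x = f u" "y = f v" by blast
      then show "a \<in> map_prod f f ` parcs G" using a e xy by force
    next
      fix a assume "a \<in> map_prod f f ` parcs G"
      then obtain u v where uv: "(u, v) \<in> parcs G" "a = (f u, f v)" by auto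
      then show "a \<in> parcs H" using e[OF G.wellformed'[OF uv(1)]] by simp
    qed
    then show "isomorphic G H"
      unfolding isomorphic_def by (intro digraph_iso_image[OF assms(1) f(1)]) (simp_all add: f(2))
  qed
qed

lemma free_of_iff:
  assumes "pair_graph F" "pair_graph G"
  shows "free_of F G \<longleftrightarrow>
    \<not> (\<exists>f. inj_on f (pverts F) \<and> f ` pverts F \<subseteq> pverts G \<and>
        (\<forall>u v. (u, v) \<in> parcs F \<longrightarrow> (f u, f v) \<in> parcs G))"
proof -
  interpret F: pair_graph F by fact
  interpret G: pair_graph G by fact
  have "(\<exists>H. subgraph H (with_proj G) \<and> digraph_iso (with_proj F) H) \<longleftrightarrow>
    (\<exists>f. inj_on f (pverts F) \<and> f ` pverts F \<subseteq> pverts G \<and>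
        (\<forall>u v. (u, v) \<in> parcs F \<longrightarrow> (f u, f v) \<in> parcs G))" (is "?L \<longleftrightarrow> ?R")
  proof
    assume ?L
    then obtain H where H: "subgraph H (with_proj G)" "digraph_iso (with_proj F) H" by blast
    then have th: "tail H = fst" "head H = snd"
      by (auto simp: subgraph_def compatible_def)
    obtain f where f: "inj_on f (pverts F)" "verts H = f ` pverts F"
      "arcs H = map_prod f f ` parcs F"
      using digraph_iso_imageD[OF H(2) th] .
    have "f ` pverts F \<subseteq> pverts G" "map_prod f f ` parcs F \<subseteq> parcs G"
      using H(1) f(2,3) by (auto simp: subgraph_def)
    with f(1) show ?R by (intro exI[of _ f]) force
  next
    assume ?R
    then obtain f where f: "inj_on f (pverts F)" "f ` pverts F \<subseteq> pverts G"
      "\<And>u v. (u, v) \<in> parcs F \<Longrightarrow> (f u, f v) \<in> parcs G" by blast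
    let ?H = "\<lparr> pverts = f ` pverts F, parcs = map_prod f f ` parcs F \<rparr>"
    have "wf_digraph (with_proj ?H)"
      by unfold_locales (auto dest: F.wellformed')
    then have "subgraph (with_proj ?H) (with_proj G)"
      using f G.wf_digraph_axioms by (auto simp: subgraph_def compatible_def)
    moreover have "digraph_iso (with_proj F) (with_proj ?H)"
      by (rule digraph_iso_image[OF assms(1) f(1)]) simp_all
    ultimately show ?L by blast
  qed
  then show ?thesis by (simp add: free_of_def)
qed

text \<open>
  A tensor of order \<open>t\<close> indexed by a finite set \<open>V\<close> is a function on index lists; only its values on
  lists of length \<open>t\<close> over \<open>V\<close> matter.  Vectors are functions, of which only the values on \<open>V\<close> matter.
\<close>

type_synonym 'a tensor = "'a list \<Rightarrow> complex"

definition tensor_apply :: "nat \<Rightarrow> 'a set \<Rightarrow> 'a tensor \<Rightarrow> ('a \<Rightarrow> complex) \<Rightarrow> 'a \<Rightarrow> complex" where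
  "tensor_apply t V A x j =
    (\<Sum>is \<in> {is. set is \<subseteq> V \<and> length is = t - 1}. A (j # is) * (\<Prod>i\<leftarrow>is. x i))"

definition tensor_eigenvalue :: "nat \<Rightarrow> 'a set \<Rightarrow> 'a tensor \<Rightarrow> complex \<Rightarrow> bool" where
  "tensor_eigenvalue t V A \<mu> \<longleftrightarrow>
    (\<exists>x. (\<exists>j \<in> V. x j \<noteq> 0) \<and> (\<forall>j \<in> V. tensor_apply t V A x j = \<mu> * x j ^ (t - 1)))"

definition clique_sets :: "nat \<Rightarrow> 'a pair_pre_digraph \<Rightarrow> 'a set set" where
  "clique_sets t G =
    {S. S \<subseteq> pverts G \<and> card S = t \<and> (\<forall>u \<in> S. \<forall>v \<in> S. u \<noteq> v \<longrightarrow> (u, v) \<in> parcs G)}"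

text \<open>An index list of length \<open>t\<close> with a repeated entry has fewer than \<open>t\<close> elements, so its entry is 0.\<close>

definition clique_tensor :: "nat \<Rightarrow> 'a pair_pre_digraph \<Rightarrow> 'a tensor" where
  "clique_tensor t G is = (if set is \<in> clique_sets t G then 1 / fact (t - 1) else 0)"

definition clique_spectral_radius :: "nat \<Rightarrow> 'a pair_pre_digraph \<Rightarrow> real" where
  "clique_spectral_radius t G =
    (GREATEST m. \<exists>\<mu>. tensor_eigenvalue t (pverts G) (clique_tensor t G) \<mu> \<and> m = cmod \<mu>)"

end

theory Submission
  imports Defs "HOL-Analysis.Analysis" "HOL-Combinatorics.Multiset_Permutations"
begin

text \<open>
  The spectral radius is the maximum of \<open>t\<close> times the weighted number of \<open>t\<close>-cliques over nonnegative
  vectors; Perron vectors are normalised so that their \<open>t\<close>-th powers sum to \<open>n\<close>.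

  If some vertex has weight well below 1, deleting it increases the ratio of the spectral radius to
  that of the extremal graph by a factor \<open>1 + \<eta> / n\<close>, which cannot happen indefinitely because the
  harmonic series diverges.  Otherwise all weights are at least \<open>1 - \<epsilon>\<close>.  A maximal family of disjoint
  copies of \<open>K_(r+1)\<close> covers a bounded set \<open>W\<close>, and the eigenvalue equation together with a
  Motzkin-Straus bound for clique-free neighbourhoods forces a minimum degree outside \<open>W\<close> so large
  that the rest of the graph is \<open>r\<close>-partite.  Let \<open>L\<close> be the vertices with many neighbours in all \<open>r\<close>
  parts.  Such vertices lie in many almost disjoint copies of \<open>K_(r+1)\<close>, so there are at most \<open>k - 1\<close> of
  them.  If there are exactly \<open>k - 1\<close>, then the graph without \<open>L\<close> contains no \<open>K_(r+1)\<close>, hence is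
  \<open>r\<close>-partite; if there are fewer, joining one more vertex to everything gains more than the few edges
  inside the parts can contribute.  Finally, moving a vertex from a larger to a smaller part of a
  complete multipartite graph increases the spectral radius.
\<close>

section \<open>Weighted clique sums\<close>

text \<open>The obstacle is that the eigenvalue equation at a vertex bounds its degree from below
  only if its weight is not small, while a Perron vector may well be small at single vertices.
  Normalising the \<open>t\<close>-th powers to average 1 makes the bound on the largest weight
  independent of \<open>n\<close>, so that "small" means the same in every order. Having no
  \<open>k\<close> disjoint cliques survives the deletion of vertices, so a light vertex can be
  deleted and the loss compared with the change of the extremal value: a vertex of average weight
  would be neutral up to lower order terms, a lighter one leaves a surplus of order
  \<open>1 / n\<close>. For \<open>t > 2\<close> the spectral radius sees only
  \<open>t\<close>-cliques. The equality case recovers the edges all the same, because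
  \<open>t \<le> r\<close> puts every edge of the extremal graph into a \<open>t\<close>-clique and
  no weight vanishes there.\<close>

definition cliques :: "nat \<Rightarrow> ('a \<times> 'a) set \<Rightarrow> 'a set \<Rightarrow> 'a set set" where
  "cliques s E V = {S. S \<subseteq> V \<and> card S = s \<and> (\<forall>u\<in>S. \<forall>v\<in>S. u \<noteq> v \<longrightarrow> (u, v) \<in> E)}"

text \<open>The clique polynomial of order \<open>s\<close>, an elementary symmetric polynomial if
  \<open>E\<close> is complete. It is multilinear, and its partial derivative at \<open>v\<close> is
  the polynomial of the next lower order on the neighbourhood of \<open>v\<close>. Since
  \<open>E\<close> and \<open>x\<close> are not tied to \<open>V\<close>, both stay fixed when
  \<open>V\<close> shrinks.\<close>

definition kap :: "nat \<Rightarrow> ('a \<times> 'a) set \<Rightarrow> ('a \<Rightarrow> real) \<Rightarrow> 'a set \<Rightarrow> real" where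
  "kap s E x V = (\<Sum>S\<in>cliques s E V. \<Prod>i\<in>S. x i)"

lemma clique_sets_eq_cliques: "clique_sets t G = cliques t (parcs G) (pverts G)"
  by (simp add: clique_sets_def cliques_def)

lemma cliques_mono: "E \<subseteq> F \<Longrightarrow> U \<subseteq> V \<Longrightarrow> cliques s E U \<subseteq> cliques s F V"
  by (auto simp: cliques_def)

lemma finite_cliques [simp]: "finite V \<Longrightarrow> finite (cliques s E V)"
  by (rule finite_subset[of _ "Pow V"]) (auto simp: cliques_def)

lemma cliques_0 [simp]: "finite V \<Longrightarrow> cliques 0 E V = {{}}"
  using finite_subset by (fastforce simp: cliques_def)

lemma cliques_Suc_empty [simp]: "cliques (Suc s) E {} = {}"
  by (auto simp: cliques_def)

lemma cliques_subset: "T \<subseteq> S \<Longrightarrow> S \<in> cliques m E V \<Longrightarrow> card T = s \<Longrightarrow> T \<in> cliques s E V"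
  by (auto simp: cliques_def)

lemma clique_insert:
  assumes "S \<in> cliques s E V" "finite V" "sym E" "v \<notin> S" "S \<subseteq> E `` {v}"
  shows "insert v S \<in> cliques (Suc s) E (insert v V)"
proof -
  have "finite S" using assms finite_subset unfolding cliques_def by blast
  then show ?thesis using assms by (auto simp: cliques_def dest: symD)
qed

lemma cliques_insert:
  assumes "finite V" "v \<notin> V" "sym E"
  shows "cliques (Suc s) E (insert v V)
      = cliques (Suc s) E V \<union> insert v ` cliques s E (V \<inter> E `` {v})"
proof (intro equalityI subsetI)
  fix S assume S: "S \<in> cliques (Suc s) E (insert v V)"
  show "S \<in> cliques (Suc s) E V \<union> insert v ` cliques s E (V \<inter> E `` {v})"
  proof (cases "v \<in> S")
    case True
    have "finite S" using S assms(1) finite_subset[of S "insert v V"] by (auto simp: cliques_def)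
    then have "S - {v} \<in> cliques s E (V \<inter> E `` {v})" using S True by (auto simp: cliques_def)
    moreover have "S = insert v (S - {v})" using True by auto
    ultimately show ?thesis by blast
  qed (use S in \<open>auto simp: cliques_def\<close>)
next
  fix S assume "S \<in> cliques (Suc s) E V \<union> insert v ` cliques s E (V \<inter> E `` {v})"
  then show "S \<in> cliques (Suc s) E (insert v V)"
  proof
    assume "S \<in> cliques (Suc s) E V"
    then show ?thesis using cliques_mono[of E E V "insert v V"] by blast
  next
    assume "S \<in> insert v ` cliques s E (V \<inter> E `` {v})"
    then obtain T where T: "S = insert v T" "T \<in> cliques s E (V \<inter> E `` {v})" by blast
    then have "v \<notin> T" "T \<subseteq> E `` {v}" using assms(2) by (auto simp: cliques_def)
    moreover have "T \<in> cliques s E V" using T(2) cliques_mono[of E E _ V] by blast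
    ultimately show ?thesis using clique_insert assms T(1) by metis
  qed
qed

lemma kap_0 [simp]: "finite V \<Longrightarrow> kap 0 E x V = 1"
  by (simp add: kap_def)

lemma kap_Suc_empty [simp]: "kap (Suc s) E x {} = 0"
  by (simp add: kap_def)

lemma kap_cong: "(\<And>v. v \<in> V \<Longrightarrow> x v = y v) \<Longrightarrow> kap s E x V = kap s E y V"
  unfolding kap_def cliques_def by (intro sum.cong prod.cong) auto

lemma kap_insert:
  assumes "finite V" "v \<notin> V" "sym E"
  shows "kap (Suc s) E x (insert v V) = kap (Suc s) E x V + x v * kap s E x (V \<inter> E `` {v})"
proof -
  let ?C = "cliques s E (V \<inter> E `` {v})"
  have nv: "v \<notin> S" "finite S" if "S \<in> ?C" for S using that assms finite_subset[of S V] by (auto simp: cliques_def)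
  have "kap (Suc s) E x (insert v V)
      = kap (Suc s) E x V + (\<Sum>S\<in>insert v ` ?C. \<Prod>i\<in>S. x i)"
    unfolding kap_def cliques_insert[OF assms]
    using assms(1,2) by (intro sum.union_disjoint) (auto simp: cliques_def)
  also have "(\<Sum>S\<in>insert v ` ?C. \<Prod>i\<in>S. x i) = (\<Sum>S\<in>?C. \<Prod>i\<in>insert v S. x i)"
    by (intro sum.reindex_cong[OF _ refl refl] inj_onI) (metis insert_ident nv(1))
  also have "\<dots> = x v * kap s E x (V \<inter> E `` {v})" unfolding kap_def sum_distrib_left using nv by (intro sum.cong) auto
  finally show ?thesis .
qed

lemma kap_split:
  assumes "finite V" "v \<in> V" "sym E" "irrefl E"
  shows "kap (Suc s) E x V = kap (Suc s) E x (V - {v}) + x v * kap s E x (V \<inter> E `` {v})"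
proof -
  have "(V - {v}) \<inter> E `` {v} = V \<inter> E `` {v}" using assms(4) by (auto simp: irrefl_def)
  then show ?thesis using kap_insert[of "V - {v}" v E s x] assms by (simp add: insert_absorb)
qed

lemma kap_nonneg: "(\<And>v. v \<in> V \<Longrightarrow> 0 \<le> x v) \<Longrightarrow> 0 \<le> kap s E x V"
  unfolding kap_def cliques_def by (intro sum_nonneg prod_nonneg) auto

lemma kap_mono:
  assumes "finite V" "cliques s E U \<subseteq> cliques s F V" "\<And>v. v \<in> V \<Longrightarrow> 0 \<le> x v"
  shows "kap s E x U \<le> kap s F x V"
  unfolding kap_def using assms
  by (intro sum_mono2) (auto intro!: prod_nonneg simp: cliques_def)

lemma kap_mono_set:
  assumes "finite V" "U \<subseteq> V" "\<And>v. v \<in> V \<Longrightarrow> 0 \<le> x v"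
  shows "kap s E x U \<le> kap s E x V"
  using assms by (intro kap_mono cliques_mono) auto

lemma kap_le_power:
  assumes "finite V" "sym E" "\<And>v. v \<in> V \<Longrightarrow> 0 \<le> x v"
  shows "kap s E x V \<le> (\<Sum>v\<in>V. x v) ^ s"
  using assms(1,3)
proof (induction V arbitrary: s rule: finite_induct)
  case empty
  then show ?case by (cases s) auto
next
  case (insert v V)
  show ?case
  proof (cases s)
    case (Suc m)
    let ?X = "\<Sum>v\<in>V. x v"
    have X: "0 \<le> ?X" using insert.prems by (intro sum_nonneg) auto
    have 1: "kap (Suc m) E x V \<le> ?X ^ Suc m" using insert.IH[of "Suc m"] insert.prems by simp
    have "kap m E x (V \<inter> E `` {v}) \<le> kap m E x V" using insert by (intro kap_mono_set) auto
    also have "\<dots> \<le> ?X ^ m" using insert by auto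
    finally have "x v * kap m E x (V \<inter> E `` {v}) \<le> x v * ?X ^ m" using insert.prems by (intro mult_left_mono) auto
    then have "kap (Suc m) E x (insert v V) \<le> ?X ^ Suc m + x v * ?X ^ m"
      using kap_insert[OF insert(1,2) assms(2), of m x] 1 by linarith
    also have "\<dots> = (x v + ?X) * ?X ^ m" by (simp add: algebra_simps)
    also have "\<dots> \<le> (x v + ?X) * (x v + ?X) ^ m" using X insert.prems by (intro mult_left_mono power_mono) auto
    finally show ?thesis using insert Suc by simp
  qed (use insert in auto)
qed

text \<open>A clique that meets \<open>A\<close> is charged to each of its vertices in
  \<open>A\<close>, so the last sum counts it at least once.\<close>

lemma kap_Un_le:
  assumes "finite A" "finite B" "A \<inter> B = {}" "sym E" "irrefl E" "\<And>v. v \<in> A \<union> B \<Longrightarrow> 0 \<le> x v"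
  shows "kap (Suc s) E x (A \<union> B)
      \<le> kap (Suc s) E x B + (\<Sum>u\<in>A. x u * kap s E x ((A \<union> B) \<inter> E `` {u}))"
  using assms(1,3,6)
proof (induction A rule: finite_induct)
  case (insert a A)
  let ?N = "\<lambda>u S. kap s E x (S \<inter> E `` {u})"
  have 1: "kap (Suc s) E x (insert a A \<union> B) = kap (Suc s) E x (A \<union> B) + x a * ?N a (A \<union> B)"
    using kap_insert[of "A \<union> B" a E s x] insert assms by auto
  have 2: "kap (Suc s) E x (A \<union> B) \<le> kap (Suc s) E x B + (\<Sum>u\<in>A. x u * ?N u (A \<union> B))" using insert by auto
  have mono: "x u * ?N u (A \<union> B) \<le> x u * ?N u (insert a A \<union> B)" if "u \<in> insert a A" for u
    using insert that assms(2) by (intro mult_left_mono kap_mono_set) auto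
  have 3: "(\<Sum>u\<in>A. x u * ?N u (A \<union> B)) \<le> (\<Sum>u\<in>A. x u * ?N u (insert a A \<union> B))"
    using mono by (intro sum_mono) auto
  have 4: "(\<Sum>u\<in>insert a A. x u * ?N u (insert a A \<union> B))
      = x a * ?N a (insert a A \<union> B) + (\<Sum>u\<in>A. x u * ?N u (insert a A \<union> B))"
    using insert(1,2) by (rule sum.insert)
  show ?case unfolding 1 4 using 2 3 mono[OF insertI1] by linarith
qed simp

text \<open>A clique uses at most one vertex of the independent set \<open>A\<close>, and every
  vertex of \<open>A\<close> extends every clique in \<open>B\<close>.\<close>

lemma kap_join:
  assumes "finite A" "finite B" "A \<inter> B = {}" "sym E"
    and "\<And>u v. u \<in> A \<Longrightarrow> v \<in> A \<Longrightarrow> (u, v) \<notin> E"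
    and "\<And>u v. u \<in> A \<Longrightarrow> v \<in> B \<Longrightarrow> (u, v) \<in> E"
  shows "kap (Suc s) E x (A \<union> B) = kap (Suc s) E x B + (\<Sum>u\<in>A. x u) * kap s E x B"
  using assms(1,3,5,6)
proof (induction A rule: finite_induct)
  case (insert a A)
  have "(A \<union> B) \<inter> E `` {a} = B" using insert.prems by blast
  then have "kap (Suc s) E x (insert a A \<union> B) = kap (Suc s) E x (A \<union> B) + x a * kap s E x B"
    using kap_insert[of "A \<union> B" a E s x] insert assms by auto
  also have "kap (Suc s) E x (A \<union> B) = kap (Suc s) E x B + (\<Sum>u\<in>A. x u) * kap s E x B" using insert by auto
  finally show ?case using insert(1,2) by (simp add: algebra_simps)
qed simp

text \<open>Euler's identity for a homogeneous polynomial: the neighbourhood terms are its partial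
  derivatives, and each clique is counted once for each of its vertices.\<close>

lemma kap_euler:
  assumes "finite V" "sym E" "irrefl E"
  shows "(\<Sum>v\<in>V. x v * kap s E x (V \<inter> E `` {v})) = real (Suc s) * kap (Suc s) E x V"
proof -
  have eq: "x v * kap s E x (V \<inter> E `` {v})
      = (\<Sum>S\<in>cliques (Suc s) E V. if v \<in> S then \<Prod>i\<in>S. x i else 0)" if "v \<in> V" for v
  proof -
    have "(\<Sum>S\<in>cliques (Suc s) E V. if v \<in> S then \<Prod>i\<in>S. x i else 0)
        = (\<Sum>S\<in>cliques (Suc s) E V. (\<Prod>i\<in>S. x i) - (if v \<notin> S then \<Prod>i\<in>S. x i else 0))"
      by (intro sum.cong) auto
    also have "\<dots> = kap (Suc s) E x V - (\<Sum>S\<in>{S\<in>cliques (Suc s) E V. v \<notin> S}. \<Prod>i\<in>S. x i)"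
      using assms(1) by (simp add: sum_subtractf kap_def sum.inter_filter)
    also have "{S\<in>cliques (Suc s) E V. v \<notin> S} = cliques (Suc s) E (V - {v})" by (auto simp: cliques_def)
    finally show ?thesis using kap_split[OF assms(1) that assms(2,3), of s x] by (simp add: kap_def)
  qed
  have "(\<Sum>v\<in>V. x v * kap s E x (V \<inter> E `` {v}))
      = (\<Sum>v\<in>V. \<Sum>S\<in>cliques (Suc s) E V. if v \<in> S then \<Prod>i\<in>S. x i else 0)"
    by (intro sum.cong eq refl)
  also have "\<dots> = (\<Sum>S\<in>cliques (Suc s) E V. \<Sum>v\<in>V. if v \<in> S then \<Prod>i\<in>S. x i else 0)"
    by (rule sum.swap)
  also have "\<dots> = (\<Sum>S\<in>cliques (Suc s) E V. real (Suc s) * (\<Prod>i\<in>S. x i))"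
  proof (intro sum.cong refl)
    fix S assume "S \<in> cliques (Suc s) E V"
    then have "S \<subseteq> V" "card S = Suc s" by (auto simp: cliques_def)
    then show "(\<Sum>v\<in>V. if v \<in> S then \<Prod>i\<in>S. x i else 0) = real (Suc s) * (\<Prod>i\<in>S. x i)"
      using assms(1) by (simp add: sum.inter_restrict[symmetric] Int_absorb1)
  qed
  finally show ?thesis by (simp add: kap_def sum_distrib_left)
qed

text \<open>Convexity in tangent form. For \<open>s = 0\<close> the truncated exponent is harmless
  because of the factor \<open>real s\<close>.\<close>

lemma power_ge_tangent:
  fixes m y :: real
  assumes "0 \<le> m" "0 \<le> y"
  shows "y ^ s + real s * y ^ (s - 1) * (m - y) \<le> m ^ s"
proof (induction s)
  case (Suc s)
  define A P where "A = y ^ s" and "P = y ^ (s - 1)"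
  have sA: "real s * A = real s * (y * P)" by (cases s) (auto simp: A_def P_def)
  have "y * A + (1 + real s) * A * (m - y) = y * A + A * (m - y) + real s * A * (m - y)" by (simp add: algebra_simps)
  also have "\<dots> = m * (A + real s * P * (m - y)) - real s * P * (m - y)\<^sup>2"
    unfolding sA by (simp add: algebra_simps power2_eq_square)
  also have "\<dots> \<le> m * (A + real s * P * (m - y))" using assms by (simp add: P_def)
  also have "\<dots> \<le> m * m ^ s" using Suc assms unfolding A_def P_def by (intro mult_left_mono) auto
  finally show ?case by (simp add: A_def)
qed simp

text \<open>A weighted Motzkin-Straus bound, proved by Zykov symmetrisation: the right-hand side is
  the value on a complete \<open>q\<close>-partite graph with parts of equal weight. Choose a vertex
  whose neighbourhood has the largest clique polynomial; its non-neighbours do no better than copies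
  of it, and its neighbourhood is free of cliques one size smaller.\<close>

lemma kap_clique_free_le:
  fixes x :: "'a \<Rightarrow> real"
  assumes "finite V" "sym E" "irrefl E" "cliques (Suc q) E V = {}" "\<And>v. v \<in> V \<Longrightarrow> 0 \<le> x v"
  shows "kap s E x V \<le> real (q choose s) * ((\<Sum>v\<in>V. x v) / real q) ^ s"
  using assms(1,4,5)
proof (induction q arbitrary: s V)
  case 0
  have "V = {}"
  proof (rule ccontr)
    assume "V \<noteq> {}"
    then obtain v where "v \<in> V" by blast
    then have "{v} \<in> cliques (Suc 0) E V" by (auto simp: cliques_def)
    then show False using 0 by blast
  qed
  then show ?case by (cases s) auto
next
  case (Suc q)
  show ?case
  proof (cases "s = 0 \<or> V = {}")
    case True
    then show ?thesis using Suc by (cases s) auto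
  next
    case False
    then obtain s' where s: "s = Suc s'" and ne: "V \<noteq> {}" by (cases s) auto
    define g where "g v = kap s' E x (V \<inter> E `` {v})" for v
    have "finite (g ` V)" "g ` V \<noteq> {}" using Suc.prems ne by auto
    then have "Max (g ` V) \<in> g ` V" by (rule Max_in)
    then obtain v where v: "v \<in> V" "g v = Max (g ` V)" by auto
    have gmax: "g u \<le> g v" if "u \<in> V" for u using v that Suc.prems(1) by simp
    define A where "A = V - E `` {v}"
    define B where "B = V \<inter> E `` {v}"
    have fin: "finite A" "finite B" and AB: "A \<inter> B = {}" "A \<union> B = V" using Suc.prems by (auto simp: A_def B_def)
    define a where "a = (\<Sum>u\<in>A. x u)"
    define b where "b = (\<Sum>u\<in>B. x u)"
    define y where "y = b / real q"
    have nn: "0 \<le> a" "0 \<le> b" using Suc.prems(3) AB(2) unfolding a_def b_def by (auto intro!: sum_nonneg)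
    have X: "(\<Sum>u\<in>V. x u) = a + b" unfolding a_def b_def AB(2)[symmetric] using fin AB(1) by (rule sum.union_disjoint)
    have Bfree: "cliques (Suc q) E B = {}"
    proof (rule ccontr)
      assume "cliques (Suc q) E B \<noteq> {}"
      then obtain S where S: "S \<in> cliques (Suc q) E B" by blast
      then have "v \<notin> S" "S \<subseteq> E `` {v}" "S \<in> cliques (Suc q) E V"
        using assms(3) by (auto simp: cliques_def B_def irrefl_def)
      then have "insert v S \<in> cliques (Suc (Suc q)) E (insert v V)" using clique_insert Suc.prems(1) assms(2) by metis
      then show False using v Suc.prems(2) by (simp add: insert_absorb)
    qed
    \<comment> \<open>For \<open>q = 0\<close> division by zero makes \<open>y = 0\<close>, so the
      identity needs that \<open>B\<close> is then empty.\<close>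
    have b: "b = real q * y"
    proof (cases q)
      case 0
      have "B = {}"
      proof (rule ccontr)
        assume "B \<noteq> {}"
        then obtain u where "u \<in> B" by blast
        then have "{u} \<in> cliques (Suc q) E B" using 0 by (auto simp: cliques_def)
        then show False using Bfree by blast
      qed
      then show ?thesis using 0 by (simp add: b_def)
    qed (simp add: y_def)
    have IH: "kap j E x B \<le> real (q choose j) * y ^ j" for j
      using Suc.IH[of B j] Bfree fin(2) Suc.prems(3) AB(2) unfolding y_def b_def by auto
    have "kap s E x V \<le> kap s E x B + (\<Sum>u\<in>A. x u * g u)"
      using kap_Un_le[OF fin AB(1) assms(2,3), of x s'] Suc.prems(3) AB(2) by (simp add: s g_def)
    also have "(\<Sum>u\<in>A. x u * g u) \<le> (\<Sum>u\<in>A. x u * g v)"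
      using gmax Suc.prems(3) AB(2) by (intro sum_mono mult_left_mono) auto
    also have "\<dots> = a * kap s' E x B" by (simp add: a_def g_def B_def sum_distrib_right)
    also have "kap s E x B + a * kap s' E x B
        \<le> real (q choose s) * y ^ s + a * (real (q choose s') * y ^ s')"
      using IH nn(1) by (intro add_mono mult_left_mono) auto
    \<comment> \<open>With \<open>b\<close> fixed the left side is affine in \<open>a\<close>. It is
      the tangent of the right side at \<open>a = y\<close>, where all \<open>Suc q\<close> parts
      have equal weight.\<close>
    also have "\<dots> \<le> real (Suc q choose s) * ((a + b) / real (Suc q)) ^ s"
    proof -
      let ?m = "(a + b) / real (Suc q)"
      define K where "K = real (Suc q choose s)"
      have m: "?m - y = (a - y) / real (Suc q)" using b by (simp add: field_simps)
      have c1: "K * real s = real (Suc q) * real (q choose s')" using Suc_times_binomial[of s' q] unfolding K_def s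
        by (metis mult.commute of_nat_mult)
      have c2: "K = real (q choose s) + real (q choose s')" unfolding K_def s by simp
      have "real (q choose s) * y ^ s + a * (real (q choose s') * y ^ s')
         = K * y ^ s + real (q choose s') * y ^ s' * (a - y)"
        unfolding c2 by (simp add: s algebra_simps)
      also have "\<dots> = K * y ^ s + K * real s / real (Suc q) * y ^ s' * (a - y)" unfolding c1 by simp
      also have "\<dots>
          = K * (y ^ s + real s * y ^ (s - 1) * (?m - y))"
        unfolding m by (simp add: s field_simps)
      also have "\<dots> \<le> K * ?m ^ s" using nn by (intro mult_left_mono power_ge_tangent) (auto simp: y_def K_def)
      finally show ?thesis unfolding K_def .
    qed
    finally show ?thesis using X by simp
  qed
qed

section \<open>The spectral radius as a maximum\<close>

abbreviation rho :: "nat \<Rightarrow> ('a \<times> 'a) set \<Rightarrow> 'a set \<Rightarrow> real" where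
  "rho t E V \<equiv> clique_spectral_radius t \<lparr> pverts = V, parcs = E \<rparr>"

lemma rho_pverts_parcs: "rho t (parcs G) (pverts G) = clique_spectral_radius t G"
  by (cases G) simp

text \<open>Each \<open>s\<close>-clique in the neighbourhood of \<open>j\<close> arises from its
  \<open>fact s\<close> orderings, which cancels the factor in the tensor; lists with repeated
  entries span too few vertices to contribute.\<close>

lemma tensor_apply_clique_tensor:
  assumes "finite V" "j \<in> V" "sym E" "irrefl E"
  shows "tensor_apply (Suc s) V (clique_tensor (Suc s) \<lparr> pverts = V, parcs = E \<rparr>) x j
      = (\<Sum>S\<in>cliques s E (V \<inter> E `` {j}). \<Prod>i\<in>S. x i)"
proof -
  let ?C = "cliques s E (V \<inter> E `` {j})"
  let ?T = "clique_tensor (Suc s) \<lparr> pverts = V, parcs = E \<rparr>"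
  let ?L = "{is. set is \<subseteq> V \<and> length is = s}"
  have finL: "finite ?L" using finite_lists_length_eq[OF assms(1)] by simp
  have sub: "is \<in> ?L \<and> set (j # is) \<in> cliques (Suc s) E V \<longleftrightarrow> is \<in> \<Union> (permutations_of_set ` ?C)" for "is"
  proof
    assume L: "is \<in> ?L \<and> set (j # is) \<in> cliques (Suc s) E V"
    then have c: "card (set (j # is)) = Suc s" by (simp add: cliques_def)
    have "card (set is) \<le> s" using L card_length[of "is"] by simp
    with c have "j \<notin> set is" "card (set is) = s"
      by (auto simp: card_insert_if split: if_splits)
    moreover from this have "distinct is" using L by (simp add: card_distinct)
    moreover have "set is \<in> ?C" using L calculation by (auto simp: cliques_def)
    ultimately show "is \<in> \<Union> (permutations_of_set ` ?C)" by (auto simp: permutations_of_set_def)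
  next
    assume "is \<in> \<Union> (permutations_of_set ` ?C)"
    then have S: "set is \<in> ?C" "distinct is" by (auto simp: permutations_of_set_def)
    then have "length is = s" by (simp add: cliques_def distinct_card)
    moreover have "set is \<subseteq> V" "j \<notin> set is" "set is \<subseteq> E `` {j}"
      using S assms(4) by (auto simp: cliques_def irrefl_def)
    moreover have "set is \<in> cliques s E V" using S(1) cliques_mono[of E E "V \<inter> E `` {j}" V] by blast
    ultimately show "is \<in> ?L \<and> set (j # is) \<in> cliques (Suc s) E V"
      using clique_insert[of "set is" s E V j] assms by (simp add: insert_absorb)
  qed
  have "tensor_apply (Suc s) V ?T x j
      = (\<Sum>is\<in>?L. if set (j # is) \<in> cliques (Suc s) E V then (\<Prod>i\<leftarrow>is. x i) / fact s else 0)"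
    unfolding tensor_apply_def clique_tensor_def clique_sets_eq_cliques by (simp add: if_distrib cong: if_cong)
      (intro sum.cong, auto)
  also have "\<dots> = (\<Sum>is\<in>{is\<in>?L. set (j # is) \<in> cliques (Suc s) E V}. (\<Prod>i\<leftarrow>is. x i) / fact s)"
    by (rule sum.inter_filter[OF finL, symmetric])
  also have "{is\<in>?L. set (j # is) \<in> cliques (Suc s) E V} = \<Union> (permutations_of_set ` ?C)" using sub by blast
  also have "(\<Sum>is\<in>\<Union> (permutations_of_set ` ?C). (\<Prod>i\<leftarrow>is. x i) / fact s)
      = (\<Sum>S\<in>?C. \<Sum>is\<in>permutations_of_set S. (\<Prod>i\<leftarrow>is. x i) / fact s)"
    using assms(1) by (intro sum.UNION_disjoint) (auto, auto simp: permutations_of_set_def)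
  also have "\<dots> = (\<Sum>S\<in>?C. \<Prod>i\<in>S. x i)"
  proof (intro sum.cong refl)
    fix S assume S: "S \<in> ?C"
    then have "finite S" "card S = s" using assms(1) finite_subset[of S V] by (auto simp: cliques_def)
    moreover have "(\<Sum>is\<in>permutations_of_set S. (\<Prod>i\<leftarrow>is. x i) / fact s)
        = (\<Sum>is\<in>permutations_of_set S. (\<Prod>i\<in>S. x i) / fact s)"
      by (intro sum.cong refl) (auto simp: permutations_of_set_def prod.distinct_set_conv_list)
    ultimately show "(\<Sum>is\<in>permutations_of_set S. (\<Prod>i\<leftarrow>is. x i) / fact s) = (\<Prod>i\<in>S. x i)" by simp
  qed
  finally show ?thesis .
qed

lemma kap_scale: "kap s E (\<lambda>v. c * x v) V = c ^ s * kap s E x V"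
  unfolding kap_def sum_distrib_left
  by (intro sum.cong refl) (simp add: prod.distrib cliques_def)

lemma kap_maximiser_exists:
  assumes "finite V" "V \<noteq> {}" "0 < t"
  shows "\<exists>x. (\<forall>v. 0 \<le> x v) \<and> (\<Sum>v\<in>V. x v ^ t) = real (card V) \<and>
    (\<forall>y. (\<forall>v\<in>V. 0 \<le> y v) \<longrightarrow> (\<Sum>v\<in>V. y v ^ t) = real (card V) \<longrightarrow> kap t E y V \<le> kap t E x V)"
proof -
  define N where "N = real (card V)"
  have N1: "1 \<le> N" using assms by (simp add: N_def Suc_le_eq card_gt_0_iff)
  \<comment> \<open>Coordinates outside \<open>V\<close> are pinned to 0, so the box is compact in
    the product over the whole type. The upper end \<open>N\<close> suffices: an entry above 1 is at
    most its own \<open>t\<close>-th power, hence at most the prescribed sum.\<close>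
  define B where "B = (\<lambda>v. if v \<in> V then {0..N} else {0::real})"
  have "compactin (product_topology (\<lambda>_::'a. euclidean) UNIV) (PiE UNIV B)" unfolding compactin_PiE by (auto simp: B_def)
  then have cB: "compact (PiE UNIV B)" by (simp add: euclidean_product_topology)
  define K where "K = PiE UNIV B \<inter> {x. (\<Sum>v\<in>V. x v ^ t) = N}"
  have "closed {x :: 'a \<Rightarrow> real. (\<Sum>v\<in>V. x v ^ t) = N}"
    by (intro closed_Collect_eq continuous_intros continuous_on_product_coordinates)
  then have cK: "compact K" unfolding K_def using cB by (rule compact_Int_closed[rotated])
  have "(\<lambda>v. if v \<in> V then 1 else 0) \<in> K" using N1 by (auto simp: K_def B_def N_def)
  then have ne: "K \<noteq> {}" by blast
  have cont: "continuous_on K (\<lambda>x. kap t E x V)" unfolding kap_def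
    by (intro continuous_intros continuous_on_subset[OF continuous_on_product_coordinates]) auto
  obtain x where x: "x \<in> K" "\<And>y. y \<in> K \<Longrightarrow> kap t E y V \<le> kap t E x V"
    using continuous_attains_sup[OF cK ne cont] by blast
  have xnn: "0 \<le> x v" for v
  proof -
    have "x v \<in> B v" using x(1) by (auto simp: K_def)
    then show ?thesis by (auto simp: B_def split: if_splits)
  qed
  have "kap t E y V \<le> kap t E x V" if y: "\<forall>v\<in>V. 0 \<le> y v" "(\<Sum>v\<in>V. y v ^ t) = N" for y
  proof -
    define z where "z v = (if v \<in> V then y v else 0)" for v
    have "y v \<le> N" if v: "v \<in> V" for v
    proof (cases "y v \<le> 1")
      case False
      have "y v \<le> y v ^ t" using False assms(3) by (intro self_le_power) auto
      also have "\<dots> \<le> (\<Sum>v\<in>V. y v ^ t)" using y(1) v assms(1) by (intro member_le_sum) auto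
      finally show ?thesis using y(2) by simp
    qed (use N1 in simp)
    then have "z \<in> K" using y by (auto simp: K_def B_def z_def)
    moreover have "kap t E z V = kap t E y V" by (rule kap_cong) (simp add: z_def)
    ultimately show ?thesis using x(2) by fastforce
  qed
  then show ?thesis using x(1) xnn unfolding K_def N_def by blast
qed

text \<open>At a maximiser, both sides of \<open>t \<cdot> kap \<le> M \<cdot> sum of t-th powers\<close> are functions of a single
  coordinate, an affine one and a power, that touch; comparing them gives the eigenvalue equation.\<close>

lemma eigen_equation_of_touching:
  fixes M a b c d :: real
  assumes t: "2 \<le> t" and a: "0 \<le> a" and b: "0 \<le> b"
    and le: "\<And>z. 0 \<le> z \<Longrightarrow> real t * (c + z * b) \<le> M * (d + z ^ t)"
    and eq: "real t * (c + a * b) = M * (d + a ^ t)"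
  shows "M * a ^ (t - 1) = b"
proof (cases "a = 0")
  case False
  define h where "h z = M * (d + z ^ t) - real t * (c + z * b)" for z
  have D: "DERIV h a :> M * (real t * a ^ (t - 1)) - real t * b" unfolding h_def by (auto intro!: derivative_eq_intros)
  have "\<forall>z. \<bar>a - z\<bar> < a \<longrightarrow> h a \<le> h z" using le eq a by (auto simp: h_def)
  with D have "M * (real t * a ^ (t - 1)) - real t * b = 0"
    using False a by (intro DERIV_local_min[of h _ a a]) auto
  then have "real t * (M * a ^ (t - 1)) = real t * b" by (simp add: algebra_simps)
  then show ?thesis using t by simp
next
  case True
  \<comment> \<open>At the boundary point 0 there is no two-sided minimum. Touching gives
    \<open>real t * b \<le> M * z ^ (t - 1)\<close> for all \<open>z > 0\<close>, and then
    \<open>z\<close> tends to 0.\<close>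
  obtain s where s: "t = Suc (Suc s)" using t by (metis add_2_eq_Suc le_Suc_ex)
  have le': "real t * b \<le> M * z ^ Suc s" if "0 < z" for z
  proof -
    have "z * (real t * b) \<le> z * (M * z ^ Suc s)" using le[of z] eq that True by (simp add: s algebra_simps)
    then show ?thesis using that by (rule mult_left_le_imp_le)
  qed
  have "((\<lambda>z. M * z ^ Suc s) \<longlongrightarrow> M * 0 ^ Suc s) (at_right 0)" by (intro tendsto_intros)
  then have "real t * b \<le> M * 0 ^ Suc s"
    by (rule tendsto_lowerbound) (auto intro!: eventually_at_rightI[of 0 1] le' simp del: power_Suc)
  then have "b = 0" using b t by (simp add: mult_le_0_iff)
  then show ?thesis using True s by simp
qed

text \<open>The maximiser of the clique polynomial satisfies the eigenvalue equation, so the maximum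
  \<open>M\<close> is an eigenvalue. Conversely the moduli of the entries of any eigenvector form a
  test vector, and the triangle inequality with Euler's identity bounds the modulus of its
  eigenvalue by \<open>M\<close>. This identifies the value of \<open>GREATEST\<close>, and the last
  conclusion keeps the variational bound for later test vectors.\<close>

lemma perron:
  assumes V: "finite V" "V \<noteq> {}" and E: "sym E" "irrefl E" and t: "2 \<le> t"
  obtains x where "\<And>v. 0 \<le> x v" "(\<Sum>v\<in>V. x v ^ t) = real (card V)"
    "real t * kap t E x V = rho t E V * real (card V)"
    "\<And>v. v \<in> V \<Longrightarrow> rho t E V * x v ^ (t - 1) = kap (t - 1) E x (V \<inter> E `` {v})"
    "\<And>y. (\<And>v. v \<in> V \<Longrightarrow> 0 \<le> y v) \<Longrightarrow> real t * kap t E y V \<le> rho t E V * (\<Sum>v\<in>V. y v ^ t)"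
proof -
  obtain s where s: "t = Suc s" using t by (cases t) auto
  define N where "N = real (card V)"
  have N: "0 < N" using V by (simp add: N_def card_gt_0_iff)
  have "0 < t" using t by simp
  from kap_maximiser_exists[OF V this, of E, folded N_def]
  obtain x where x': "\<forall>v. 0 \<le> x v" "(\<Sum>v\<in>V. x v ^ t) = N"
    "\<forall>y. (\<forall>v\<in>V. 0 \<le> y v) \<longrightarrow> (\<Sum>v\<in>V. y v ^ t) = N \<longrightarrow> kap t E y V \<le> kap t E x V"
    by (elim exE conjE) (rule that)
  then have x: "0 \<le> x v" "(\<Sum>v\<in>V. x v ^ t) = N"
    "(\<And>v. v \<in> V \<Longrightarrow> 0 \<le> y v) \<Longrightarrow> (\<Sum>v\<in>V. y v ^ t) = N \<Longrightarrow> kap t E y V \<le> kap t E x V" for v y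
    by simp_all
  define M where "M = real t * kap t E x V / N"
  have M: "real t * kap t E x V = M * N" using N by (simp add: M_def)
  have M0: "0 \<le> M" unfolding M_def using N x(1) by (simp add: kap_nonneg)
  have up: "real t * kap t E y V \<le> M * (\<Sum>v\<in>V. y v ^ t)" if y: "\<And>v. v \<in> V \<Longrightarrow> 0 \<le> y v" for y
  proof -
    define Y where "Y = (\<Sum>v\<in>V. y v ^ t)"
    have Y0: "0 \<le> Y" unfolding Y_def using y by (intro sum_nonneg) simp
    show ?thesis
    proof (cases "Y = 0")
      case True
      then have "y v ^ t = 0" if "v \<in> V" for v using that y V(1) unfolding Y_def by (subst (asm) sum_nonneg_eq_0_iff) auto
      then have "y v = 0 * y v" if "v \<in> V" for v using that t by auto
      then have "kap t E y V = kap t E (\<lambda>v. 0 * y v) V" by (rule kap_cong)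
      also have "\<dots> = 0" unfolding kap_scale using t by simp
      finally show ?thesis using M0 Y0 by (simp add: Y_def)
    next
      case False
      with Y0 have Y: "0 < Y" by simp
      define c where "c = root t (N / Y)"
      have c: "c ^ t = N / Y" using N Y t by (simp add: c_def)
      have c0: "0 \<le> c" using N Y t by (simp add: c_def)
      have "(\<Sum>v\<in>V. (c * y v) ^ t) = c ^ t * Y" by (simp add: Y_def power_mult_distrib sum_distrib_left)
      then have "kap t E (\<lambda>v. c * y v) V \<le> kap t E x V" using c Y y c0 by (intro x(3)) auto
      then have "real t * (N / Y * kap t E y V) \<le> M * N" unfolding kap_scale c M[symmetric] using t by (intro mult_left_mono) auto
      then show ?thesis using N Y unfolding Y_def[symmetric] by (simp add: field_simps)
    qed
  qed
  have eig: "M * x v ^ (t - 1) = kap s E x (V \<inter> E `` {v})" if v: "v \<in> V" for v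
  proof (rule eigen_equation_of_touching[OF t])
    have eq: "kap t E (x(v := z)) V = kap t E x (V - {v}) + z * kap s E x (V \<inter> E `` {v})" for z
    proof -
      have "v \<notin> V \<inter> E `` {v}" using E(2) by (auto simp: irrefl_def)
      then have "kap s E (x(v := z)) (V \<inter> E `` {v}) = kap s E x (V \<inter> E `` {v})" by (intro kap_cong) auto
      moreover have "kap t E (x(v := z)) (V - {v}) = kap t E x (V - {v})" by (intro kap_cong) auto
      ultimately show ?thesis using kap_split[OF V(1) v E, of s "x(v := z)"] s by simp
    qed
    have sq: "(\<Sum>u\<in>V. (x(v := z)) u ^ t) = (\<Sum>u\<in>V - {v}. x u ^ t) + z ^ t" for z
    proof -
      have "(\<Sum>u\<in>V - {v}. (x(v := z)) u ^ t) = (\<Sum>u\<in>V - {v}. x u ^ t)" by (intro sum.cong) auto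
      then show ?thesis using sum.remove[OF V(1) v, of "\<lambda>u. (x(v := z)) u ^ t"] by simp
    qed
    show "0 \<le> x v" by (rule x(1))
    show "0 \<le> kap s E x (V \<inter> E `` {v})" using x(1) by (rule kap_nonneg)
    show "real t * (kap t E x (V - {v}) + z * kap s E x (V \<inter> E `` {v}))
        \<le> M * ((\<Sum>u\<in>V - {v}. x u ^ t) + z ^ t)" if "0 \<le> z" for z
      using up[of "x(v := z)"] that x(1) unfolding eq sq by simp
    show "real t * (kap t E x (V - {v}) + x v * kap s E x (V \<inter> E `` {v}))
        = M * ((\<Sum>u\<in>V - {v}. x u ^ t) + x v ^ t)"
      using M x(2) eq[of "x v"] sq[of "x v"] by simp
  qed
  let ?T = "clique_tensor t \<lparr> pverts = V, parcs = E \<rparr>"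
  have ap: "tensor_apply t V ?T z j = (\<Sum>S\<in>cliques s E (V \<inter> E `` {j}). \<Prod>i\<in>S. z i)" if "j \<in> V" for z j
    using tensor_apply_clique_tensor[OF V(1) that E] s by simp
  have rho: "rho t E V = M" unfolding clique_spectral_radius_def
  proof (rule Greatest_equality)
    have "tensor_apply t V ?T (\<lambda>v. complex_of_real (x v)) j = complex_of_real M * complex_of_real (x j) ^ (t - 1)"
      if "j \<in> V" for j
      using arg_cong[OF eig[OF that], of complex_of_real] ap[OF that] by (simp add: kap_def)
    moreover have "\<exists>j\<in>V. complex_of_real (x j) \<noteq> 0"
    proof (rule ccontr)
      assume "\<not> (\<exists>j\<in>V. complex_of_real (x j) \<noteq> 0)"
      then have "(\<Sum>v\<in>V. x v ^ t) = 0" using t by (intro sum.neutral) auto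
      then show False using x(2) N by simp
    qed
    ultimately have "tensor_eigenvalue t V ?T (complex_of_real M)"
      unfolding tensor_eigenvalue_def by (intro exI[of _ "\<lambda>v. complex_of_real (x v)"] conjI ballI)
    then show "\<exists>\<mu>. tensor_eigenvalue t (pverts \<lparr>pverts = V, parcs = E\<rparr>) ?T \<mu> \<and> M = cmod \<mu>"
      using M0 by (intro exI[of _ "complex_of_real M"]) simp
  next
    fix m assume "\<exists>\<mu>. tensor_eigenvalue t (pverts \<lparr>pverts = V, parcs = E\<rparr>) ?T \<mu> \<and> m = cmod \<mu>"
    then obtain \<mu> z j where m: "m = cmod \<mu>" and j: "j \<in> V" "z j \<noteq> 0"
      and z: "\<And>j. j \<in> V \<Longrightarrow> tensor_apply t V ?T z j = \<mu> * z j ^ (t - 1)"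
      unfolding tensor_eigenvalue_def by auto
    define y where "y v = cmod (z v)" for v
    have "m * y v ^ (t - 1) \<le> kap s E y (V \<inter> E `` {v})" if "v \<in> V" for v
    proof -
      have "m * y v ^ (t - 1) = cmod (\<Sum>S\<in>cliques s E (V \<inter> E `` {v}). \<Prod>i\<in>S. z i)"
        using z[OF that] ap[OF that] by (simp add: m y_def norm_mult norm_power)
      also have "\<dots> \<le> kap s E y (V \<inter> E `` {v})"
        unfolding kap_def by (rule order_trans[OF norm_sum]) (simp add: y_def prod_norm)
      finally show ?thesis .
    qed
    then have "(\<Sum>v\<in>V. y v * (m * y v ^ (t - 1))) \<le> (\<Sum>v\<in>V. y v * kap s E y (V \<inter> E `` {v}))"
      by (intro sum_mono mult_left_mono) (auto simp: y_def)
    also have "\<dots> = real t * kap t E y V" using kap_euler[OF V(1) E, of y s] s by simp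
    also have "\<dots> \<le> M * (\<Sum>v\<in>V. y v ^ t)" by (rule up) (simp add: y_def)
    finally have "m * (\<Sum>v\<in>V. y v ^ t) \<le> M * (\<Sum>v\<in>V. y v ^ t)" by (simp add: s sum_distrib_left mult.left_commute)
    moreover have "0 < (\<Sum>v\<in>V. y v ^ t)" using V(1) j by (intro sum_pos2[of _ j]) (auto simp: y_def)
    ultimately show "m \<le> M" by simp
  qed
  show thesis
  proof (rule that[of x])
    show "real t * kap t E x V = rho t E V * real (card V)" using M rho N_def by simp
    show "rho t E V * x v ^ (t - 1) = kap (t - 1) E x (V \<inter> E `` {v})" if "v \<in> V" for v using eig[OF that] rho s by simp
    show "real t * kap t E y V \<le> rho t E V * (\<Sum>v\<in>V. y v ^ t)"
      if "\<And>v. v \<in> V \<Longrightarrow> 0 \<le> y v" for y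
      using up[OF that] rho by simp
  qed (use x N_def in auto)
qed

section \<open>Joins of a clique with a complete multipartite graph\<close>

lemma rho_upper:
  assumes "finite V" "V \<noteq> {}" "sym E" "irrefl E" "2 \<le> t" "\<And>v. v \<in> V \<Longrightarrow> 0 \<le> y v"
  shows "real t * kap t E y V \<le> rho t E V * (\<Sum>v\<in>V. y v ^ t)"
  using perron[OF assms(1-5)] assms(6) by metis

lemma rho_nonneg:
  assumes "finite V" "V \<noteq> {}" "sym E" "irrefl E" "2 \<le> t"
  shows "0 \<le> rho t E V"
proof -
  obtain x where x: "\<And>v. 0 \<le> x v" "real t * kap t E x V = rho t E V * real (card V)" using perron[OF assms] by metis
  have "0 \<le> rho t E V * real (card V)" unfolding x(2)[symmetric] using x(1) by (simp add: kap_nonneg)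
  then show ?thesis using assms(1,2) by (simp add: zero_le_mult_iff card_gt_0_iff)
qed

section \<open>Invariance of the spectral radius under isomorphism\<close>

lemma rho_hom_le:
  assumes V: "finite V" "V \<noteq> {}" and E: "sym E" "irrefl E" "sym E'" "irrefl E'" and t: "2 \<le> t"
    and f: "bij_betw f V V'"
    and hom: "\<And>u v. u \<in> V \<Longrightarrow> v \<in> V \<Longrightarrow> (u, v) \<in> E \<Longrightarrow> (f u, f v) \<in> E'"
  shows "rho t E V \<le> rho t E' V'"
proof -
  obtain x where x: "\<And>v. 0 \<le> x v" "(\<Sum>v\<in>V. x v ^ t) = real (card V)"
    "real t * kap t E x V = rho t E V * real (card V)"
    using perron[OF V E(1,2) t] by metis
  have inj: "inj_on f V" and V': "V' = f ` V" using f by (auto simp: bij_betw_def)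
  have V'f: "finite V'" "V' \<noteq> {}" "card V' = card V" using V V' inj by (auto simp: card_image)
  define y where "y = x \<circ> inv_into V f"
  have yf: "y (f v) = x v" if "v \<in> V" for v using that inj by (simp add: y_def)
  have "kap t E x V = (\<Sum>S\<in>cliques t E V. \<Prod>i\<in>f ` S. y i)" unfolding kap_def
  proof (intro sum.cong refl)
    fix S assume "S \<in> cliques t E V"
    then have "S \<subseteq> V" by (auto simp: cliques_def)
    then have "inj_on f S" "\<forall>i\<in>S. y (f i) = x i" using inj inj_on_subset yf by auto
    then show "(\<Prod>i\<in>S. x i) = (\<Prod>i\<in>f ` S. y i)" by (simp add: prod.reindex)
  qed
  also have "\<dots> = (\<Sum>T\<in>(`) f ` cliques t E V. \<Prod>i\<in>T. y i)"
    using inj by (intro sum.reindex_cong[of "(`) f", symmetric] refl inj_onI)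
      (auto simp: cliques_def inj_on_image_eq_iff)
  also have "\<dots> \<le> kap t E' y V'" unfolding kap_def
  proof (rule sum_mono2)
    show "(`) f ` cliques t E V \<subseteq> cliques t E' V'"
    proof clarify
      fix S assume S: "S \<in> cliques t E V"
      then have "inj_on f S" "S \<subseteq> V" using inj inj_on_subset by (auto simp: cliques_def)
      moreover have "(f u, f v) \<in> E'" if "u \<in> S" "v \<in> S" "f u \<noteq> f v" for u v
      proof -
        have "u \<noteq> v" using that(3) by auto
        then have "(u, v) \<in> E" "u \<in> V" "v \<in> V" using S that(1,2) by (auto simp: cliques_def)
        then show ?thesis by (intro hom)
      qed
      ultimately show "f ` S \<in> cliques t E' V'" using S V' by (auto simp: cliques_def card_image)
    qed
  qed (use V'f x(1) in \<open>auto intro!: prod_nonneg simp: y_def\<close>)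
  finally have "rho t E V * real (card V) \<le> real t * kap t E' y V'" unfolding x(3)[symmetric] by (simp add: mult_left_mono)
  also have "\<dots> \<le> rho t E' V' * (\<Sum>v\<in>V'. y v ^ t)" using V'f E t x(1) by (intro rho_upper) (auto simp: y_def)
  also have "(\<Sum>v\<in>V'. y v ^ t) = real (card V)" unfolding V' using inj yf x(2) by (simp add: sum.reindex)
  finally show ?thesis using V by (simp add: card_gt_0_iff)
qed

definition iso_on :: "'a set \<Rightarrow> ('a \<times> 'a) set \<Rightarrow> 'b set \<Rightarrow> ('b \<times> 'b) set \<Rightarrow> bool" where
  "iso_on V E V' E' \<longleftrightarrow>
    (\<exists>f. bij_betw f V V' \<and> (\<forall>u\<in>V. \<forall>v\<in>V. (u, v) \<in> E \<longleftrightarrow> (f u, f v) \<in> E'))"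

lemma rho_iso:
  assumes "finite V" "V \<noteq> {}" "sym E" "irrefl E" "sym E'" "irrefl E'" "2 \<le> t"
    and "iso_on V E V' E'"
  shows "rho t E V = rho t E' V'"
proof (rule antisym)
  obtain f where f: "bij_betw f V V'"
    and iff: "\<And>u v. u \<in> V \<Longrightarrow> v \<in> V \<Longrightarrow> (u, v) \<in> E \<longleftrightarrow> (f u, f v) \<in> E'"
    using assms(8) unfolding iso_on_def by blast
  show "rho t E V \<le> rho t E' V'" using assms f iff by (intro rho_hom_le[where f = f]) auto
  let ?g = "inv_into V f"
  have g: "?g v \<in> V" "f (?g v) = v" if "v \<in> V'" for v using that f by (auto simp: bij_betw_def inv_into_into f_inv_into_f)
  have "finite V'" "V' \<noteq> {}" using assms(1,2) f by (auto simp: bij_betw_def)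
  then show "rho t E' V' \<le> rho t E V" using assms f iff g by (intro rho_hom_le[where f = ?g] bij_betw_inv_into) auto
qed

text \<open>Colour \<open>r\<close> marks the vertices adjacent to everything; the colours below \<open>r\<close> mark the
  independent parts.\<close>

definition jn :: "nat \<Rightarrow> 'a set \<Rightarrow> ('a \<Rightarrow> nat) \<Rightarrow> ('a \<times> 'a) set" where
  "jn r V c = {(u, v). u \<in> V \<and> v \<in> V \<and> u \<noteq> v \<and> (c u \<noteq> c v \<or> c u = r)}"

lemma sym_jn [simp]: "sym (jn r V c)" and irrefl_jn [simp]: "irrefl (jn r V c)"
  by (auto simp: jn_def sym_def irrefl_def)

lemma kap_cong_edges:
  assumes "\<And>u v. u \<in> V \<Longrightarrow> v \<in> V \<Longrightarrow> u \<noteq> v \<Longrightarrow> (u, v) \<in> E \<longleftrightarrow> (u, v) \<in> F"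
  shows "kap s E x V = kap s F x V"
proof -
  have "cliques s E V = cliques s F V" unfolding cliques_def
  proof (intro Collect_cong conj_cong refl ball_cong imp_cong)
    fix S u v assume "S \<subseteq> V" "u \<in> S" "v \<in> S" "u \<noteq> v"
    then show "(u, v) \<in> E \<longleftrightarrow> (u, v) \<in> F" using assms by auto
  qed
  then show ?thesis by (simp add: kap_def)
qed

lemma kap_jn_class:
  assumes "finite V" "U \<subseteq> V" "p \<noteq> r" "P = {v \<in> U. c v = p}"
  shows "kap (Suc s) (jn r V c) x U
      = kap (Suc s) (jn r V c) x (U - P) + (\<Sum>v\<in>P. x v) * kap s (jn r V c) x (U - P)"
proof -
  have "finite U" using assms finite_subset by blast
  have "kap (Suc s) (jn r V c) x (P \<union> (U - P))
      = kap (Suc s) (jn r V c) x (U - P) + (\<Sum>v\<in>P. x v) * kap s (jn r V c) x (U - P)"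
    using assms \<open>finite U\<close> by (intro kap_join sym_jn) (auto simp: jn_def)
  moreover have "P \<union> (U - P) = U" using assms(4) by auto
  ultimately show ?thesis by simp
qed

text \<open>Dropping a vertex from a clique of positive weight leaves a smaller clique of positive
  weight.\<close>

lemma kap_Suc_eq_0:
  assumes "finite V" "\<And>v. v \<in> V \<Longrightarrow> 0 \<le> x v" "kap s E x V = 0"
  shows "kap (Suc s) E x V = 0"
  unfolding kap_def
proof (rule sum.neutral, rule ballI)
  fix S assume S: "S \<in> cliques (Suc s) E V"
  then have fS: "finite S" using assms(1) finite_subset by (auto simp: cliques_def)
  from S have "S \<noteq> {}" by (auto simp: cliques_def)
  then obtain u where u: "u \<in> S" by blast
  have 1: "S - {u} \<in> cliques s E V" using S u fS by (auto simp: cliques_def)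
  have "\<forall>T\<in>cliques s E V. 0 \<le> (\<Prod>i\<in>T. x i)" using assms(2) by (auto simp: cliques_def intro!: prod_nonneg)
  then have "(\<Prod>i\<in>S - {u}. x i) = 0" using 1 assms(1,3) unfolding kap_def by (subst (asm) sum_nonneg_eq_0_iff) auto
  then show "(\<Prod>i\<in>S. x i) = 0" using prod.remove[OF fS u, of x] by simp
qed

text \<open>The clique polynomial depends on the two parts only through their weights
  \<open>X\<close> and \<open>Y\<close>, as \<open>A + (X + Y) * B + X * Y * C\<close>. The test
  vector for the new graph is constant on both new parts, with part weights mixed in the proportion
  in which the part sizes are mixed. The sum of the weights stays, their product grows, and by
  convexity the sum of \<open>t\<close>-th powers does not grow.\<close>

lemma jn_rebalance:
  fixes c :: "'a \<Rightarrow> nat" and V :: "'a set"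
  defines "cl \<equiv> \<lambda>i. {v \<in> V. c v = i}"
  assumes V: "finite V" and t: "2 \<le> t" and pq: "p < r" "q < r"
    and ab: "card (cl q) + 2 \<le> card (cl p)" and v0: "v0 \<in> cl p" and pos: "0 < rho t (jn r V c) V"
  shows "rho t (jn r V c) V < rho t (jn r V (c(v0 := q))) V"
proof -
  define P Q R where "P = cl p" and "Q = cl q" and "R = V - P - Q"
  define c' where "c' = c(v0 := q)"
  define E E' where "E = jn r V c" and "E' = jn r V c'"
  have pneq: "p \<noteq> q" using ab by auto
  have v0V: "v0 \<in> V" "c v0 = p" using v0 by (auto simp: cl_def)
  have ne: "V \<noteq> {}" using v0V by auto
  obtain s where s: "t = Suc (Suc s)" using t by (metis add_2_eq_Suc le_Suc_ex)
  have fin: "finite P" "finite Q" "finite R" using V by (auto simp: P_def Q_def R_def cl_def)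
  have EE: "sym E" "irrefl E" "sym E'" "irrefl E'" by (auto simp: E_def E'_def)
  define \<rho> where "\<rho> = rho t E V"
  have \<rho>: "0 < \<rho>" using pos by (simp add: \<rho>_def E_def)
  obtain x where x: "\<And>v. 0 \<le> x v" "(\<Sum>v\<in>V. x v ^ t) = real (card V)"
    "real t * kap t E x V = \<rho> * real (card V)"
    "\<And>v. v \<in> V \<Longrightarrow> \<rho> * x v ^ (t - 1) = kap (t - 1) E x (V \<inter> E `` {v})"
    unfolding \<rho>_def using perron[OF V ne EE(1,2) t] by metis
  define A B C where "A = kap t E x R" and "B = kap (Suc s) E x R" and "C = kap s E x R"
  define X Y where "X = (\<Sum>v\<in>P. x v)" and "Y = (\<Sum>v\<in>Q. x v)"
  have nn: "0 \<le> A" "0 \<le> B" "0 \<le> C" "0 \<le> X" "0 \<le> Y"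
    using x(1) by (auto simp: A_def B_def C_def X_def Y_def intro!: kap_nonneg sum_nonneg)
  have two: "kap (Suc (Suc s)) (jn r V d) z V = kap (Suc (Suc s)) (jn r V d) z S
      + (sum z P' + sum z Q') * kap (Suc s) (jn r V d) z S + sum z P' * sum z Q' * kap s (jn r V d) z S"
    if "P' = {v \<in> V. d v = p}" "Q' = {v \<in> V. d v = q}" "S = V - P' - Q'" for d z P' Q' S
  proof -
    have 1: "kap (Suc j) (jn r V d) z V = kap (Suc j) (jn r V d) z (V - P')
        + sum z P' * kap j (jn r V d) z (V - P')" for j
      using V pq that by (intro kap_jn_class) auto
    have 2: "kap (Suc j) (jn r V d) z (V - P') = kap (Suc j) (jn r V d) z S
        + sum z Q' * kap j (jn r V d) z S" for j
      using V pq pneq that unfolding that(3) by (intro kap_jn_class[where p = q]) auto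
    show ?thesis unfolding 1 2 by (simp add: algebra_simps)
  qed
  have kx: "kap t E x V = A + (X + Y) * B + X * Y * C" using two[of P c Q R x]
    by (simp add: s A_def B_def C_def X_def Y_def E_def P_def Q_def R_def cl_def)
  have nonzero: "kap t E x V \<noteq> 0" using x(3) \<rho> V ne t by (auto simp: card_gt_0_iff)
  have BA: "B = 0 \<Longrightarrow> A = 0" unfolding A_def B_def s using kap_Suc_eq_0[OF fin(3), of x "Suc s" E] x(1) by simp
  have CB: "C = 0 \<Longrightarrow> B = 0" unfolding C_def B_def using kap_Suc_eq_0[OF fin(3), of x s E] x(1) by simp
  have C0: "0 < C"
  proof (rule ccontr)
    assume "\<not> 0 < C"
    then have "C = 0" "B = 0" "A = 0" using nn CB BA by auto
    then show False using nonzero kx by simp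
  qed
  define a b where "a = real (card P)" and "b = real (card Q)"
  have abr: "b + 2 \<le> a" "0 \<le> b" using ab unfolding a_def b_def P_def Q_def by linarith+
  \<comment> \<open>If the part weights agreed, the eigenvalue equations would give all vertices of
    both parts the same weight. As the parts differ in size this weight is 0, and then the whole
    clique polynomial vanishes.\<close>
  have XY: "X \<noteq> Y"
  proof
    assume eq: "X = Y"
    have nbr': "\<rho> * x v ^ Suc s = B + sum x (cl j) * C"
      if ij: "i = p \<and> j = q \<or> i = q \<and> j = p" and v: "v \<in> cl i" for i j v
    proof -
      have "V \<inter> E `` {v} = V - cl i" using v ij pq by (auto simp: cl_def E_def jn_def)
      moreover have "R = V - cl i - cl j" using ij by (auto simp: R_def P_def Q_def)
      then have "kap (Suc s) E x (V - cl i) = B + sum x (cl j) * C" unfolding B_def C_def E_def using V pq pneq ij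
        by (simp only:) (intro kap_jn_class[where p = j], auto simp: cl_def)
      ultimately show ?thesis using x(4)[of v] v by (simp add: s cl_def)
    qed
    have nbr: "\<rho> * x v ^ Suc s = B + X * C" if "v \<in> P \<union> Q" for v
      using that nbr'[of p q v] nbr'[of q p v] eq by (auto simp: P_def Q_def X_def Y_def)
    have const: "x v = x v0" if "v \<in> P \<union> Q" for v
    proof -
      have "v0 \<in> P \<union> Q" using v0 by (simp add: P_def)
      then have "x v ^ Suc s = x v0 ^ Suc s" using nbr[OF that] nbr[of v0] \<rho> by (metis less_irrefl mult_left_cancel)
      then show ?thesis using x(1) by (metis power_inject_base)
    qed
    have "X = a * x v0" "Y = b * x v0" using const by (simp_all add: X_def Y_def a_def b_def)
    then have "x v0 = 0" using eq abr by auto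
    then have "B + X * C = 0" using nbr[of v0] v0 by (simp add: P_def)
    then have "B = 0" "X * C = 0" using nn by (auto simp: add_nonneg_eq_0_iff)
    then have "A = 0" "B = 0" "X = 0" using BA C0 by auto
    then show False using nonzero kx eq by simp
  qed
  \<comment> \<open>The mixing proportion that turns the part sizes \<open>a\<close> and
    \<open>b\<close> into \<open>a - 1\<close> and \<open>b + 1\<close>.\<close>
  define h where "h = 1 / (a - b)"
  have h: "0 < h" "h < 1" "h * (a - b) = 1" using abr by (auto simp: h_def field_simps)
  define X' Y' where "X' = X - h * (X - Y)" and "Y' = Y + h * (X - Y)"
  have X'alt: "X' = (1 - h) * X + h * Y" and Y'alt: "Y' = (1 - h) * Y + h * X" by (simp_all add: X'_def Y'_def algebra_simps)
  have X'0: "0 \<le> X'" and Y'0: "0 \<le> Y'" unfolding X'alt Y'alt using nn h by auto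
  define P' Q' where "P' = P - {v0}" and "Q' = insert v0 Q"
  have v0PQ: "v0 \<in> P" "v0 \<notin> Q" using v0V pneq v0 by (auto simp: P_def Q_def cl_def)
  have P'c: "P' = {v \<in> V. c' v = p}" and Q'c: "Q' = {v \<in> V. c' v = q}"
    using v0V pneq by (auto simp: P'_def Q'_def P_def Q_def cl_def c'_def)
  have R': "R = V - P' - Q'" using v0PQ by (auto simp: R_def P'_def Q'_def)
  have cP': "real (card P') = a - 1" and cQ': "real (card Q') = b + 1"
    using v0PQ fin abr by (auto simp: P'_def Q'_def a_def b_def of_nat_diff Suc_le_eq card_gt_0_iff)
  define m m' where "m = X' / (a - 1)" and "m' = Y' / (b + 1)"
  have mX: "(a - 1) * m = X'" and mY: "(b + 1) * m' = Y'" using abr by (auto simp: m_def m'_def)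
  have m0: "0 \<le> m" "0 \<le> m'" using X'0 Y'0 abr by (auto simp: m_def m'_def)
  define y where "y v = (if v \<in> P' then m else if v \<in> Q' then m' else x v)" for v
  have y0: "0 \<le> y v" for v using m0 x(1) by (simp add: y_def)
  have PQ': "P' \<inter> Q' = {}" "P \<inter> Q = {}" using pneq by (auto simp: P'_def Q'_def P_def Q_def cl_def)
  have sP: "sum y P' = X'" using mX cP' by (simp add: y_def)
  have "sum y Q' = sum (\<lambda>_. m') Q'" using PQ' by (intro sum.cong) (auto simp: y_def)
  then have sQ: "sum y Q' = Y'" using mY cQ' by simp
  have ky: "kap t E' y V = A + (X' + Y') * B + X' * Y' * C"
  proof -
    have e: "kap j E' y R = kap j E x R" for j
    proof -
      have "kap j E' y R = kap j E' x R" using R' by (intro kap_cong) (auto simp: y_def)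
      also have "\<dots> = kap j E x R" using R' by (intro kap_cong_edges) (auto simp: E_def E'_def jn_def c'_def Q'_def)
      finally show ?thesis .
    qed
    show ?thesis using two[OF P'c Q'c R', of y] e sP sQ by (simp add: s A_def B_def C_def E'_def)
  qed
  have "X' * Y' = X * Y + h * (1 - h) * (X - Y)\<^sup>2" unfolding X'_def Y'_def by (simp add: algebra_simps power2_eq_square)
  moreover have "0 < h * (1 - h) * (X - Y)\<^sup>2" using h XY by simp
  ultimately have "X * Y * C < X' * Y' * C" using C0 by (intro mult_strict_right_mono) auto
  moreover have "X' + Y' = X + Y" by (simp add: X'_def Y'_def)
  ultimately have kk: "kap t E x V < kap t E' y V" unfolding kx ky by simp
  text \<open>Both new parts are compared with the mixture of the old parts whose total size and total
    weight they have, through the tangent of the \<open>t\<close>-th power at their mean weight.\<close>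
  have tang: "real (card S) * z ^ t + real t * z ^ (t - 1) * (sum x S - real (card S) * z) \<le> (\<Sum>v\<in>S. x v ^ t)"
    if "0 \<le> z" for z :: real and S
  proof -
    have "(\<Sum>v\<in>S. z ^ t + real t * z ^ (t - 1) * (x v - z)) \<le> (\<Sum>v\<in>S. x v ^ t)"
      using that x(1) by (intro sum_mono power_ge_tangent) auto
    then show ?thesis by (simp add: sum.distrib sum_distrib_left[symmetric] sum_subtractf)
  qed
  define SP SQ where "SP = (\<Sum>v\<in>P. x v ^ t)" and "SQ = (\<Sum>v\<in>Q. x v ^ t)"
  have mix: "(u * a + w * b) * z ^ t \<le> u * SP + w * SQ"
    if "0 \<le> u" "0 \<le> w" "0 \<le> z" "(u * a + w * b) * z = u * X + w * Y" for u w z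
  proof -
    have 1: "u * (a * z ^ t + real t * z ^ (t - 1) * (X - a * z)) \<le> u * SP"
      using tang[of z P] that unfolding SP_def X_def a_def by (intro mult_left_mono) auto
    have 2: "w * (b * z ^ t + real t * z ^ (t - 1) * (Y - b * z)) \<le> w * SQ"
      using tang[of z Q] that unfolding SQ_def Y_def b_def by (intro mult_left_mono) auto
    have "u * (a * z ^ t + real t * z ^ (t - 1) * (X - a * z))
        + w * (b * z ^ t + real t * z ^ (t - 1) * (Y - b * z))
        = (u * a + w * b) * z ^ t + real t * z ^ (t - 1) * (u * X + w * Y - (u * a + w * b) * z)"
      by (simp add: algebra_simps)
    also have "\<dots> = (u * a + w * b) * z ^ t" using that(4) by simp
    finally show ?thesis using 1 2 by linarith
  qed
  have s1: "(1 - h) * a + h * b = a - 1" "h * a + (1 - h) * b = b + 1" using h(3) by (simp_all add: algebra_simps)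
  have m1: "(a - 1) * m ^ t \<le> (1 - h) * SP + h * SQ" using mix[of "1 - h" h m] h m0 mX X'alt s1 by simp
  have m2: "(b + 1) * m' ^ t \<le> h * SP + (1 - h) * SQ" using mix[of h "1 - h" m'] h m0 mY Y'alt s1 by (simp add: add.commute)
  have sum_split: "(\<Sum>v\<in>V. f v) = (\<Sum>v\<in>S1. f v) + (\<Sum>v\<in>S2. f v) + (\<Sum>v\<in>R. f v)"
    if "S1 \<inter> S2 = {}" "R = V - S1 - S2" "S1 \<subseteq> V" "S2 \<subseteq> V" for S1 S2 and f :: "'a \<Rightarrow> real"
  proof -
    have "V = (S1 \<union> S2) \<union> R" "(S1 \<union> S2) \<inter> R = {}" using that by auto
    moreover have "finite S1" "finite S2" using that(3,4) V by (auto intro: finite_subset)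
    ultimately show ?thesis using that(1) fin by (simp add: sum.union_disjoint)
  qed
  have "(\<Sum>v\<in>V. y v ^ t) = (\<Sum>v\<in>P'. y v ^ t) + (\<Sum>v\<in>Q'. y v ^ t) + (\<Sum>v\<in>R. y v ^ t)"
    using PQ' R' P'c Q'c by (intro sum_split) auto
  also have "(\<Sum>v\<in>P'. y v ^ t) = (a - 1) * m ^ t" using cP' by (simp add: y_def)
  also have "(\<Sum>v\<in>Q'. y v ^ t) = (\<Sum>v\<in>Q'. m' ^ t)" using PQ' by (intro sum.cong) (auto simp: y_def)
  also have "\<dots> = (b + 1) * m' ^ t" using cQ' by simp
  also have "(\<Sum>v\<in>R. y v ^ t) = (\<Sum>v\<in>R. x v ^ t)" using R' by (intro sum.cong) (auto simp: y_def)
  also have "(a - 1) * m ^ t + (b + 1) * m' ^ t + (\<Sum>v\<in>R. x v ^ t) \<le> SP + SQ + (\<Sum>v\<in>R. x v ^ t)"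
    using m1 m2 by (simp add: algebra_simps)
  also have "\<dots> = (\<Sum>v\<in>V. x v ^ t)"
    unfolding SP_def SQ_def using PQ' by (intro sum_split[symmetric]) (auto simp: R_def P_def Q_def cl_def)
  finally have ysum: "(\<Sum>v\<in>V. y v ^ t) \<le> real (card V)" using x(2) by simp
  have "\<rho> * real (card V) < real t * kap t E' y V" unfolding x(3)[symmetric] using kk t by simp
  also have "\<dots> \<le> rho t E' V * (\<Sum>v\<in>V. y v ^ t)" using V ne EE t y0 by (intro rho_upper) auto
  also have "\<dots> \<le> rho t E' V * real (card V)" using ysum rho_nonneg[OF V ne EE(3,4) t] by (intro mult_left_mono)
  finally have "\<rho> < rho t E' V" by (simp add: mult_less_cancel_right)
  then show ?thesis by (simp add: \<rho>_def E_def E'_def c'_def)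
qed

section \<open>Balanced colourings and the extremality of equal part sizes\<close>

lemma bij_betw_fibres:
  assumes "finite A" "finite B" "\<And>y. card {a \<in> A. f a = y} = card {b \<in> B. g b = y}"
  shows "\<exists>h. bij_betw h A B \<and> (\<forall>a\<in>A. g (h a) = f a)"
proof -
  have "\<exists>h. bij_betw h {a \<in> A. f a = y} {b \<in> B. g b = y}" for y using assms by (intro finite_same_card_bij) auto
  then obtain H where H: "\<And>y. bij_betw (H y) {a \<in> A. f a = y} {b \<in> B. g b = y}" by metis
  define h where "h a = H (f a) a" for a
  have h: "h a \<in> B" "g (h a) = f a" if "a \<in> A" for a using bij_betwE[OF H[of "f a"]] that by (auto simp: h_def)
  have "inj_on h A"
  proof (rule inj_onI)
    fix a b assume ab: "a \<in> A" "b \<in> A" "h a = h b"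
    then have "f a = f b" using h by metis
    then show "a = b" using ab H[of "f a"] unfolding h_def bij_betw_def inj_on_def by auto
  qed
  moreover have "B \<subseteq> h ` A"
  proof
    fix b assume "b \<in> B"
    then have "b \<in> H (g b) ` {a \<in> A. f a = g b}" using H[of "g b"] by (auto simp: bij_betw_def)
    then obtain a where "a \<in> A" "b = H (g b) a" "f a = g b" by auto
    then have "b = h a" by (simp add: h_def)
    then show "b \<in> h ` A" using \<open>a \<in> A\<close> by (rule image_eqI)
  qed
  ultimately have "bij_betw h A B" using h(1) by (auto simp: bij_betw_def)
  then show ?thesis using h(2) by blast
qed

text \<open>Balanced sizes take only the values \<open>lo\<close> and \<open>lo + 1\<close>, so
  division with remainder determines how often each occurs. Two balanced families with the same
  total therefore have the same sizes up to order.\<close>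

lemma card_level_set_of_balanced:
  fixes f :: "nat \<Rightarrow> nat"
  assumes "\<And>p q. p < r \<Longrightarrow> q < r \<Longrightarrow> f p \<le> f q + 1" and S: "S = (\<Sum>i<r. f i)" and r: "0 < r"
  shows "card {i \<in> {..<r}. f i = y}
    = (if y = S div r then r - S mod r else if y = S div r + 1 then S mod r else 0)"
proof -
  define lo where "lo = Min (f ` {..<r})"
  have "lo \<in> f ` {..<r}" unfolding lo_def using r by (intro Min_in) auto
  then obtain i0 where i0: "i0 < r" "f i0 = lo" by auto
  have lo: "f i = lo \<or> f i = lo + 1" if "i < r" for i
  proof -
    have "lo \<le> f i" unfolding lo_def using that by (intro Min_le) auto
    then show ?thesis using assms(1)[OF that i0(1)] i0(2) by linarith
  qed
  define K where "K = {i \<in> {..<r}. f i = lo + 1}"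
  have "K \<subseteq> {..<r} - {i0}" using i0 by (auto simp: K_def)
  then have "card K \<le> card ({..<r} - {i0})" by (intro card_mono) auto
  then have k: "card K < r" using i0(1) by simp
  have "S = (\<Sum>i<r. lo + (if f i = lo + 1 then 1 else 0))" unfolding S using lo by (intro sum.cong) auto
  also have "\<dots> = r * lo + card K" unfolding sum.distrib K_def by (simp add: sum.inter_filter[symmetric])
  finally have S': "S = r * lo + card K" .
  then have d: "S div r = lo" "S mod r = card K" using k by auto
  have "{i \<in> {..<r}. f i = lo} = {..<r} - K" using lo by (auto simp: K_def)
  moreover have "card ({..<r} - K) = r - card K" by (subst card_Diff_subset) (auto simp: K_def)
  ultimately have "card {i \<in> {..<r}. f i = lo} = r - card K" by simp
  moreover have "{i \<in> {..<r}. f i = y} = {}" if "y \<noteq> lo" "y \<noteq> lo + 1" using lo that by auto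
  ultimately show ?thesis unfolding d using K_def by auto
qed

definition balanced :: "nat \<Rightarrow> 'a set \<Rightarrow> ('a \<Rightarrow> nat) \<Rightarrow> bool" where
  "balanced r V c \<longleftrightarrow>
    (\<forall>p<r. \<forall>q<r. card {v \<in> V. c v = p} \<le> card {v \<in> V. c v = q} + 1)"

text \<open>A permutation of the colours below \<open>r\<close> matches the part sizes; extended by
  the identity, it also fixes the special colour \<open>r\<close>. A bijection of the vertices that
  respects the matched colours is then an isomorphism.\<close>

lemma balanced_jn_iso:
  assumes V: "finite V" "finite V'" "card V = card V'" and r: "0 < r"
    and c: "c ` V \<subseteq> {..r}" "c' ` V' \<subseteq> {..r}" and bal: "balanced r V c" "balanced r V' c'"
    and L: "card {v \<in> V. c v = r} = card {v \<in> V'. c' v = r}"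
  shows "iso_on V (jn r V c) V' (jn r V' c')"
proof -
  define F where "F i = card {v \<in> V. c v = i}" for i
  define G where "G i = card {v \<in> V'. c' v = i}" for i
  have "card V = (\<Sum>i\<le>r. F i)" using sum.group[of V "{..r}" c "\<lambda>_. 1::nat"] V c by (simp add: F_def)
  moreover have "card V' = (\<Sum>i\<le>r. G i)" using sum.group[of V' "{..r}" c' "\<lambda>_. 1::nat"] V c by (simp add: G_def)
  ultimately have "(\<Sum>i<r. F i) = (\<Sum>i<r. G i)" using V(3) L by (simp add: lessThan_Suc_atMost[symmetric] F_def G_def)
  then have "card {i \<in> {..<r}. F i = y} = card {i \<in> {..<r}. G i = y}" for y
    using card_level_set_of_balanced[of r F "\<Sum>i<r. F i" y]
      card_level_set_of_balanced[of r G "\<Sum>i<r. G i" y] bal r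
    by (simp add: balanced_def F_def G_def)
  then obtain \<sigma>0 where \<sigma>0: "bij_betw \<sigma>0 {..<r} {..<r}" "\<And>i. i < r \<Longrightarrow> G (\<sigma>0 i) = F i"
    using bij_betw_fibres[of "{..<r}" "{..<r}" F G] by auto
  define \<sigma> where "\<sigma> i = (if i < r then \<sigma>0 i else i)" for i
  have inj0: "inj_on \<sigma>0 {..<r}" and im0: "\<sigma>0 ` {..<r} = {..<r}" using \<sigma>0(1) by (auto simp: bij_betw_def)
  have lt: "\<sigma> i < r \<longleftrightarrow> i < r" for i using im0 by (auto simp: \<sigma>_def)
  have inj: "\<sigma> i = \<sigma> j \<longleftrightarrow> i = j" for i j
    using inj0 lt[of i] lt[of j] by (auto simp: \<sigma>_def inj_on_def split: if_splits)
  have "card {v \<in> V. \<sigma> (c v) = y} = card {v \<in> V'. c' v = y}" for y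
  proof (cases "y < r")
    case True
    then have "y \<in> \<sigma>0 ` {..<r}" using im0 by simp
    then obtain i where i: "i < r" "y = \<sigma>0 i" by auto
    then have "y = \<sigma> i" by (simp add: \<sigma>_def)
    then have "{v \<in> V. \<sigma> (c v) = y} = {v \<in> V. c v = i}" by (simp add: inj)
    then show ?thesis using \<sigma>0(2)[OF i(1)] i(2) by (simp add: F_def G_def)
  next
    case False
    then have "y = \<sigma> y" by (simp add: \<sigma>_def)
    then have "\<sigma> (c v) = y \<longleftrightarrow> c v = y" for v using inj by metis
    then have e: "{v \<in> V. \<sigma> (c v) = y} = {v \<in> V. c v = y}" by simp
    show ?thesis
    proof (cases "y = r")
      case True
      then show ?thesis using e L by simp
    next
      case F: False
      then have "{v \<in> V. c v = y} = {}" "{v \<in> V'. c' v = y} = {}" using c False by auto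
      then show ?thesis using e by (simp only: card.empty)
    qed
  qed
  then obtain f where f: "bij_betw f V V'" "\<And>v. v \<in> V \<Longrightarrow> c' (f v) = \<sigma> (c v)"
    using bij_betw_fibres[of V V' "\<lambda>v. \<sigma> (c v)" c'] V by auto
  have "\<sigma> r = r" by (simp add: \<sigma>_def)
  then have r_iff: "\<sigma> i = r \<longleftrightarrow> i = r" for i using inj by metis
  have "(u, v) \<in> jn r V c \<longleftrightarrow> (f u, f v) \<in> jn r V' c'" if "u \<in> V" "v \<in> V" for u v
    using that f bij_betwE[OF f(1)] inj_onD[OF bij_betw_imp_inj_on[OF f(1)], of u v] by (auto simp: jn_def inj r_iff)
  then show ?thesis using f(1) unfolding iso_on_def by blast
qed

text \<open>There are finitely many colourings with the given number of vertices of colour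
  \<open>r\<close>, so one of them is best. Rebalancing is a strict improvement, so every best
  colouring is balanced and hence gives the reference graph.\<close>

lemma jn_extremal:
  assumes V: "finite V" "V \<noteq> {}" "finite V'" "card V = card V'" and r: "0 < r" and t: "2 \<le> t"
    and c: "c ` V \<subseteq> {..r}" "c0 ` V' \<subseteq> {..r}" and bal: "balanced r V' c0"
    and L: "card {v \<in> V. c v = r} = card {v \<in> V'. c0 v = r}"
    and pos: "0 < rho t (jn r V' c0) V'"
  shows "rho t (jn r V c) V \<le> rho t (jn r V' c0) V'"
    and "rho t (jn r V c) V = rho t (jn r V' c0) V' \<Longrightarrow>
      iso_on V (jn r V c) V' (jn r V' c0)"
proof -
  define j where "j = card {v \<in> V'. c0 v = r}"
  \<comment> \<open>Extensional functions make the set finite; restricting a colouring to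
    \<open>V\<close> does not change its graph.\<close>
  define K where "K = {d \<in> V \<rightarrow>\<^sub>E {..r}. card {v \<in> V. d v = r} = j}"
  define R where "R d = rho t (jn r V d) V" for d
  have fK: "finite K" unfolding K_def using V(1) by (simp add: finite_PiE)
  have restr: "restrict d V \<in> K \<and> R (restrict d V) = R d"
    if "d ` V \<subseteq> {..r}" "card {v \<in> V. d v = r} = j" for d
  proof -
    have "{v \<in> V. restrict d V v = r} = {v \<in> V. d v = r}" by auto
    moreover have "jn r V (restrict d V) = jn r V d" by (auto simp: jn_def)
    ultimately show ?thesis using that by (auto simp: K_def R_def)
  qed
  obtain g where g: "bij_betw g V V'" using V finite_same_card_bij by blast
  have "card {v \<in> V. c0 (g v) = r} = j"
  proof -
    have "bij_betw g {v \<in> V. c0 (g v) = r} {v \<in> V'. c0 v = r}" using g by (auto simp: bij_betw_def inj_on_def)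
    then show ?thesis using bij_betw_same_card j_def by blast
  qed
  moreover have "(c0 \<circ> g) ` V \<subseteq> {..r}" using c(2) g by (auto simp: bij_betw_def)
  ultimately have d0: "restrict (c0 \<circ> g) V \<in> K" "R (restrict (c0 \<circ> g) V) = R (c0 \<circ> g)"
    using restr[of "c0 \<circ> g"] by auto
  have "iso_on V (jn r V (c0 \<circ> g)) V' (jn r V' c0)" unfolding iso_on_def
  proof (intro exI[of _ g] conjI ballI)
    show "(u, v) \<in> jn r V (c0 \<circ> g) \<longleftrightarrow> (g u, g v) \<in> jn r V' c0" if "u \<in> V" "v \<in> V" for u v
      using that bij_betwE[OF g] inj_onD[OF bij_betw_imp_inj_on[OF g], of u v] by (auto simp: jn_def)
  qed (rule g)
  then have "R (c0 \<circ> g) = rho t (jn r V' c0) V'" unfolding R_def using V t by (intro rho_iso) auto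
  with d0 have d0R: "R (restrict (c0 \<circ> g) V) = rho t (jn r V' c0) V'" by simp
  have "K \<noteq> {}" using d0 by blast
  then have "Max (R ` K) \<in> R ` K" using fK by (intro Max_in) auto
  then obtain d where d: "d \<in> K" "R d = Max (R ` K)" by auto
  have dmax: "R e \<le> R d" if "e \<in> K" for e using that fK d(2) by simp
  have dpos: "0 < R d" using dmax[OF d0(1)] pos d0R by simp
  have top_bal: "balanced r V e" if e: "e \<in> K" "R e = R d" for e
  proof (rule ccontr)
    assume "\<not> balanced r V e"
    then obtain p q where pq: "p < r" "q < r"
      "card {v \<in> V. e v = q} + 2 \<le> card {v \<in> V. e v = p}"
      unfolding balanced_def by (metis Suc_eq_plus1 add_2_eq_Suc' not_less_eq_eq)
    then have "card {v \<in> V. e v = p} \<noteq> 0" by linarith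
    then have "{v \<in> V. e v = p} \<noteq> {}" by (metis card.empty)
    then obtain v0 where v0: "v0 \<in> V" "e v0 = p" by auto
    have "R e < R (e(v0 := q))" unfolding R_def using pq v0 V(1) t e(2) dpos by (intro jn_rebalance[where p = p]) (auto simp: R_def)
    moreover have "e(v0 := q) \<in> K"
    proof -
      have "{v \<in> V. (e(v0 := q)) v = r} = {v \<in> V. e v = r}" using v0 pq by auto
      then show ?thesis using e(1) v0(1) pq(2) by (auto simp: K_def PiE_iff extensional_def)
    qed
    ultimately show False using dmax e(2) by fastforce
  qed
  have isoK: "iso_on V (jn r V e) V' (jn r V' c0)"
    if "e \<in> K" "R e = R d" for e
    using that top_bal[OF that] V r c(2) bal by (intro balanced_jn_iso) (auto simp: K_def j_def)
  have Rd: "R d = rho t (jn r V' c0) V'" unfolding R_def using V t isoK[OF d(1) refl] by (intro rho_iso) auto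
  have cK: "restrict c V \<in> K" "R (restrict c V) = R c" using restr[OF c(1)] L j_def by auto
  then show "rho t (jn r V c) V \<le> rho t (jn r V' c0) V'" using dmax[OF cK(1)] Rd by (simp add: R_def)
  assume "rho t (jn r V c) V = rho t (jn r V' c0) V'"
  then have "R (restrict c V) = R d" using Rd cK(2) by (simp add: R_def)
  then have "iso_on V (jn r V (restrict c V)) V' (jn r V' c0)" by (rule isoK[OF cK(1)])
  moreover have "jn r V (restrict c V) = jn r V c" by (auto simp: jn_def)
  ultimately show "iso_on V (jn r V c) V' (jn r V' c0)" by simp
qed

section \<open>Clique packings and dense clique-free graphs\<close>

text \<open>Disjointness of the \<open>k\<close> cliques is built in by removing each chosen clique
  from the vertex set, which suits both greedy choice and induction on \<open>k\<close>.\<close>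

primrec packs :: "nat \<Rightarrow> nat \<Rightarrow> ('a \<times> 'a) set \<Rightarrow> 'a set \<Rightarrow> bool" where
  "packs 0 q E V \<longleftrightarrow> True"
| "packs (Suc k) q E V \<longleftrightarrow> (\<exists>S\<in>cliques q E V. packs k q E (V - S))"

lemma packs_mono: "packs k q E U \<Longrightarrow> U \<subseteq> V \<Longrightarrow> packs k q E V"
proof (induction k arbitrary: U V)
  case (Suc k)
  then obtain S where S: "S \<in> cliques q E U" "packs k q E (U - S)" by auto
  have "S \<in> cliques q E V" using S(1) Suc.prems(2) cliques_mono[of E E U V q] by auto
  moreover have "packs k q E (V - S)" using Suc.IH[OF S(2)] Suc.prems(2) by blast
  ultimately show ?case by auto
qed simp

lemma packs_embedding:
  assumes "finite V" "packs k q E V"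
  shows "\<exists>f. inj_on f ({..<k} \<times> {..<q}) \<and> f ` ({..<k} \<times> {..<q}) \<subseteq> V \<and>
    (\<forall>i<k. \<forall>a<q. \<forall>b<q. a \<noteq> b \<longrightarrow> (f (i, a), f (i, b)) \<in> E)"
  using assms
proof (induction k arbitrary: V)
  case (Suc k)
  then obtain S where S: "S \<in> cliques q E V" "packs k q E (V - S)" by auto
  obtain f where f: "inj_on f ({..<k} \<times> {..<q})" "f ` ({..<k} \<times> {..<q}) \<subseteq> V - S"
    "\<forall>i<k. \<forall>a<q. \<forall>b<q. a \<noteq> b \<longrightarrow> (f (i, a), f (i, b)) \<in> E"
    using Suc.IH[OF _ S(2)] Suc.prems(1) by auto
  have SV: "S \<subseteq> V" and cS: "card S = q" and eS: "\<And>u v. u \<in> S \<Longrightarrow> v \<in> S \<Longrightarrow> u \<noteq> v \<Longrightarrow> (u, v) \<in> E"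
    using S(1) by (auto simp: cliques_def)
  have "finite S" using SV Suc.prems(1) finite_subset by blast
  then obtain g where g: "bij_betw g {..<q} S" using cS finite_same_card_bij[of "{..<q}" S] by auto
  define h where "h = (\<lambda>(i, a). if i < k then f (i, a) else g a)"
  have gS: "g a \<in> S" if "a < q" for a using bij_betwE[OF g] that by auto
  have gi: "g a = g b \<longleftrightarrow> a = b" if "a < q" "b < q" for a b using inj_onD[OF bij_betw_imp_inj_on[OF g]] that by auto
  have fS: "f (i, a) \<in> V" "f (i, a) \<notin> S" if "i < k" "a < q" for i a using f(2) that by auto
  have fi: "f (i, a) = f (j, b) \<longleftrightarrow> i = j \<and> a = b" if "i < k" "a < q" "j < k" "b < q" for i a j b
    using inj_onD[OF f(1), of "(i, a)" "(j, b)"] that by auto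
  have "inj_on h ({..<Suc k} \<times> {..<q})"
  proof (rule inj_onI, clarify)
    fix i a j b
    assume ia: "i < Suc k" "a < q" and jb: "j < Suc k" "b < q" and eq: "h (i, a) = h (j, b)"
    show "i = j \<and> a = b" using eq fi[of i a j b] fS[of i a] fS[of j b] gS[of a] gS[of b] gi[of a b] ia jb
      by (cases "i < k"; cases "j < k") (auto simp: h_def)
  qed
  moreover have "h ` ({..<Suc k} \<times> {..<q}) \<subseteq> V" using fS subsetD[OF SV gS] by (auto simp: h_def less_Suc_eq)
  moreover have "\<forall>i<Suc k. \<forall>a<q. \<forall>b<q. a \<noteq> b \<longrightarrow> (h (i, a), h (i, b)) \<in> E"
    using f(3) eS gS gi by (simp add: h_def)
  ultimately show ?case by blast
qed simp

lemma free_of_imp_not_packs: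
  assumes "pair_graph G" "free_of (disjoint_copies k (complete_graph q)) G"
  shows "\<not> packs k q (parcs G) (pverts G)"
proof
  assume p: "packs k q (parcs G) (pverts G)"
  interpret pair_graph G by fact
  obtain f where f: "inj_on f ({..<k} \<times> {..<q})" "f ` ({..<k} \<times> {..<q}) \<subseteq> pverts G"
    "\<forall>i<k. \<forall>a<q. \<forall>b<q. a \<noteq> b \<longrightarrow> (f (i, a), f (i, b)) \<in> parcs G"
    using packs_embedding[OF _ p] by auto
  have "pair_graph (disjoint_copies k (complete_graph q))" by (intro pair_graph_disjoint_copies pair_graph_complete_graph)
  note free = assms(2)[unfolded free_of_iff[OF this assms(1)]]
  have pv: "pverts (disjoint_copies k (complete_graph q)) = {..<k} \<times> {..<q}"
    by (simp add: disjoint_copies_def complete_graph_def)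
  have pa: "(f u, f v) \<in> parcs G" if "(u, v) \<in> parcs (disjoint_copies k (complete_graph q))" for u v
    using that f(3) by (auto simp: disjoint_copies_def complete_graph_def)
  from free show False
    by (rule notE) (intro exI[of _ f] conjI allI impI pa, simp_all only: pv f(1,2))
qed

text \<open>Remove cliques greedily until none is left. This stops after fewer than \<open>k\<close>
  rounds, and \<open>W\<close> is the union of what was removed.\<close>

lemma packing_cover:
  assumes "finite V" "\<not> packs k q E V"
  shows "\<exists>W\<subseteq>V. card W \<le> k * q \<and> cliques q E (V - W) = {}"
  using assms
proof (induction k arbitrary: V)
  case (Suc k)
  show ?case
  proof (cases "cliques q E V = {}")
    case True
    then show ?thesis by (intro exI[of _ "{}"]) auto
  next
    case False
    then obtain S where S: "S \<in> cliques q E V" by blast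
    then have "\<not> packs k q E (V - S)" using Suc.prems(2) by auto
    then obtain W where W: "W \<subseteq> V - S" "card W \<le> k * q" "cliques q E (V - S - W) = {}"
      using Suc.IH[of "V - S"] Suc.prems(1) by auto
    have "card (S \<union> W) \<le> card S + card W" by (rule card_Un_le)
    then have "card (S \<union> W) \<le> Suc k * q" using W(2) S by (simp add: cliques_def)
    moreover have "V - (S \<union> W) = V - S - W" by blast
    moreover have "S \<union> W \<subseteq> V" using W(1) S by (auto simp: cliques_def)
    ultimately show ?thesis using W(3) by metis
  qed
qed simp

section \<open>Greedy cliques and the \<open>r\<close>-partite structure of dense clique-free
  graphs\<close>

lemma cliques_insert_vertex:
  assumes "S \<in> cliques s E V" "finite V" "sym E" "irrefl E" "v \<in> V" "S \<subseteq> E `` {v}"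
  shows "insert v S \<in> cliques (Suc s) E V"
proof -
  have "v \<notin> S" using assms(4,6) by (auto simp: irrefl_def)
  then show ?thesis using clique_insert[of S s E V v] assms by (simp add: insert_absorb)
qed

text \<open>Choose a vertex in one class and restrict the others to its neighbours. Each remaining
  class loses at most \<open>\<beta>\<close> vertices, exactly what the size requirement drops by
  when one class is gone.\<close>

lemma transversal_clique:
  assumes "finite I" "sym E" "irrefl E" "0 \<le> \<beta>" "\<And>i. i \<in> I \<Longrightarrow> finite (T i)"
    and "\<And>i j x. i \<in> I \<Longrightarrow> j \<in> I \<Longrightarrow> i \<noteq> j \<Longrightarrow> x \<in> T i \<Longrightarrow> real (card (T j - E `` {x})) \<le> \<beta>"
    and "\<And>i. i \<in> I \<Longrightarrow> \<beta> * real (card I) < real (card (T i))"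
  shows "\<exists>S. S \<in> cliques (card I) E (\<Union> (T ` I))"
  using assms(1,5-7)
proof (induction I arbitrary: T rule: finite_induct)
  case (insert i0 I)
  have "0 \<le> \<beta> * real (card (insert i0 I))" using assms(4) by simp
  then have "card (T i0) \<noteq> 0" using insert.prems(3)[of i0] by (metis insertI1 not_le of_nat_0)
  then have "T i0 \<noteq> {}" by (metis card.empty)
  then obtain x where x: "x \<in> T i0" by blast
  define T' where "T' j = T j \<inter> E `` {x}" for j
  have ne: "j \<noteq> i0" if "j \<in> I" for j using that insert.hyps by auto
  have "\<exists>S. S \<in> cliques (card I) E (\<Union> (T' ` I))"
  proof (rule insert.IH)
    show "finite (T' i)" if "i \<in> I" for i using insert.prems(1) that by (simp add: T'_def)
    show "real (card (T' j - E `` {y})) \<le> \<beta>" if "i \<in> I" "j \<in> I" "i \<noteq> j" "y \<in> T' i" for i j y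
    proof -
      have "card (T' j - E `` {y}) \<le> card (T j - E `` {y})" using insert.prems(1) that(2) by (intro card_mono) (auto simp: T'_def)
      moreover have "real (card (T j - E `` {y})) \<le> \<beta>" using that by (intro insert.prems(2)[of i]) (auto simp: T'_def)
      ultimately show ?thesis by linarith
    qed
    show "\<beta> * real (card I) < real (card (T' i))" if "i \<in> I" for i
    proof -
      have "real (card (T i - E `` {x})) \<le> \<beta>" using that ne x by (intro insert.prems(2)[of i0]) auto
      moreover have "card (T i) = card (T' i) + card (T i - E `` {x})"
        unfolding T'_def using insert.prems(1)[of i] that by (intro card_Int_Diff) auto
      moreover have "\<beta> * real (card (insert i0 I)) < real (card (T i))" using insert.prems(3) that by auto
      moreover have "\<beta> * real (card (insert i0 I)) = \<beta> + \<beta> * real (card I)"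
        using insert.hyps by (simp add: algebra_simps)
      ultimately show ?thesis by linarith
    qed
  qed
  then obtain S where S: "S \<in> cliques (card I) E (\<Union> (T' ` I))" by blast
  have "\<Union> (T' ` I) \<subseteq> \<Union> (T ` insert i0 I) \<inter> E `` {x}" unfolding T'_def by blast
  moreover have "S \<subseteq> \<Union> (T' ` I)" using S by (simp add: cliques_def)
  ultimately have "S \<subseteq> \<Union> (T ` insert i0 I) \<inter> E `` {x}" by (rule order_trans[rotated])
  then have "S \<in> cliques (card I) E (\<Union> (T ` insert i0 I))" "S \<subseteq> E `` {x}" using S by (simp_all add: cliques_def)
  then have "insert x S \<in> cliques (Suc (card I)) E (\<Union> (T ` insert i0 I))"
    using insert.hyps(1) insert.prems(1) x by (intro cliques_insert_vertex[OF _ _ assms(2,3)]) auto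
  then show ?case using insert.hyps by auto
qed simp

lemma card_Diff_Int_real: "finite A \<Longrightarrow> real (card A) = real (card (A \<inter> B)) + real (card (A - B))"
  by (metis card_Int_Diff of_nat_add)

text \<open>Greedy extension: at most \<open>r - 1\<close> chosen vertices exclude fewer than all
  vertices of \<open>U\<close>. By irreflexivity each chosen vertex is among those it
  excludes.\<close>

lemma clique_exists_of_few_nonneighbours:
  assumes "finite U" "sym E" "irrefl E" "\<And>v. v \<in> U \<Longrightarrow> real (card (U - E `` {v})) \<le> m"
    and "real (r - 1) * m < real (card U)" "p \<le> r" "0 \<le> m"
  shows "\<exists>S. S \<in> cliques p E U"
  using assms(6)
proof (induction p)
  case (Suc p)
  then obtain S where S: "S \<in> cliques p E U" by auto
  then have SU: "S \<subseteq> U" and cS: "card S = p" by (auto simp: cliques_def)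
  have fS: "finite S" using SU assms(1) finite_subset by blast
  have "card (\<Union>v\<in>S. U - E `` {v}) \<le> (\<Sum>v\<in>S. card (U - E `` {v}))" using fS by (rule card_UN_le)
  then have "real (card (\<Union>v\<in>S. U - E `` {v})) \<le> (\<Sum>v\<in>S. real (card (U - E `` {v})))"
    by (metis of_nat_le_iff of_nat_sum)
  also have "\<dots> \<le> (\<Sum>v\<in>S. m)" using SU by (intro sum_mono assms(4)) auto
  also have "\<dots> = real p * m" using cS by simp
  also have "\<dots> \<le> real (r - 1) * m" using Suc.prems assms(7) by (intro mult_right_mono) auto
  also have "\<dots> < real (card U)" by (rule assms(5))
  finally have "(\<Union>v\<in>S. U - E `` {v}) \<noteq> U" by auto
  then obtain w where w: "w \<in> U" "w \<notin> (\<Union>v\<in>S. U - E `` {v})" by blast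
  then have "S \<subseteq> E `` {w}" using assms(2) by (auto dest: symD)
  then show ?case using cliques_insert_vertex[OF S assms(1-3) w(1)] by blast
qed (use assms(1) in auto)

text \<open>A weak form of the Andrasfai-Erdos-Sos theorem.  The vertices adjacent to all but the \<open>i\<close>-th
  vertex of a fixed clique of order \<open>r\<close> form the core of the \<open>i\<close>-th part, and every vertex joins
  a part in whose core it has few neighbours.\<close>

lemma proper_colouring_exists:
  fixes \<eta> :: real
  assumes U: "finite U" and E: "sym E" "irrefl E" and free: "cliques (Suc r) E U = {}"
    and r: "0 < r" and \<eta>: "0 \<le> \<eta>" "\<eta> * (6 * real r ^ 3) \<le> 1"
    and deg: "\<And>v. v \<in> U \<Longrightarrow> real (card (U - E `` {v})) \<le> (1 / real r + \<eta>) * real (card U)"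
  shows "\<exists>c. c ` U \<subseteq> {..<r} \<and> (\<forall>v\<in>U. \<forall>w\<in>U. c v = c w \<longrightarrow> (v, w) \<notin> E)"
proof (cases "U = {}")
  case False
  define u where "u = real (card U)"
  have u: "0 < u" using U False by (simp add: u_def card_gt_0_iff)
  define R where "R = real r"
  have R: "1 \<le> R" using r by (simp add: R_def Suc_le_eq)
  have rR: "real (r - 1) = R - 1" using r by (simp add: R_def of_nat_diff)
  have \<eta>6: "6 * R\<^sup>2 * \<eta> \<le> 1 / R"
    using \<eta>(2) R unfolding R_def[symmetric] by (simp add: field_simps power2_eq_square power3_eq_cube)
  define m where "m = (1 / R + \<eta>) * u"
  have m0: "0 \<le> m" using R u \<eta> by (simp add: m_def)
  have deg: "real (card (U - E `` {v})) \<le> m" if "v \<in> U" for v using deg[OF that] by (simp add: m_def u_def R_def)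
  \<comment> \<open>The total slack: \<open>r\<close> independent parts, each as large as the bound
    \<open>m\<close> on non-neighbours allows, would exceed \<open>u\<close> by exactly
    \<open>\<beta>\<close>.\<close>
  define \<beta> where "\<beta> = R * \<eta> * u"
  have \<beta>0: "0 \<le> \<beta>" using R u \<eta> by (simp add: \<beta>_def)
  have m\<beta>: "R * m = u + \<beta>" using R by (simp add: m_def \<beta>_def field_simps)
  \<comment> \<open>A core has at least \<open>m - \<beta>\<close> vertices. Two vertices of the
    same colour together miss at most \<open>2 * (R + 1) * \<beta>\<close> of it, and a transversal
    of \<open>r - 1\<close> cores consumes another \<open>(R - 1) * \<beta>\<close>.\<close>
  have key: "(3 * R + 1) * \<beta> < m - \<beta>"
  proof -
    have "5 * R\<^sup>2 - ((3 * R + 1) * R + R - 1) = (R - 1)\<^sup>2 + R\<^sup>2" by (simp add: algebra_simps power2_eq_square)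
    moreover have "0 \<le> (R - 1)\<^sup>2 + R\<^sup>2" by simp
    ultimately have "(3 * R + 1) * R + R - 1 \<le> 5 * R\<^sup>2" by linarith
    then have "((3 * R + 1) * R + R - 1) * \<eta> \<le> 5 * R\<^sup>2 * \<eta>" using \<eta>(1) by (rule mult_right_mono)
    also have "\<dots> \<le> 5 / 6 * (1 / R)" using \<eta>6 by simp
    also have "\<dots> < 1 * (1 / R)" using R by (intro mult_strict_right_mono) auto
    finally have "((3 * R + 1) * R + R - 1) * \<eta> * u < 1 * (1 / R) * u" using u by (intro mult_strict_right_mono)
    then show ?thesis by (simp add: m_def \<beta>_def algebra_simps)
  qed
  have "0 \<le> (3 * R + 1) * \<beta>" using R \<beta>0 by simp
  with key have m\<beta>': "\<beta> < m" by linarith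
  have "real (r - 1) * m < u" unfolding rR using m\<beta> m\<beta>' by (simp add: algebra_simps)
  then obtain S where S: "S \<in> cliques r E U" using clique_exists_of_few_nonneighbours[OF U E deg, of r r] m0 by (auto simp: u_def)
  have SU: "S \<subseteq> U" and cS: "card S = r" using S by (auto simp: cliques_def)
  have fS: "finite S" using SU U finite_subset by blast
  obtain g where g: "bij_betw g {..<r} S" using cS fS finite_same_card_bij[of "{..<r}" S] by auto
  have gU: "g j \<in> U" "g j \<in> S" if "j < r" for j using bij_betwE[OF g] that SU by auto
  have gS: "S = g ` {..<r}" using g by (simp add: bij_betw_def)
  define P where "P i = {x \<in> U. \<forall>j<r. j \<noteq> i \<longrightarrow> (g j, x) \<in> E}" for i
  have PU: "P i \<subseteq> U" for i by (auto simp: P_def)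
  have fP: "finite (P i)" for i using PU U finite_subset by blast
  have no_full: False if "x \<in> U" "S \<subseteq> E `` {x}" for x using cliques_insert_vertex[OF S U E that] free by blast
  \<comment> \<open>The core excludes only the non-neighbours of \<open>r - 1\<close> clique
    vertices, and \<open>u - (R - 1) * m = m - \<beta>\<close>.\<close>
  have Psize: "m - \<beta> \<le> real (card (P i))" if i: "i < r" for i
  proof -
    have "U - P i \<subseteq> (\<Union>j\<in>{..<r} - {i}. U - E `` {g j})" by (auto simp: P_def)
    then have "card (U - P i) \<le> card (\<Union>j\<in>{..<r} - {i}. U - E `` {g j})" using U by (intro card_mono) auto
    also have "\<dots> \<le> (\<Sum>j\<in>{..<r} - {i}. card (U - E `` {g j}))" by (intro card_UN_le) auto
    finally have "real (card (U - P i)) \<le> (\<Sum>j\<in>{..<r} - {i}. real (card (U - E `` {g j})))"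
      by (metis of_nat_le_iff of_nat_sum)
    also have "\<dots> \<le> (\<Sum>j\<in>{..<r} - {i}. m)" using gU by (intro sum_mono deg) auto
    also have "\<dots> = (R - 1) * m" using i rR by simp
    finally have "real (card (U - P i)) \<le> (R - 1) * m" .
    moreover have "U \<inter> P i = P i" using PU by blast
    then have "u = real (card (P i)) + real (card (U - P i))" unfolding u_def using card_Diff_Int_real[OF U, of "P i"] by simp
    ultimately show ?thesis using m\<beta> by (simp add: algebra_simps)
  qed
  have indep: "(x, y) \<notin> E" if i: "i < r" and xy: "x \<in> P i" "y \<in> P i" for x y i
  proof
    assume e: "(x, y) \<in> E"
    have sub: "S - {g i} \<subseteq> E `` {z}" if "z \<in> P i" for z
    proof
      fix w assume "w \<in> S - {g i}"
      then obtain j where "j < r" "j \<noteq> i" "w = g j" using gS by auto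
      then have "(w, z) \<in> E" using that by (auto simp: P_def)
      then show "w \<in> E `` {z}" using E(1) by (auto dest: symD)
    qed
    have xU: "x \<in> U" and yU: "y \<in> U" using xy PU by auto
    have "S - {g i} \<in> cliques (r - 1) E U" by (rule cliques_subset[OF _ S]) (use cS fS gU[OF i] in auto)
    then have "insert x (S - {g i}) \<in> cliques (Suc (r - 1)) E U" by (rule cliques_insert_vertex[OF _ U E xU sub[OF xy(1)]])
    moreover have "insert x (S - {g i}) \<subseteq> E `` {y}" using sub[OF xy(2)] e E(1) by (auto dest: symD)
    ultimately have "insert y (insert x (S - {g i})) \<in> cliques (Suc (Suc (r - 1))) E U"
      by (rule cliques_insert_vertex[OF _ U E yU])
    then show False using free r by simp
  qed
  have disj: "P i \<inter> P j = {}" if "i < r" "j < r" "i \<noteq> j" for i j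
  proof (rule ccontr)
    assume "P i \<inter> P j \<noteq> {}"
    then obtain x where x: "x \<in> P i" "x \<in> P j" by blast
    have "(g l, x) \<in> E" if "l < r" for l using x that \<open>i \<noteq> j\<close> by (cases "l = i") (auto simp: P_def)
    then have "S \<subseteq> E `` {x}" unfolding gS using E(1) by (auto dest: symD)
    then show False using no_full[of x] x(1) PU by blast
  qed
  \<comment> \<open>A core vertex already misses its whole core, of size at least
    \<open>m - \<beta>\<close>, so at most \<open>\<beta>\<close> non-neighbours are left for the
    others.\<close>
  have miss: "real (card (P j - E `` {x})) \<le> \<beta>" if "i < r" "j < r" "i \<noteq> j" "x \<in> P i" for i j x
  proof -
    have xU: "x \<in> U" using that(4) PU by blast
    have "P i \<union> (P j - E `` {x}) \<subseteq> U - E `` {x}" using PU indep[OF that(1,4)] by blast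
    then have "card (P i \<union> (P j - E `` {x})) \<le> card (U - E `` {x})" using U by (intro card_mono) auto
    moreover have "card (P i \<union> (P j - E `` {x})) = card (P i) + card (P j - E `` {x})"
      using disj[OF that(1-3)] fP by (intro card_Un_disjoint) auto
    ultimately show ?thesis using Psize[OF that(1)] deg[OF xU] by linarith
  qed
  \<comment> \<open>With more neighbours in every core, a transversal clique among the neighbours of
    \<open>y\<close> would extend by \<open>y\<close> to a clique of order
    \<open>r + 1\<close>.\<close>
  have "\<exists>i<r. real (card (P i \<inter> E `` {y})) \<le> R * \<beta>" if y: "y \<in> U" for y
  proof (rule ccontr)
    assume "\<not> (\<exists>i<r. real (card (P i \<inter> E `` {y})) \<le> R * \<beta>)"
    then have big: "\<beta> * real (card {..<r}) < real (card (P i \<inter> E `` {y}))" if "i \<in> {..<r}" for i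
      using that by (auto simp: R_def mult.commute not_le)
    have "\<exists>Q. Q \<in> cliques (card {..<r}) E (\<Union>i\<in>{..<r}. P i \<inter> E `` {y})"
    proof (rule transversal_clique[OF _ E \<beta>0 _ _ big])
      show "real (card (P j \<inter> E `` {y} - E `` {x})) \<le> \<beta>"
        if "i \<in> {..<r}" "j \<in> {..<r}" "i \<noteq> j" "x \<in> P i \<inter> E `` {y}" for i j x
      proof -
        have "card (P j \<inter> E `` {y} - E `` {x}) \<le> card (P j - E `` {x})" using fP by (intro card_mono) auto
        then show ?thesis using miss[of i j x] that by auto
      qed
    qed (use fP in auto)
    then obtain Q where Q: "Q \<in> cliques r E (\<Union>i\<in>{..<r}. P i \<inter> E `` {y})" by auto
    have "(\<Union>i\<in>{..<r}. P i \<inter> E `` {y}) \<subseteq> U \<inter> E `` {y}" using PU by blast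
    then have "Q \<in> cliques r E U" "Q \<subseteq> E `` {y}" using Q by (auto simp: cliques_def)
    then show False using cliques_insert_vertex[OF _ U E y] free by blast
  qed
  then obtain c where c: "\<And>y. y \<in> U \<Longrightarrow> c y < r"
    "\<And>y. y \<in> U \<Longrightarrow> real (card (P (c y) \<inter> E `` {y})) \<le> R * \<beta>" by metis
  \<comment> \<open>In the core of its own colour \<open>y\<close> misses at least
    \<open>m - \<beta> - R * \<beta>\<close> vertices, out of at most \<open>m\<close> in
    total.\<close>
  have missU: "real (card (P j - E `` {y})) \<le> (R + 1) * \<beta>" if y: "y \<in> U" and j: "j < r" "j \<noteq> c y" for y j
  proof -
    have "(P (c y) - E `` {y}) \<union> (P j - E `` {y}) \<subseteq> U - E `` {y}" using PU by blast
    then have "card ((P (c y) - E `` {y}) \<union> (P j - E `` {y})) \<le> card (U - E `` {y})" using U by (intro card_mono) auto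
    moreover have "card ((P (c y) - E `` {y}) \<union> (P j - E `` {y}))
        = card (P (c y) - E `` {y}) + card (P j - E `` {y})"
      using disj[OF c(1)[OF y] j(1)] j(2) fP by (intro card_Un_disjoint) auto
    moreover have "real (card (P (c y))) = real (card (P (c y) \<inter> E `` {y})) + real (card (P (c y) - E `` {y}))"
      using fP by (rule card_Diff_Int_real)
    ultimately show ?thesis using Psize[OF c(1)[OF y]] deg[OF y] c(2)[OF y] by (simp add: algebra_simps)
  qed
  \<comment> \<open>Two adjacent vertices of the same colour have a common transversal clique in the
    \<open>r - 1\<close> other cores, which again gives order \<open>r + 1\<close>.\<close>
  have "(y, z) \<notin> E" if yz: "y \<in> U" "z \<in> U" "c y = c z" for y z
  proof
    assume e: "(y, z) \<in> E"
    define I where "I = {..<r} - {c y}"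
    have cI: "card I = r - 1" using c(1)[OF yz(1)] by (simp add: I_def)
    define T where "T j = P j \<inter> E `` {y} \<inter> E `` {z}" for j
    have big: "\<beta> * real (card I) < real (card (T j))" if j: "j \<in> I" for j
    proof -
      have jr: "j < r" "j \<noteq> c y" "j \<noteq> c z" using j yz(3) by (auto simp: I_def)
      have 1: "real (card (P j)) = real (card (P j \<inter> E `` {y})) + real (card (P j - E `` {y}))"
        using fP by (rule card_Diff_Int_real)
      have 2: "real (card (P j \<inter> E `` {y})) = real (card (T j)) + real (card (P j \<inter> E `` {y} - E `` {z}))"
        unfolding T_def using fP by (intro card_Diff_Int_real) auto
      have 3: "card (P j \<inter> E `` {y} - E `` {z}) \<le> card (P j - E `` {z})" using fP by (intro card_mono) auto
      have "m - \<beta> - 2 * ((R + 1) * \<beta>) \<le> real (card (T j))"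
        using 1 2 3 missU[OF yz(1) jr(1,2)] missU[OF yz(2) jr(1,3)] Psize[OF jr(1)] by linarith
      moreover have "\<beta> * real (card I) = R * \<beta> - \<beta>" unfolding cI rR by (simp add: algebra_simps)
      moreover have "(3 * R + 1) * \<beta> = 3 * (R * \<beta>) + \<beta>" "(R + 1) * \<beta> = R * \<beta> + \<beta>"
        by (simp_all add: algebra_simps)
      ultimately show ?thesis using key by linarith
    qed
    have "\<exists>Q. Q \<in> cliques (card I) E (\<Union> (T ` I))"
    proof (rule transversal_clique[OF _ E \<beta>0 _ _ big])
      show "real (card (T j - E `` {x})) \<le> \<beta>" if "i \<in> I" "j \<in> I" "i \<noteq> j" "x \<in> T i" for i j x
      proof -
        have "card (T j - E `` {x}) \<le> card (P j - E `` {x})" using fP by (intro card_mono) (auto simp: T_def)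
        then show ?thesis using miss[of i j x] that by (auto simp: I_def T_def)
      qed
    qed (use fP in \<open>auto simp: I_def T_def\<close>)
    then obtain Q where Q: "Q \<in> cliques (r - 1) E (\<Union> (T ` I))" using cI by auto
    have "\<Union> (T ` I) \<subseteq> U \<inter> E `` {y} \<inter> E `` {z}" using PU unfolding T_def by blast
    moreover have "Q \<subseteq> \<Union> (T ` I)" using Q by (simp add: cliques_def)
    ultimately have "Q \<subseteq> U \<inter> E `` {y} \<inter> E `` {z}" by (rule order_trans[rotated])
    then have Q': "Q \<in> cliques (r - 1) E U" "Q \<subseteq> E `` {y}" "Q \<subseteq> E `` {z}"
      using Q by (simp_all add: cliques_def)
    have "insert y Q \<in> cliques (Suc (r - 1)) E U" by (rule cliques_insert_vertex[OF Q'(1) U E yz(1) Q'(2)])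
    moreover have "insert y Q \<subseteq> E `` {z}" using Q'(3) e E(1) by (auto dest: symD)
    ultimately have "insert z (insert y Q) \<in> cliques (Suc (Suc (r - 1))) E U" by (rule cliques_insert_vertex[OF _ U E yz(2)])
    then show False using free r by simp
  qed
  then show ?thesis using c(1) by (intro exI[of _ c]) auto
qed simp

text \<open>A colour class is contained in the non-neighbourhood of each of its vertices, so it has
  at most \<open>m\<close> vertices. Counting the other classes bounds it from below, and what it
  leaves of the non-neighbourhood bounds the missing edges to other classes.\<close>

lemma colouring_regularity:
  fixes m :: real
  assumes U: "finite U" and c: "c ` U \<subseteq> {..<r}" "\<And>v w. v \<in> U \<Longrightarrow> w \<in> U \<Longrightarrow> c v = c w \<Longrightarrow> (v, w) \<notin> E"
    and deg: "\<And>v. v \<in> U \<Longrightarrow> real (card (U - E `` {v})) \<le> m" and m: "0 \<le> m"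
  shows "\<And>i. i < r \<Longrightarrow> real (card U) - (real r - 1) * m \<le> real (card {v \<in> U. c v = i})"
    and "\<And>v. v \<in> U \<Longrightarrow> real (card ({w \<in> U. c w \<noteq> c v} - E `` {v})) \<le> real r * m - real (card U)"
proof -
  let ?P = "\<lambda>i. {v \<in> U. c v = i}"
  have up: "real (card (?P i)) \<le> m" for i
  proof (cases "?P i = {}")
    case True
    then have "card (?P i) = 0" by (metis card.empty)
    then show ?thesis using m by simp
  next
    case False
    then obtain v where v: "v \<in> U" "c v = i" by blast
    have "?P i \<subseteq> U - E `` {v}" using c(2) v by auto
    then have "card (?P i) \<le> card (U - E `` {v})" using U by (intro card_mono) auto
    then show ?thesis using deg[OF v(1)] by linarith
  qed
  have "card U = (\<Sum>i<r. card (?P i))" using sum.group[of U "{..<r}" c "\<lambda>_. 1::nat"] U c by simp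
  then have tot: "real (card U) = (\<Sum>i<r. real (card (?P i)))" by simp
  show low: "real (card U) - (real r - 1) * m \<le> real (card (?P i))" if i: "i < r" for i
  proof -
    have "real (card U) = real (card (?P i)) + (\<Sum>j\<in>{..<r} - {i}. real (card (?P j)))"
      unfolding tot using i by (intro sum.remove) auto
    also have "(\<Sum>j\<in>{..<r} - {i}. real (card (?P j))) \<le> (\<Sum>j\<in>{..<r} - {i}. m)" by (intro sum_mono up)
    also have "\<dots> = (real r - 1) * m" using i by (simp add: of_nat_diff)
    finally show ?thesis by simp
  qed
  show "real (card ({w \<in> U. c w \<noteq> c v} - E `` {v})) \<le> real r * m - real (card U)" if v: "v \<in> U" for v
  proof -
    let ?M = "{w \<in> U. c w \<noteq> c v} - E `` {v}"
    have "?P (c v) \<union> ?M \<subseteq> U - E `` {v}" using c(2) v by auto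
    then have "card (?P (c v) \<union> ?M) \<le> card (U - E `` {v})" using U by (intro card_mono) auto
    moreover have "card (?P (c v) \<union> ?M) = card (?P (c v)) + card ?M" using U by (intro card_Un_disjoint) auto
    moreover have "c v < r" using c(1) v by auto
    ultimately show ?thesis using low[of "c v"] deg[OF v] by (simp add: algebra_simps)
  qed
qed

section \<open>The extremal graph\<close>

text \<open>The power mean inequality, by the tangent of the \<open>t\<close>-th power at 1.\<close>

lemma sum_le_card_of_power_sum:
  fixes x :: "'a \<Rightarrow> real"
  assumes "0 < t" "\<And>v. v \<in> V \<Longrightarrow> 0 \<le> x v" "(\<Sum>v\<in>V. x v ^ t) = real (card V)"
  shows "(\<Sum>v\<in>V. x v) \<le> real (card V)"
proof -
  have "(\<Sum>v\<in>V. 1 + real t * (x v - 1)) \<le> (\<Sum>v\<in>V. x v ^ t)"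
    using power_ge_tangent[of _ 1 t] assms(2) by (intro sum_mono) auto
  then have "real t * ((\<Sum>v\<in>V. x v) - real (card V)) \<le> 0"
    using assms(3) by (simp add: sum.distrib sum_distrib_left[symmetric] sum_subtractf)
  then show ?thesis using assms(1) by (simp add: mult_le_0_iff)
qed

text \<open>By the eigenvalue equation \<open>\<rho> * x v ^ (t - 1)\<close> is at most the
  \<open>(t - 1)\<close>-th power of the total weight, hence of \<open>n\<close>. A radius of order
  \<open>n ^ (t - 1)\<close> thus bounds every weight independently of \<open>n\<close>.\<close>

lemma perron_weight_le:
  fixes x :: "'a \<Rightarrow> real"
  assumes V: "finite V" and E: "sym E" and t: "2 \<le> t" and x: "\<And>v. 0 \<le> x v" "(\<Sum>v\<in>V. x v ^ t) = real (card V)"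
    and v: "v \<in> V" "\<rho> * x v ^ (t - 1) = kap (t - 1) E x (V \<inter> E `` {v})"
    and c0: "0 < c0" "c0 * real (card V) ^ (t - 1) \<le> \<rho>"
  shows "x v \<le> max 1 (1 / c0)"
proof (rule ccontr)
  assume "\<not> x v \<le> max 1 (1 / c0)"
  then have big: "1 < x v" "1 / c0 < x v" by auto
  have n: "0 < real (card V)" using V v(1) by (auto simp: card_gt_0_iff)
  have X0: "0 \<le> (\<Sum>v\<in>V. x v)" using x(1) by (intro sum_nonneg) auto
  have "c0 * real (card V) ^ (t - 1) * x v ^ (t - 1) \<le> \<rho> * x v ^ (t - 1)" using c0(2) x(1) by (intro mult_right_mono) auto
  also have "\<dots> \<le> kap (t - 1) E x V" unfolding v(2) using V x(1) by (intro kap_mono_set) auto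
  also have "\<dots> \<le> (\<Sum>v\<in>V. x v) ^ (t - 1)" using V E x(1) by (intro kap_le_power) auto
  also have "\<dots> \<le> real (card V) ^ (t - 1)" using sum_le_card_of_power_sum[of t V x] x t X0 by (intro power_mono) auto
  finally have "real (card V) ^ (t - 1) * (c0 * x v ^ (t - 1)) \<le> real (card V) ^ (t - 1) * 1" by (simp add: mult_ac)
  then have "c0 * x v ^ (t - 1) \<le> 1" using n by (simp only: mult_le_cancel_left_pos zero_less_power)
  moreover have "x v \<le> x v ^ (t - 1)" using big t by (intro self_le_power) auto
  then have "c0 * x v \<le> c0 * x v ^ (t - 1)" using c0(1) by simp
  moreover have "1 < c0 * x v" using big(2) c0(1) by (simp add: field_simps)
  ultimately show False by linarith
qed

text \<open>Any \<open>s\<close> of the classes contribute at least \<open>Q ^ s\<close>; adding one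
  class at a time is Pascal's rule.\<close>

lemma kap_jn_classes_ge:
  assumes V: "finite V" and x: "\<And>v. v \<in> V \<Longrightarrow> 0 \<le> x v" and Q: "0 \<le> Q"
    and I: "finite I" "I \<subseteq> {..<r}" "\<And>i. i \<in> I \<Longrightarrow> Q \<le> (\<Sum>v\<in>{v \<in> V. c v = i}. x v)"
  shows "real (card I choose s) * Q ^ s \<le> kap s (jn r V c) x {v \<in> V. c v \<in> I}"
  using I
proof (induction I arbitrary: s rule: finite_induct)
  case empty
  then show ?case by (cases s) auto
next
  case (insert p I)
  show ?case
  proof (cases s)
    case 0
    then show ?thesis using V by simp
  next
    case (Suc j)
    let ?K = "\<lambda>s. kap s (jn r V c) x {v \<in> V. c v \<in> I}"
    let ?P = "{v \<in> V. c v = p}"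
    have IH: "real (card I choose s) * Q ^ s \<le> ?K s" for s using insert by auto
    have "{v \<in> V. c v \<in> insert p I} - ?P = {v \<in> V. c v \<in> I}" using insert.hyps by auto
    moreover have "kap (Suc j) (jn r V c) x {v \<in> V. c v \<in> insert p I}
      = kap (Suc j) (jn r V c) x ({v \<in> V. c v \<in> insert p I} - ?P)
        + (\<Sum>v\<in>?P. x v) * kap j (jn r V c) x ({v \<in> V. c v \<in> insert p I} - ?P)"
      using V insert.prems(1) by (intro kap_jn_class[where p = p]) auto
    ultimately have "kap s (jn r V c) x {v \<in> V. c v \<in> insert p I} = ?K (Suc j) + (\<Sum>v\<in>?P. x v) * ?K j"
      using Suc by simp
    moreover have "Q * (real (card I choose j) * Q ^ j) \<le> (\<Sum>v\<in>?P. x v) * ?K j"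
      using insert.prems(2)[of p] IH Q x by (intro mult_mono) (auto intro!: sum_nonneg)
    moreover have "real (card (insert p I) choose s) * Q ^ s
        = real (card I choose Suc j) * Q ^ Suc j + Q * (real (card I choose j) * Q ^ j)"
      using insert.hyps Suc by (simp add: algebra_simps)
    ultimately show ?thesis using IH[of "Suc j"] by linarith
  qed
qed

definition hgraph :: "nat \<Rightarrow> nat \<Rightarrow> nat \<Rightarrow> (nat + nat) pair_pre_digraph" where
  "hgraph r k n = graph_join (complete_graph (k - 1)) (turan_graph r (n - k + 1))"

definition hcol :: "nat \<Rightarrow> nat + nat \<Rightarrow> nat" where
  "hcol r = case_sum (\<lambda>_. r) (\<lambda>v. v mod r)"

lemma pair_graph_hgraph: "pair_graph (hgraph r k n)"
  unfolding hgraph_def by (intro pair_graph_graph_join pair_graph_complete_graph pair_graph_turan_graph)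

lemma pverts_hgraph: "pverts (hgraph r k n) = {..<k - 1} <+> {..<n - k + 1}"
  by (simp add: hgraph_def graph_join_def complete_graph_def turan_graph_def)

lemma finite_pverts_hgraph [simp]: "finite (pverts (hgraph r k n))"
  by (simp add: pverts_hgraph)

lemma card_pverts_hgraph: "1 \<le> k \<Longrightarrow> k \<le> n \<Longrightarrow> card (pverts (hgraph r k n)) = n"
  by (simp add: pverts_hgraph card_Plus)

lemma parcs_hgraph:
  assumes "0 < r"
  shows "parcs (hgraph r k n) = jn r (pverts (hgraph r k n)) (hcol r)"
proof -
  have m: "v mod r \<noteq> r" "r \<noteq> v mod r" for v using mod_less_divisor[OF assms, of v] by auto
  have "(a, b) \<in> parcs (hgraph r k n) \<longleftrightarrow> (a, b) \<in> jn r (pverts (hgraph r k n)) (hcol r)" for a b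
    unfolding pverts_hgraph
    by (cases a; cases b)
      (auto simp: hgraph_def graph_join_def complete_graph_def turan_graph_def jn_def hcol_def m)
  then show ?thesis by auto
qed

lemma hcol_image: "0 < r \<Longrightarrow> hcol r ` S \<subseteq> {..r}"
  by (auto simp: hcol_def less_imp_le split: sum.splits)

lemma hcol_eq_r:
  assumes "0 < r"
  shows "{v \<in> pverts (hgraph r k n). hcol r v = r} = Inl ` {..<k - 1}"
proof -
  have "v mod r \<noteq> r" for v using mod_less_divisor[OF assms, of v] by auto
  then show ?thesis by (auto simp: pverts_hgraph hcol_def)
qed

lemma hcol_class: "i < r \<Longrightarrow>
    {v \<in> pverts (hgraph r k n). hcol r v = i} = Inr ` {v. v < n - k + 1 \<and> v mod r = i}"
  by (auto simp: pverts_hgraph hcol_def)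

lemma balanced_hgraph: "balanced r (pverts (hgraph r k n)) (hcol r)"
  unfolding balanced_def
  using turan_graph_balanced[of _ r _ "n - k + 1"] by (simp add: hcol_class card_image turan_graph_def)

lemma hgraph_class_ge:
  assumes "i < r"
  shows "real (n - k + 1) \<le> real r * (real (card {v \<in> pverts (hgraph r k n). hcol r v = i}) + 1)"
proof -
  let ?m = "n - k + 1"
  let ?f = "\<lambda>i. card {v. v < ?m \<and> v mod r = i}"
  have "(\<Sum>j<r. ?f j) = ?m" using sum.group[of "{..<?m}" "{..<r}" "\<lambda>v. v mod r" "\<lambda>_. 1::nat"] assms
    by (simp add: image_subset_iff)
  then have "?m = (\<Sum>j<r. ?f j)" by (rule sym)
  also have "\<dots> \<le> (\<Sum>j<r. ?f i + 1)"
    using turan_graph_balanced[of _ r i ?m] assms by (intro sum_mono) (auto simp: turan_graph_def)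
  also have "\<dots> = r * (?f i + 1)" by simp
  finally have "real ?m \<le> real (r * (?f i + 1))" by (simp only: of_nat_le_iff)
  then show ?thesis using assms by (simp add: hcol_class card_image algebra_simps)
qed

definition hrho :: "nat \<Rightarrow> nat \<Rightarrow> nat \<Rightarrow> nat \<Rightarrow> real" where
  "hrho r t k n = clique_spectral_radius t (hgraph r k n)"

lemma hrho_eq: "0 < r \<Longrightarrow>
    hrho r t k n = rho t (jn r (pverts (hgraph r k n)) (hcol r)) (pverts (hgraph r k n))"
  by (simp add: hrho_def parcs_hgraph[symmetric] rho_pverts_parcs)

text \<open>The test vector is constantly 1, and only the cliques inside the Turan graph are
  counted. Its parts have at least \<open>(n - k - r) / r\<close> vertices because they differ by at
  most one; the binomial identity \<open>t * (r choose t) = r * (r - 1 choose (t - 1))\<close>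
  brings the constant into the form of \<open>tcoef\<close>.\<close>

lemma hrho_ge:
  assumes t: "2 \<le> t" "t \<le> r" and k: "1 \<le> k" and n: "k + r \<le> n"
  shows "real (r - 1 choose (t - 1)) / real r ^ (t - 1) * real (n - k - r) ^ t \<le> hrho r t k n * real n"
proof -
  let ?V = "pverts (hgraph r k n)"
  let ?E = "jn r ?V (hcol r)"
  have r: "0 < r" using t by simp
  define Q where "Q = real (n - k - r) / real r"
  have Q: "Q \<le> (\<Sum>v\<in>{v \<in> ?V. hcol r v = i}. 1)" if "i \<in> {..<r}" for i
  proof -
    have "real (n - k - r) \<le> real r * real (card {v \<in> ?V. hcol r v = i})"
      using hgraph_class_ge[of i r n k] that n by (simp add: algebra_simps of_nat_diff)
    then show ?thesis using r by (simp add: Q_def field_simps)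
  qed
  have "real (card {..<r} choose t) * Q ^ t \<le> kap t ?E (\<lambda>_. 1) {v \<in> ?V. hcol r v \<in> {..<r}}"
    using Q by (intro kap_jn_classes_ge) (auto simp: Q_def)
  also have "\<dots> \<le> kap t ?E (\<lambda>_. 1) ?V" by (intro kap_mono_set) auto
  finally have "real t * (real (r choose t) * Q ^ t) \<le> real t * kap t ?E (\<lambda>_. 1) ?V" by (simp add: mult_left_mono)
  also have "\<dots> \<le> hrho r t k n * (\<Sum>v\<in>?V. 1 ^ t)" unfolding hrho_eq[OF r] using t k n card_pverts_hgraph[of k n r]
    by (intro rho_upper) auto
  also have "\<dots> = hrho r t k n * real n" using card_pverts_hgraph[of k n r] k n by simp
  finally have 1: "real t * (real (r choose t) * Q ^ t) \<le> hrho r t k n * real n" .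
  obtain t' where t': "t = Suc t'" using t by (cases t) auto
  obtain r' where "r = Suc r'" using r by (cases r) auto
  note tr = t' this
  have "t * (r choose t) = r * (r - 1 choose (t - 1))" using Suc_times_binomial[of t' r'] tr by simp
  then have "real t * real (r choose t) = real r * real (r - 1 choose (t - 1))" by (metis of_nat_mult)
  then have "real t * (real (r choose t) * Q ^ t) = real r * real (r - 1 choose (t - 1)) * Q ^ t" by (simp add: mult.assoc)
  also have "\<dots> = real (r - 1 choose (t - 1)) / real r ^ (t - 1) * real (n - k - r) ^ t"
    unfolding Q_def power_divide using r by (simp add: tr)
  finally show ?thesis using 1 by simp
qed

lemma jn_le_hrho:
  assumes t: "2 \<le> t" and r: "0 < r" and k: "1 \<le> k" "k \<le> n" and pos: "0 < hrho r t k n"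
    and V: "finite V" "card V = n" and c: "c ` V \<subseteq> {..r}" "card {v \<in> V. c v = r} = k - 1"
  shows "rho t (jn r V c) V \<le> hrho r t k n"
    and "rho t (jn r V c) V = hrho r t k n \<Longrightarrow>
      iso_on V (jn r V c) (pverts (hgraph r k n)) (parcs (hgraph r k n))"
proof -
  have "V \<noteq> {}" using V k by auto
  moreover have "card {v \<in> V. c v = r} = card {v \<in> pverts (hgraph r k n). hcol r v = r}"
    unfolding hcol_eq_r[OF r] using c(2) by (simp add: card_image)
  ultimately show "rho t (jn r V c) V \<le> hrho r t k n"
    "rho t (jn r V c) V = hrho r t k n \<Longrightarrow>
      iso_on V (jn r V c) (pverts (hgraph r k n)) (parcs (hgraph r k n))"
    unfolding hrho_eq[OF r] parcs_hgraph[OF r]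
    using jn_extremal[OF V(1) _ finite_pverts_hgraph _ r t c(1) hcol_image[OF r] balanced_hgraph, of k n]
      V(2) card_pverts_hgraph[OF k, of r] pos[unfolded hrho_eq[OF r]] by auto
qed

text \<open>The leading coefficient of the extremal spectral radius, which grows like
  \<open>n ^ (t - 1)\<close>: a vertex of the Turan graph is completed to a \<open>t\<close>-clique
  by choosing \<open>t - 1\<close> of the other parts and a vertex in each.\<close>

definition tcoef :: "nat \<Rightarrow> nat \<Rightarrow> real" where
  "tcoef r t = real (r - 1 choose (t - 1)) / real r ^ (t - 1)"

text \<open>The bound on Perron weights from \<open>perron_weight_le\<close>; the factor
  \<open>2 ^ t\<close> pays for replacing \<open>n - k - r\<close> by \<open>n / 2\<close>.\<close>

definition wmax :: "nat \<Rightarrow> nat \<Rightarrow> real" where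
  "wmax r t = max 1 (1 / (tcoef r t / 2 ^ t))"

lemma tcoef_pos: "2 \<le> t \<Longrightarrow> t \<le> r \<Longrightarrow> 0 < tcoef r t"
  by (simp add: tcoef_def)

lemma hrho_ge_power:
  assumes t: "2 \<le> t" "t \<le> r" and k: "1 \<le> k" and n: "2 * (k + r) \<le> n"
  shows "tcoef r t / 2 ^ t * real n ^ (t - 1) \<le> hrho r t k n"
proof -
  obtain s where s: "t = Suc s" using t by (cases t) auto
  have n0: "0 < real n" using n k by simp
  have "real n / 2 \<le> real (n - k - r)" using n by (simp add: of_nat_diff)
  then have "(real n / 2) ^ t \<le> real (n - k - r) ^ t" by (intro power_mono) auto
  then have "tcoef r t * (real n / 2) ^ t \<le> tcoef r t * real (n - k - r) ^ t" using tcoef_pos[OF t] by (intro mult_left_mono) auto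
  also have "\<dots> \<le> hrho r t k n * real n" using hrho_ge[OF t k, of n] n by (simp add: tcoef_def)
  finally have "tcoef r t / 2 ^ t * real n ^ (t - 1) * real n \<le> hrho r t k n * real n" by (simp add: s power_divide mult_ac)
  then show ?thesis using n0 by (rule mult_right_le_imp_le)
qed

lemma hrho_pos:
  assumes "2 \<le> t" "t \<le> r" "1 \<le> k" "2 * (k + r) \<le> n"
  shows "0 < hrho r t k n"
proof -
  have "0 < tcoef r t / 2 ^ t * real n ^ (t - 1)" using tcoef_pos[OF assms(1,2)] assms by simp
  then show ?thesis using hrho_ge_power[OF assms] by linarith
qed

lemma weight_le_wmax:
  fixes x :: "'a \<Rightarrow> real"
  assumes t: "2 \<le> t" "t \<le> r" and k: "1 \<le> k" and n: "2 * (k + r) \<le> card V"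
    and V: "finite V" and E: "sym E" and x: "\<And>v. 0 \<le> x v" "(\<Sum>v\<in>V. x v ^ t) = real (card V)"
    and \<rho>: "hrho r t k (card V) \<le> \<rho>"
    and v: "v \<in> V" "\<rho> * x v ^ (t - 1) = kap (t - 1) E x (V \<inter> E `` {v})"
  shows "x v \<le> wmax r t"
  unfolding wmax_def
  using hrho_ge_power[OF t k n] tcoef_pos[OF t] \<rho> by (intro perron_weight_le[OF V E t(1) x v]) auto

text \<open>Clone the heaviest vertex \<open>w\<close> of the Turan part. With \<open>M\<close> the
  \<open>t\<close>-th power of its weight, this multiplies the radius by at least
  \<open>(n + t * M) / (n + M)\<close>, and the cloned graph is still of the form \<open>jn\<close>,
  hence at most extremal. Moreover \<open>M \<ge> 1 - \<epsilon>\<close>, because fewer than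
  \<open>k\<close> vertices lie outside the Turan part and their weights are bounded.\<close>

lemma hrho_step:
  assumes t: "2 \<le> t" "t \<le> r" and k: "1 \<le> k" and n: "2 * (k + r) \<le> n"
    and \<epsilon>: "real k * wmax r t ^ t < \<epsilon> * real n"
  shows "hrho r t k n * (1 + real (t - 1) * (1 - \<epsilon>) / real (n + 1)) \<le> hrho r t k (n + 1)"
proof -
  have r: "0 < r" using t by simp
  obtain s where s: "t = Suc s" using t by (cases t) auto
  define V where "V = pverts (hgraph r k n)"
  define E where "E = jn r V (hcol r)"
  have V: "finite V" "card V = n" "V \<noteq> {}" using card_pverts_hgraph[of k n r] k n by (auto simp: V_def)
  define h where "h = hrho r t k n"
  have h: "h = rho t E V" unfolding h_def E_def V_def by (rule hrho_eq[OF r])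
  have h0: "0 < h" unfolding h_def by (rule hrho_pos[OF t k n])
  have EE: "sym E" "irrefl E" by (auto simp: E_def)
  obtain x where x: "\<And>v. 0 \<le> x v" "(\<Sum>v\<in>V. x v ^ t) = real (card V)"
    "real t * kap t E x V = h * real n"
    "\<And>v. v \<in> V \<Longrightarrow> h * x v ^ (t - 1) = kap (t - 1) E x (V \<inter> E `` {v})"
    using perron[OF V(1,3) EE t(1)] V(2) unfolding h by metis
  have xD: "x v \<le> wmax r t" if "v \<in> V" for v
    using weight_le_wmax[OF t k _ V(1) EE(1) x(1,2) _ that x(4)[OF that]] n V(2) h_def by simp
  define A where "A = Inl ` {..<k - 1} \<inter> V"
  define B where "B = (Inr ` {..<n - k + 1} :: (nat + nat) set)"
  have AB: "V = A \<union> B" "A \<inter> B = {}" "finite A" "finite B" by (auto simp: V_def pverts_hgraph A_def B_def)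
  have cA: "card A \<le> k" and cB: "card B \<le> n"
  proof -
    have "card A \<le> card (Inl ` {..<k - 1} :: (nat + nat) set)" by (intro card_mono) (auto simp: A_def)
    then show "card A \<le> k" by (simp add: card_image)
    show "card B \<le> n" unfolding B_def using k n by (simp add: card_image)
  qed
  have neB: "B \<noteq> {}" by (auto simp: B_def)
  then have "Max (x ` B) \<in> x ` B" using AB by (intro Max_in) auto
  then obtain w where w: "w \<in> B" "x w = Max (x ` B)" by auto
  have wmax: "x v \<le> x w" if "v \<in> B" for v using that AB(4) w(2) by simp
  have wV: "w \<in> V" using w AB by blast
  have cw: "hcol r w < r" using w r by (auto simp: B_def hcol_def)
  define M where "M = x w ^ t"
  have M0: "0 \<le> M" using x(1) by (simp add: M_def)
  have "real n = (\<Sum>v\<in>A. x v ^ t) + (\<Sum>v\<in>B. x v ^ t)" using x(2) V(2) AB by (simp add: sum.union_disjoint)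
  also have "\<dots> \<le> (\<Sum>v\<in>A. wmax r t ^ t) + (\<Sum>v\<in>B. M)"
    using x(1) xD wmax AB(1) unfolding M_def by (intro add_mono sum_mono power_mono) auto
  also have "\<dots> = real (card A) * wmax r t ^ t + real (card B) * M" by simp
  also have "\<dots> \<le> real k * wmax r t ^ t + real n * M" using cA cB M0 by (intro add_mono mult_right_mono) (auto simp: wmax_def)
  finally have "real n < \<epsilon> * real n + real n * M" using \<epsilon> by linarith
  then have "real n * (1 - \<epsilon>) < real n * M" by (simp add: algebra_simps)
  then have M: "1 - \<epsilon> \<le> M" using n k by (simp add: mult_less_cancel_left)
  \<comment> \<open>A fresh vertex: the clique uses only \<open>Inl i\<close> with
    \<open>i < k - 1\<close>.\<close>
  define z where "z = (Inl k :: nat + nat)"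
  have z: "z \<notin> V" by (auto simp: z_def V_def pverts_hgraph)
  define V' where "V' = insert z V"
  define c' where "c' = (hcol r)(z := hcol r w)"
  define E' where "E' = jn r V' c'"
  define x' where "x' = x(z := x w)"
  have EE': "sym E'" "irrefl E'" by (auto simp: E'_def)
  have e: "kap j E' x' S = kap j E x S" if "S \<subseteq> V" for j S
  proof -
    have "kap j E' x' S = kap j E' x S" using that z by (intro kap_cong) (auto simp: x'_def)
    also have "\<dots> = kap j E x S" using that z by (intro kap_cong_edges) (auto simp: E_def E'_def jn_def c'_def V'_def)
    finally show ?thesis .
  qed
  have "V \<inter> E' `` {z} = V \<inter> E `` {w}" using z wV cw by (auto simp: E'_def E_def jn_def c'_def V'_def)
  then have "kap t E' x' V' = kap t E x V + x w * kap (t - 1) E x (V \<inter> E `` {w})"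
    using kap_insert[OF V(1) z EE'(1), of s x'] e[of V t] e[of "V \<inter> E `` {w}" s] by (simp add: s V'_def x'_def)
  also have "\<dots> = kap t E x V + h * M" unfolding x(4)[OF wV, symmetric] by (simp add: M_def s)
  finally have k1: "real t * kap t E' x' V' = h * (real n + real t * M)" using x(3) by (simp add: algebra_simps)
  have k2: "real t * kap t E' x' V' \<le> rho t E' V' * (\<Sum>v\<in>V'. x' v ^ t)"
    using V EE' t x(1) by (intro rho_upper) (auto simp: V'_def x'_def)
  have k3: "(\<Sum>v\<in>V'. x' v ^ t) = real n + M"
  proof -
    have "(\<Sum>v\<in>V. x' v ^ t) = (\<Sum>v\<in>V. x v ^ t)" using z by (intro sum.cong) (auto simp: x'_def)
    then show ?thesis using x(2) V z by (simp add: V'_def x'_def M_def)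
  qed
  have "rho t E' V' \<le> hrho r t k (n + 1)" unfolding E'_def
  proof (rule jn_le_hrho)
    show "0 < hrho r t k (n + 1)" using n by (intro hrho_pos t k) simp
    show "c' ` V' \<subseteq> {..r}" using hcol_image[OF r, of "V \<union> {w}"] by (auto simp: c'_def V'_def)
    have "{v \<in> V'. c' v = r} = {v \<in> V. hcol r v = r}" using cw z by (auto simp: V'_def c'_def)
    then show "card {v \<in> V'. c' v = r} = k - 1" unfolding V_def hcol_eq_r[OF r] by (simp add: card_image)
  qed (use t r k n V z in \<open>auto simp: V'_def\<close>)
  then have k4: "rho t E' V' * (real n + M) \<le> hrho r t k (n + 1) * (real n + M)" using M0 by (intro mult_right_mono) auto
  have main: "h * (real n + real t * M) \<le> hrho r t k (n + 1) * (real n + M)" using order_trans[OF k2[unfolded k1 k3] k4] .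
  have nM: "0 < real n + M" using M0 n k by simp
  have "(1 - \<epsilon>) * (real n + M) \<le> M * (real n + 1)"
  proof -
    have "0 \<le> wmax r t" by (simp add: wmax_def)
    then have "0 \<le> real k * wmax r t ^ t" by simp
    then have "0 < \<epsilon> * real n" using \<epsilon> by linarith
    then have "0 \<le> \<epsilon>" by (simp add: zero_less_mult_iff)
    then have "0 \<le> \<epsilon> * M" using M0 by simp
    moreover have "(1 - \<epsilon>) * real n \<le> M * real n" using M by (intro mult_right_mono) auto
    ultimately show ?thesis by (simp add: algebra_simps)
  qed
  then have "(1 - \<epsilon>) / (real n + 1) \<le> M / (real n + M)" using nM by (simp add: field_simps)
  then have "real (t - 1) * ((1 - \<epsilon>) / (real n + 1)) \<le> real (t - 1) * (M / (real n + M))" by (intro mult_left_mono) auto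
  moreover have "1 + real (t - 1) * (M / (real n + M)) = (real n + real t * M) / (real n + M)" using nM by (simp add: s field_simps)
  ultimately have "1 + real (t - 1) * (1 - \<epsilon>) / real (n + 1) \<le> (real n + real t * M) / (real n + M)"
    by (simp add: algebra_simps)
  then have "h * (1 + real (t - 1) * (1 - \<epsilon>) / real (n + 1)) \<le> h * ((real n + real t * M) / (real n + M))"
    using h0 by (intro mult_left_mono) auto
  also have "\<dots> \<le> hrho r t k (n + 1)" using main nM by (simp add: field_simps)
  finally show ?thesis unfolding h_def .
qed

text \<open>The Perron vector restricted to \<open>V - {v}\<close> is the test vector. With
  \<open>a = x v ^ t\<close>, the clique polynomial loses \<open>rho t E V * a\<close> and the power
  sum loses \<open>a\<close>, so the radius keeps the factor \<open>(n - t * a) / (n - a)\<close>,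
  which is larger for lighter vertices.\<close>

lemma rho_delete:
  fixes x :: "'a \<Rightarrow> real"
  assumes V: "finite V" "2 \<le> card V" and E: "sym E" "irrefl E" and t: "2 \<le> t"
    and x: "\<And>v. 0 \<le> x v" "(\<Sum>v\<in>V. x v ^ t) = real (card V)"
      "real t * kap t E x V = rho t E V * real (card V)"
      "\<And>v. v \<in> V \<Longrightarrow> rho t E V * x v ^ (t - 1) = kap (t - 1) E x (V \<inter> E `` {v})"
    and v: "v \<in> V" "x v ^ t \<le> 1 - \<delta>" and \<delta>: "0 \<le> \<delta>"
  shows "rho t E V * (1 - real (t - 1) * (1 - \<delta>) / (real (card V) - 1)) \<le> rho t E (V - {v})"
proof -
  obtain s where s: "t = Suc s" using t by (cases t) auto
  define n where "n = real (card V)"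
  have n: "2 \<le> n" using V(2) by (simp add: n_def)
  define a where "a = x v ^ t"
  have a: "0 \<le> a" "a \<le> 1 - \<delta>" using x(1) v by (simp_all add: a_def)
  define h where "h = rho t E V"
  have ne: "V - {v} \<noteq> {}"
  proof
    assume "V - {v} = {}"
    then have "card V \<le> card {v}" by (intro card_mono) auto
    then show False using V(2) by simp
  qed
  have h0: "0 \<le> h" unfolding h_def using V v E t by (intro rho_nonneg) auto
  have "kap t E x V = kap t E x (V - {v}) + h * a" using kap_split[OF V(1) v(1) E, of s x] x(4)[OF v(1), symmetric]
    by (simp add: h_def a_def s mult.left_commute)
  then have "real t * kap t E x (V - {v}) = h * (n - real t * a)" using x(3) by (simp add: h_def n_def algebra_simps)
  moreover have "real t * kap t E x (V - {v}) \<le> rho t E (V - {v}) * (\<Sum>u\<in>V - {v}. x u ^ t)"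
    using V E t x(1) ne by (intro rho_upper) auto
  moreover have "(\<Sum>u\<in>V - {v}. x u ^ t) = n - a"
    using sum.remove[OF V(1) v(1), of "\<lambda>u. x u ^ t"] x(2) by (simp add: n_def a_def)
  ultimately have main: "h * (n - real t * a) \<le> rho t E (V - {v}) * (n - a)" by simp
  have na: "0 < n - a" using n a \<delta> by linarith
  have "a * (n - 1) \<le> (1 - \<delta>) * (n - a)"
  proof -
    have "0 \<le> (1 - \<delta> - a) * (n - 1)" using a n by simp
    moreover have "0 \<le> (1 - \<delta>) * (1 - a)" using a \<delta> by simp
    ultimately show ?thesis by (simp add: algebra_simps)
  qed
  then have "a / (n - a) \<le> (1 - \<delta>) / (n - 1)" using na n by (simp add: field_simps)
  then have "real (t - 1) * (a / (n - a)) \<le> real (t - 1) * ((1 - \<delta>) / (n - 1))" by (intro mult_left_mono) auto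
  moreover have "1 - real (t - 1) * (a / (n - a)) = (n - real t * a) / (n - a)" using na by (simp add: s field_simps)
  ultimately have "1 - real (t - 1) * (1 - \<delta>) / (n - 1) \<le> (n - real t * a) / (n - a)" by simp
  then have "h * (1 - real (t - 1) * (1 - \<delta>) / (n - 1)) \<le> h * ((n - real t * a) / (n - a))"
    using h0 by (intro mult_left_mono) auto
  also have "\<dots> \<le> rho t E (V - {v})" using main na by (simp add: field_simps)
  finally show ?thesis by (simp add: h_def n_def)
qed

text \<open>To first order the growth exceeds the loss by
  \<open>3 / 4 * \<delta> * T / (N + 1)\<close>. The error terms cost at most
  \<open>\<delta> / 2\<close> in the bracket, which leaves \<open>\<delta> / 4\<close>.\<close>

lemma ratio_arith:
  fixes T \<delta> N :: real
  assumes "0 \<le> T" "0 < \<delta>" "\<delta> \<le> 1" "0 < N" "(1 + T) * 2 \<le> \<delta> * N"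
  shows "1 + T * \<delta> / 4 / (N + 1) \<le> (1 - T * (1 - \<delta>) / N) * (1 + T * (1 - \<delta> / 4) / (N + 1))"
proof -
  define p q where "p = 1 - \<delta>" and "q = 1 - \<delta> / 4"
  have pq: "0 \<le> p" "p \<le> 1" "0 \<le> q" "q \<le> 1" using assms by (auto simp: p_def q_def)
  have pq1: "p * q \<le> 1" using pq by (simp add: mult_le_one)
  have e: "(1 - T * p / N) * (1 + T * q / (N + 1)) = 1 + T / (N + 1) * (q - p - p / N - T * p * q / N)"
  proof -
    have nz: "N + 1 \<noteq> 0" "N \<noteq> 0" using assms(4) by auto
    then have "p + p / N = p * (N + 1) / N" by (simp add: field_simps)
    then have 1: "T * p / N = T / (N + 1) * (p + p / N)" using nz by simp
    have "(1 - A) * (1 + B) = 1 + B - A - A * B" for A B :: real by (simp add: algebra_simps)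
    from this[of "T * p / N" "T * q / (N + 1)"]
    have "(1 - T * p / N) * (1 + T * q / (N + 1))
        = 1 + T / (N + 1) * q - T / (N + 1) * (p + p / N) - T / (N + 1) * (T * p * q / N)"
      unfolding 1[symmetric] by (simp add: mult_ac)
    moreover have "1 + c * q - c * (p + y) - c * X = 1 + c * (q - p - y - X)" for c y X :: real by (simp add: algebra_simps)
    ultimately show ?thesis by (simp only:)
  qed
  have "p / N + T * p * q / N \<le> 1 / N + T / N"
    using pq pq1 assms by (intro add_mono divide_right_mono) (auto simp: mult.assoc mult_left_le)
  also have "\<dots> = (1 + T) / N" by (simp add: add_divide_distrib)
  also have "\<dots> \<le> \<delta> / 2" using assms by (simp add: field_simps)
  finally have "p / N + T * p * q / N \<le> \<delta> / 2" .
  moreover have "q - p = \<delta> / 2 + \<delta> / 4" by (simp add: p_def q_def)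
  ultimately have "\<delta> / 4 \<le> q - p - p / N - T * p * q / N" by linarith
  then have "T / (N + 1) * (\<delta> / 4) \<le> T / (N + 1) * (q - p - p / N - T * p * q / N)"
    using assms by (intro mult_left_mono) auto
  moreover have "T * \<delta> / 4 / (N + 1) = T / (N + 1) * (\<delta> / 4)" by simp
  ultimately have "1 + T * \<delta> / 4 / (N + 1) \<le> (1 - T * p / N) * (1 + T * q / (N + 1))" unfolding e by linarith
  then show ?thesis unfolding p_def q_def .
qed

text \<open>Combines the loss of the graph under deletion with the growth of the extremal value from
  the smaller order. The latter is taken with error \<open>\<delta> / 4\<close>, so that a light
  vertex leaves a net gain in the ratio.\<close>

lemma rho_ratio_delete:
  fixes x :: "'a \<Rightarrow> real"
  assumes t: "2 \<le> t" "t \<le> r" and k: "1 \<le> k" and n: "2 * (k + r) + 1 \<le> card V"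
    and V: "finite V" and E: "sym E" "irrefl E"
    and x: "\<And>v. 0 \<le> x v" "(\<Sum>v\<in>V. x v ^ t) = real (card V)"
      "real t * kap t E x V = rho t E V * real (card V)"
      "\<And>v. v \<in> V \<Longrightarrow> rho t E V * x v ^ (t - 1) = kap (t - 1) E x (V \<inter> E `` {v})"
    and v: "v \<in> V" "x v ^ t \<le> 1 - \<delta>" and \<delta>: "0 < \<delta>" "\<delta> \<le> 1"
    and big: "real t * 2 \<le> \<delta> * (real (card V) - 1)" "real k * wmax r t ^ t < \<delta> / 4 * (real (card V) - 1)"
  shows "rho t E V / hrho r t k (card V) * (1 + real (t - 1) * \<delta> / 4 / real (card V))
    \<le> rho t E (V - {v}) / hrho r t k (card V - 1)"
proof -
  obtain m where m: "card V = m + 1" using n by (cases "card V") auto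
  let ?T = "real (t - 1)" let ?N = "real m"
  define P S where "P = rho t E V" and "S = rho t E (V - {v})"
  define h h' where "h = hrho r t k m" and "h' = hrho r t k (m + 1)"
  have hp: "0 < h" "0 < h'" unfolding h_def h'_def using n m by (auto intro!: hrho_pos t k)
  have N: "0 < ?N" using m n k by simp
  have P0: "0 \<le> P" unfolding P_def using V v E t by (intro rho_nonneg) auto
  have 1: "h * (1 + ?T * (1 - \<delta> / 4) / (?N + 1)) \<le> h'"
    unfolding h_def h'_def using hrho_step[OF t k, of m "\<delta> / 4"] n m big by (simp add: add.commute)
  have 2: "P * (1 - ?T * (1 - \<delta>) / ?N) \<le> S" unfolding P_def S_def using rho_delete[OF V _ E t(1) x v] \<delta> m n k by simp
  have T: "?T = real t - 1" using t by (simp add: of_nat_diff)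
  have 3: "1 + ?T * \<delta> / 4 / (?N + 1) \<le> (1 - ?T * (1 - \<delta>) / ?N) * (1 + ?T * (1 - \<delta> / 4) / (?N + 1))"
    using \<delta> N big(1) m T by (intro ratio_arith) (auto simp: algebra_simps)
  have pos: "0 < 1 + ?T * (1 - \<delta> / 4) / (?N + 1)"
    using \<delta> N by (intro add_pos_nonneg divide_nonneg_nonneg mult_nonneg_nonneg) auto
  have S0: "0 \<le> S"
  proof -
    have "0 < (1 - ?T * (1 - \<delta>) / ?N) * (1 + ?T * (1 - \<delta> / 4) / (?N + 1))"
    proof -
      have "0 \<le> ?T * \<delta> / 4 / (?N + 1)" using \<delta> N by auto
      then show ?thesis using 3 by linarith
    qed
    then have "0 < 1 - ?T * (1 - \<delta>) / ?N" using pos by (simp add: zero_less_mult_iff)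
    then have "0 \<le> P * (1 - ?T * (1 - \<delta>) / ?N)" using P0 by simp
    then show ?thesis using 2 by linarith
  qed
  have "P * (1 + ?T * \<delta> / 4 / (?N + 1)) * h
      \<le> P * ((1 - ?T * (1 - \<delta>) / ?N) * (1 + ?T * (1 - \<delta> / 4) / (?N + 1))) * h"
    using 3 P0 hp by (intro mult_right_mono mult_left_mono) auto
  also have "\<dots> = P * (1 - ?T * (1 - \<delta>) / ?N) * (h * (1 + ?T * (1 - \<delta> / 4) / (?N + 1)))" by (simp add: mult_ac)
  also have "\<dots> \<le> S * h'" using 1 2 S0 hp pos by (intro mult_mono) auto
  finally have fin: "P * (1 + ?T * \<delta> / 4 / (?N + 1)) * h \<le> S * h'" .
  have "P / h' * X \<le> S / h" if "P * X * h \<le> S * h'" for X using hp that by (simp add: field_simps)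
  from this[OF fin] have "P / h' * (1 + ?T * \<delta> / 4 / (?N + 1)) \<le> S / h" .
  then show ?thesis unfolding P_def S_def h_def h'_def m by (simp add: add.commute)
qed

section \<open>Structure of graphs with a nearly constant Perron vector\<close>

text \<open>A clique of \<open>E\<close> that is not one of \<open>J\<close> contains a pair from
  \<open>F\<close>. The cliques through a fixed pair weigh at most \<open>D\<^sup>2 * N ^ s\<close>,
  by splitting off its two vertices.\<close>

lemma kap_le_bad_edges:
  fixes x :: "'a \<Rightarrow> real"
  assumes V: "finite V" and E: "sym E" and x: "\<And>v. v \<in> V \<Longrightarrow> 0 \<le> x v" "\<And>v. v \<in> V \<Longrightarrow> x v \<le> D"
    and N: "(\<Sum>v\<in>V. x v) \<le> N"
    and F: "F = {(a, b). a \<in> V \<and> b \<in> V \<and> a \<noteq> b \<and> (a, b) \<in> E \<and> (a, b) \<notin> J}"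
  shows "kap (Suc (Suc s)) E x V \<le> kap (Suc (Suc s)) J x V + real (card F) * (D\<^sup>2 * N ^ s)"
proof -
  let ?C = "cliques (Suc (Suc s)) E V"
  define g where "g S = (\<Prod>i\<in>S. x i)" for S
  have g0: "0 \<le> g S" if "S \<subseteq> V" for S unfolding g_def using x(1) that by (intro prod_nonneg) auto
  have CV: "S \<subseteq> V" if "S \<in> ?C" for S using that by (simp add: cliques_def)
  have fF: "finite F" by (rule finite_subset[of _ "V \<times> V"]) (use V F in auto)
  let ?I = "\<lambda>S. if S \<in> cliques (Suc (Suc s)) J V then g S else 0"
  let ?B = "\<lambda>S p. if fst p \<in> S \<and> snd p \<in> S then g S else 0"
  have "g S \<le> ?I S + (\<Sum>p\<in>F. ?B S p)" if S: "S \<in> ?C" for S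
  proof (cases "S \<in> cliques (Suc (Suc s)) J V")
    case True
    have "0 \<le> (\<Sum>p\<in>F. ?B S p)" using g0[OF CV[OF S]] by (intro sum_nonneg) auto
    then show ?thesis using True by simp
  next
    case False
    then obtain a b where ab: "a \<in> S" "b \<in> S" "a \<noteq> b" "(a, b) \<notin> J" using S by (auto simp: cliques_def)
    then have "(a, b) \<in> F" using S unfolding F by (auto simp: cliques_def)
    then have "?B S (a, b) \<le> (\<Sum>p\<in>F. ?B S p)" using fF g0[OF CV[OF S]] by (intro member_le_sum) auto
    then show ?thesis using False ab by simp
  qed
  then have "kap (Suc (Suc s)) E x V \<le> (\<Sum>S\<in>?C. ?I S + (\<Sum>p\<in>F. ?B S p))"
    unfolding kap_def g_def by (intro sum_mono) auto
  also have "\<dots> = (\<Sum>S\<in>?C. ?I S) + (\<Sum>p\<in>F. \<Sum>S\<in>?C. ?B S p)" by (simp only: sum.distrib sum.swap[of _ F])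
  also have "(\<Sum>S\<in>?C. ?I S) \<le> kap (Suc (Suc s)) J x V"
  proof -
    have "(\<Sum>S\<in>?C. ?I S) = (\<Sum>S\<in>{S \<in> ?C. S \<in> cliques (Suc (Suc s)) J V}. g S)"
      using V by (intro sum.inter_filter[symmetric]) auto
    also have "\<dots> \<le> (\<Sum>S\<in>cliques (Suc (Suc s)) J V. g S)" using V g0 by (intro sum_mono2) (auto simp: cliques_def)
    finally show ?thesis by (simp add: kap_def g_def)
  qed
  also have "(\<Sum>p\<in>F. \<Sum>S\<in>?C. ?B S p) \<le> (\<Sum>p\<in>F. D\<^sup>2 * N ^ s)"
  proof (rule sum_mono)
    fix p assume "p \<in> F"
    then obtain a b where p: "p = (a, b)" and ab: "a \<in> V" "b \<in> V" "a \<noteq> b" using F by auto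
    let ?Cab = "{S \<in> ?C. a \<in> S \<and> b \<in> S}"
    have "(\<Sum>S\<in>?C. ?B S p) = (\<Sum>S\<in>?Cab. g S)" unfolding p using V by (simp add: sum.inter_filter)
    also have "\<dots> = (\<Sum>S\<in>?Cab. x a * x b * g (S - {a, b}))"
    proof (intro sum.cong refl)
      fix S assume S: "S \<in> ?Cab"
      then have "finite S" using CV V finite_subset by blast
      then have "g S = x a * g (S - {a})" "g (S - {a}) = x b * g (S - {a} - {b})" using S ab by (auto simp: g_def prod.remove)
      moreover have "S - {a} - {b} = S - {a, b}" by blast
      ultimately show "g S = x a * x b * g (S - {a, b})" by simp
    qed
    also have "\<dots> = x a * x b * (\<Sum>T\<in>(\<lambda>S. S - {a, b}) ` ?Cab. g T)" unfolding sum_distrib_left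
      by (intro sum.reindex_cong[of "\<lambda>S. S - {a, b}", symmetric] refl inj_onI) auto
    also have "(\<Sum>T\<in>(\<lambda>S. S - {a, b}) ` ?Cab. g T) \<le> kap s E x V" unfolding kap_def g_def[symmetric]
    proof (rule sum_mono2)
      show "(\<lambda>S. S - {a, b}) ` ?Cab \<subseteq> cliques s E V"
      proof clarify
        fix S assume S: "S \<in> ?C" "a \<in> S" "b \<in> S"
        then have "finite S" using CV V finite_subset by blast
        then have "card (S - {a, b}) = s" using S ab by (simp add: cliques_def card_Diff_subset)
        then show "S - {a, b} \<in> cliques s E V" by (intro cliques_subset[OF _ S(1)]) auto
      qed
    qed (use V g0 in \<open>auto simp: cliques_def\<close>)
    also have "kap s E x V \<le> N ^ s"
    proof -
      have "kap s E x V \<le> (\<Sum>v\<in>V. x v) ^ s" using V E x by (intro kap_le_power) auto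
      also have "\<dots> \<le> N ^ s" using N x(1) by (intro power_mono sum_nonneg) auto
      finally show ?thesis .
    qed
    also have "x a * x b * N ^ s \<le> D\<^sup>2 * N ^ s"
    proof -
      have "0 \<le> (\<Sum>v\<in>V. x v)" using x(1) by (rule sum_nonneg)
      then have "0 \<le> N" using N by linarith
      moreover have "x a * x b \<le> D * D" using x ab by (intro mult_mono) (auto intro: order_trans)
      ultimately show ?thesis by (intro mult_right_mono) (auto simp: power2_eq_square)
    qed
    finally show "(\<Sum>S\<in>?C. ?B S p) \<le> D\<^sup>2 * N ^ s" using x ab by (simp add: mult_left_mono)
  qed
  finally show ?thesis by simp
qed

text \<open>Complete the vertices of \<open>L\<close> to cliques one after the other. Each new
  clique must avoid the part \<open>U\<close> already used and the vertices of \<open>L\<close>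
  still waiting; the bound \<open>card U + card L * Suc r \<le> z\<close> is invariant and keeps
  this obstacle within robustness.\<close>

lemma packs_of_robust:
  assumes V: "finite V" and E: "sym E" "irrefl E"
    and rob: "\<And>w Z. w \<in> L \<Longrightarrow> finite Z \<Longrightarrow> card Z \<le> z \<Longrightarrow> \<exists>S. S \<in> cliques r E (V \<inter> E `` {w} - Z)"
    and L: "L \<subseteq> V" and U: "packs j (Suc r) E U" "U \<subseteq> V - L" "card U + card L * Suc r \<le> z"
  shows "packs (j + card L) (Suc r) E V"
proof -
  have "finite L" using L V finite_subset by blast
  then show ?thesis using rob L U
  proof (induction L arbitrary: j U rule: finite_induct)
    case empty
    then show ?case using packs_mono[of j "Suc r" E U V] by auto
  next
    case (insert w L)
    have fU: "finite U" using insert.prems(4) V finite_subset by blast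
    have "card (U \<union> L) \<le> z" using card_Un_le[of U L] insert.prems(5) insert.hyps by simp
    then obtain S where S: "S \<in> cliques r E (V \<inter> E `` {w} - (U \<union> L))"
      using insert.prems(1)[of w "U \<union> L"] fU insert.hyps by auto
    have SV: "S \<subseteq> V" "S \<inter> U = {}" "S \<inter> L = {}" "S \<subseteq> E `` {w}" using S by (auto simp: cliques_def)
    have fS: "finite S" using SV(1) V finite_subset by blast
    have wU: "w \<notin> U" using insert.prems(4) by blast
    have wS: "w \<notin> S" using SV(4) E(2) by (auto simp: irrefl_def)
    let ?S = "insert w S"
    have "S \<in> cliques r E S" using S by (auto simp: cliques_def)
    then have "?S \<in> cliques (Suc r) E ?S" using clique_insert[OF _ fS E(1) wS SV(4)] by blast
    then have "?S \<in> cliques (Suc r) E (U \<union> ?S)" using cliques_mono[of E E ?S "U \<union> ?S"] by blast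
    moreover have "packs j (Suc r) E (U \<union> ?S - ?S)" using insert.prems(3) by (rule packs_mono) (use SV wU in blast)
    ultimately have pk: "packs (Suc j) (Suc r) E (U \<union> ?S)" unfolding packs.simps by (rule bexI[rotated])
    have "packs (Suc j + card L) (Suc r) E V"
    proof (rule insert.IH[OF _ _ pk])
      show "\<exists>S. S \<in> cliques r E (V \<inter> E `` {u} - Z)" if "u \<in> L" "finite Z" "card Z \<le> z" for u Z
        using insert.prems(1) that by auto
      show "L \<subseteq> V" "U \<union> ?S \<subseteq> V - L" using insert.prems insert.hyps SV by auto
      have "card (U \<union> ?S) \<le> card U + Suc r" using card_Un_le[of U ?S] fS wS S by (simp add: cliques_def)
      then show "card (U \<union> ?S) + card L * Suc r \<le> z" using insert.prems(5) insert.hyps by simp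
    qed
    then show ?case using insert.hyps by simp
  qed
qed

text \<open>The graph is at least as good as the extremal one and no weight is small. The last
  condition on \<open>\<epsilon>\<close> admits \<open>10 * \<epsilon>\<close> as the
  \<open>\<eta>\<close> of \<open>proper_colouring_exists\<close>. The size conditions:
  \<open>big1\<close> drives the degree bound, \<open>big2\<close> makes a bounded vertex set
  negligible, \<open>big3\<close> lets robustness absorb such a set, \<open>big4\<close> keeps the
  class weights above 1, and \<open>big5\<close> says that an additional joined vertex outweighs the
  bad edges.\<close>

locale flat_perron =
  fixes r t k :: nat and \<epsilon> :: real and V :: "'a set" and E :: "('a \<times> 'a) set" and x :: "'a \<Rightarrow> real"
  assumes t: "2 \<le> t" "t \<le> r" and k: "1 \<le> k"
    and \<epsilon>: "0 < \<epsilon>" "\<epsilon> \<le> 1 / 10" "10 * \<epsilon> * (6 * real r ^ 3) \<le> 1"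
    and V: "finite V" and E: "sym E" "irrefl E"
    and x0: "\<And>v. 0 \<le> x v" and xsum: "(\<Sum>v\<in>V. x v ^ t) = real (card V)"
    and xmax: "real t * kap t E x V = rho t E V * real (card V)"
    and xeig: "\<And>v. v \<in> V \<Longrightarrow> rho t E V * x v ^ (t - 1) = kap (t - 1) E x (V \<inter> E `` {v})"
    and low: "\<And>v. v \<in> V \<Longrightarrow> 1 - \<epsilon> \<le> x v"
    and nbig: "2 * (k + r) \<le> card V"
    and rho: "hrho r t k (card V) \<le> rho t E V"
    and nopack: "\<not> packs k (Suc r) E V"
    and big1: "tcoef r t * (1 - 2 * \<epsilon>) ^ (t - 1) + real (k * Suc r) * wmax r t / real (card V)
      < tcoef r t * (1 - real (k + r) / real (card V)) ^ t * (1 - \<epsilon>) ^ (t - 1)"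
    and big2: "real (card V) \<le> (1 + \<epsilon>) * (real (card V) - real (k * Suc r))"
    and big3: "real (k * Suc r) < 10 * real r ^ 2 * \<epsilon> * real (card V)"
    and big4: "8 * real r \<le> real (card V)"
    and big5: "4 * real (k * Suc r) * (wmax r t)\<^sup>2 * (20 * real r ^ 2 * \<epsilon> + real (k * Suc r) / real (card V))
      * (16 * real r) ^ (t - 1) < 1"
begin

lemma r2: "2 \<le> r" using t by simp

lemma n0: "0 < real (card V)" using nbig k by simp

lemma ne: "V \<noteq> {}" using n0 by auto

lemma x_le: "v \<in> V \<Longrightarrow> x v \<le> wmax r t"
  using weight_le_wmax[OF t k nbig V E(1) x0 xsum rho _ xeig] by simp

lemma sum_x_le: "(\<Sum>v\<in>V. x v) \<le> real (card V)"
  using sum_le_card_of_power_sum[of t V x] t x0 xsum by simp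

lemma card_le_card_off:
  assumes "W \<subseteq> V" "card W \<le> k * Suc r"
  shows "real (card V) \<le> (1 + \<epsilon>) * real (card (V - W))"
proof -
  have "real (card (V - W)) = real (card V) - real (card W)"
    using assms(1) V finite_subset[of W V] card_mono[of V W] by (simp add: card_Diff_subset of_nat_diff)
  then have "real (card V) - real (k * Suc r) \<le> real (card (V - W))" using assms(2) by (simp only: of_nat_le_iff diff_left_mono)
  then have "(1 + \<epsilon>) * (real (card V) - real (k * Suc r)) \<le> (1 + \<epsilon>) * real (card (V - W))"
    using \<epsilon> by (intro mult_left_mono) auto
  then show ?thesis using big2 by linarith
qed

text \<open>Outside \<open>W\<close> the neighbourhood of \<open>v\<close> contains no clique of
  order \<open>r\<close>, so \<open>kap_clique_free_le\<close> bounds its clique polynomial by its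
  weight, while the eigenvalue equation and \<open>low\<close> force the polynomial to be large.
  Hence the neighbourhood has weight nearly \<open>(1 - 1 / r) * n\<close>. The total weight is at
  most \<open>n\<close> and every non-neighbour weighs at least
  \<open>1 - \<epsilon>\<close>.\<close>

lemma few_nonneighbours:
  assumes W: "W \<subseteq> V" "card W \<le> k * Suc r" "cliques (Suc r) E (V - W) = {}" and v: "v \<in> V - W"
  shows "real (card (V - W - E `` {v})) \<le> (1 / real r + 10 * \<epsilon>) * real (card (V - W))"
proof -
  define n where "n = real (card V)"
  have n: "0 < n" using n0 by (simp add: n_def)
  define R where "R = real r"
  have R: "2 \<le> R" using r2 by (simp add: R_def)
  obtain s where s: "t - 1 = Suc s" using t by (cases "t - 1") auto
  define N A B where "N = V \<inter> E `` {v}" and "A = N \<inter> W" and "B = N - W"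
  have AB: "finite A" "finite B" "A \<inter> B = {}" "N = A \<union> B" using V by (auto simp: A_def B_def N_def)
  define Y where "Y = (\<Sum>u\<in>B. x u)"
  have Y0: "0 \<le> Y" unfolding Y_def using x0 by (intro sum_nonneg) auto
  define D where "D = wmax r t"
  have D0: "0 \<le> D" by (simp add: D_def wmax_def)
  have cA: "card A \<le> k * Suc r" using W(1,2) V finite_subset[of W V] card_mono[of W A] by (auto simp: A_def)
  have Bfree: "cliques (Suc (r - 1)) E B = {}"
  proof (rule ccontr)
    assume "cliques (Suc (r - 1)) E B \<noteq> {}"
    then obtain S where S: "S \<in> cliques (Suc (r - 1)) E B" by blast
    have "S \<in> cliques (Suc (r - 1)) E (V - W)" "S \<subseteq> E `` {v}" using S by (auto simp: cliques_def B_def N_def)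
    then have "insert v S \<in> cliques (Suc (Suc (r - 1))) E (V - W)" using V E v by (intro cliques_insert_vertex) auto
    then show False using W(3) r2 by simp
  qed
  have "kap (Suc s) E x N \<le> kap (Suc s) E x B + (\<Sum>u\<in>A. x u * kap s E x (N \<inter> E `` {u}))"
    using kap_Un_le[OF AB(1-3) E, of x s] x0 AB(4) by simp
  also have "kap (Suc s) E x B \<le> real (r - 1 choose Suc s) * (Y / real (r - 1)) ^ Suc s"
    unfolding Y_def using AB Bfree E x0 by (intro kap_clique_free_le) auto
  also have "(\<Sum>u\<in>A. x u * kap s E x (N \<inter> E `` {u})) \<le> (\<Sum>u\<in>A. D * n ^ s)"
  proof (intro sum_mono mult_mono)
    fix u assume u: "u \<in> A"
    show "x u \<le> D" using x_le u by (simp add: D_def A_def N_def)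
    have "kap s E x (N \<inter> E `` {u}) \<le> kap s E x V" using V x0 by (intro kap_mono_set) (auto simp: N_def)
    also have "\<dots> \<le> (\<Sum>v\<in>V. x v) ^ s" using V E x0 by (intro kap_le_power) auto
    also have "\<dots> \<le> n ^ s" unfolding n_def using sum_x_le x0 by (intro power_mono sum_nonneg) auto
    finally show "kap s E x (N \<inter> E `` {u}) \<le> n ^ s" .
  qed (use D0 x0 in \<open>auto intro: kap_nonneg\<close>)
  also have "(\<Sum>u\<in>A. D * n ^ s) \<le> real (k * Suc r) * D * n ^ s"
  proof -
    have "(\<Sum>u\<in>A. D * n ^ s) = real (card A) * (D * n ^ s)" by (rule sum_constant)
    also have "\<dots> \<le> real (k * Suc r) * (D * n ^ s)"
      using cA D0 n by (intro mult_right_mono) (simp_all only: of_nat_le_iff zero_le_power mult_nonneg_nonneg less_imp_le)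
    finally show ?thesis by (simp only: mult.assoc)
  qed
  finally have up: "kap (Suc s) E x N
      \<le> real (r - 1 choose Suc s) * (Y / real (r - 1)) ^ Suc s + real (k * Suc r) * D * n ^ s" by simp
  \<comment> \<open>The loss \<open>2 * \<epsilon>\<close> against the \<open>\<epsilon>\<close> in
    the weight of \<open>v\<close> leaves the strict gap of \<open>big1\<close>, which absorbs the
    cliques meeting \<open>W\<close> and the lower order terms of the extremal value.\<close>
  have Ybig: "(1 - 1 / R) * (1 - 2 * \<epsilon>) * n \<le> Y"
  proof (rule ccontr)
    assume "\<not> (1 - 1 / R) * (1 - 2 * \<epsilon>) * n \<le> Y"
    then have "Y < (1 - 1 / R) * (1 - 2 * \<epsilon>) * n" by simp
    also have "(1 - 1 / R) * (1 - 2 * \<epsilon>) * n = (R - 1) * ((1 - 2 * \<epsilon>) * n / R)" using R by (simp add: field_simps)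
    finally have "Y / (R - 1) \<le> (1 - 2 * \<epsilon>) * n / R" using R by (simp add: field_simps)
    moreover have "real (r - 1) = R - 1" using r2 by (simp add: R_def of_nat_diff)
    ultimately have "(Y / real (r - 1)) ^ Suc s \<le> ((1 - 2 * \<epsilon>) * n / R) ^ Suc s" using Y0 by (intro power_mono) auto
    then have "real (r - 1 choose Suc s) * (Y / real (r - 1)) ^ Suc s
        \<le> real (r - 1 choose Suc s) * ((1 - 2 * \<epsilon>) * n / R) ^ Suc s"
      by (intro mult_left_mono) auto
    also have "\<dots> = tcoef r t * (1 - 2 * \<epsilon>) ^ Suc s * n ^ Suc s"
      unfolding tcoef_def s R_def by (simp add: power_divide power_mult_distrib)
    finally have 1: "kap (Suc s) E x N
        \<le> tcoef r t * (1 - 2 * \<epsilon>) ^ Suc s * n ^ Suc s + real (k * Suc r) * D * n ^ s"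
      using up by linarith
    have "kap (Suc s) E x N = rho t E V * x v ^ Suc s" using xeig[of v] v s by (simp add: N_def)
    moreover have "hrho r t k (card V) * (1 - \<epsilon>) ^ Suc s \<le> rho t E V * x v ^ Suc s"
      using rho hrho_pos[OF t k nbig] low[of v] v \<epsilon> x0 by (intro mult_mono power_mono) auto
    ultimately have 2: "hrho r t k (card V) * (1 - \<epsilon>) ^ Suc s
        \<le> tcoef r t * (1 - 2 * \<epsilon>) ^ Suc s * n ^ Suc s + real (k * Suc r) * D * n ^ s"
      using 1 by linarith
    have ts: "t = Suc (Suc s)" using s t by simp
    have nk: "real (card V - k - r) = n * (1 - real (k + r) / n)" using nbig n by (simp add: n_def of_nat_diff field_simps)
    have "tcoef r t * (n * (1 - real (k + r) / n)) ^ t \<le> hrho r t k (card V) * n"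
      using hrho_ge[OF t k, of "card V"] nbig unfolding nk tcoef_def n_def by simp
    then have "tcoef r t * (1 - real (k + r) / n) ^ t * n ^ Suc s * n \<le> hrho r t k (card V) * n"
      by (simp add: power_mult_distrib ts mult_ac)
    then have "tcoef r t * (1 - real (k + r) / n) ^ t * n ^ Suc s \<le> hrho r t k (card V)" using n by (rule mult_right_le_imp_le)
    then have "tcoef r t * (1 - real (k + r) / n) ^ t * n ^ Suc s * (1 - \<epsilon>) ^ Suc s
        \<le> hrho r t k (card V) * (1 - \<epsilon>) ^ Suc s"
      using \<epsilon> by (intro mult_right_mono) auto
    then have 3: "tcoef r t * (1 - real (k + r) / n) ^ t * (1 - \<epsilon>) ^ Suc s * n ^ Suc s
        \<le> tcoef r t * (1 - 2 * \<epsilon>) ^ Suc s * n ^ Suc s + real (k * Suc r) * D * n ^ s"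
      using 2 by (simp add: mult_ac)
    have "(tcoef r t * (1 - 2 * \<epsilon>) ^ Suc s + real (k * Suc r) * D / n) * n ^ Suc s
        < tcoef r t * (1 - real (k + r) / n) ^ t * (1 - \<epsilon>) ^ Suc s * n ^ Suc s"
      using big1 n unfolding s n_def[symmetric] D_def[symmetric] by (intro mult_strict_right_mono) auto
    moreover have "(tcoef r t * (1 - 2 * \<epsilon>) ^ Suc s + real (k * Suc r) * D / n) * n ^ Suc s
        = tcoef r t * (1 - 2 * \<epsilon>) ^ Suc s * n ^ Suc s + real (k * Suc r) * D * n ^ s"
      using n by (simp add: field_simps)
    ultimately show False using 3 by linarith
  qed
  define M u where "M = V - W - E `` {v}" and "u = real (card (V - W))"
  have MB: "M \<inter> B = {}" "M \<union> B \<subseteq> V" by (auto simp: M_def B_def N_def)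
  have fM: "finite M" using V by (simp add: M_def)
  have "(\<Sum>w\<in>M. 1 - \<epsilon>) \<le> (\<Sum>w\<in>M. x w)" using low by (intro sum_mono) (auto simp: M_def)
  then have "real (card M) * (1 - \<epsilon>) + Y \<le> (\<Sum>w\<in>M \<union> B. x w)"
    using MB(1) fM AB(2) by (simp add: sum.union_disjoint Y_def)
  also have "\<dots> \<le> (\<Sum>w\<in>V. x w)" using MB(2) V x0 by (intro sum_mono2) auto
  also have "\<dots> \<le> n" using sum_x_le by (simp add: n_def)
  finally have "real (card M) * (1 - \<epsilon>) \<le> n - (1 - 1 / R) * (1 - 2 * \<epsilon>) * n" using Ybig by linarith
  also have "\<dots> = (1 / R + 2 * \<epsilon> * (1 - 1 / R)) * n" by (simp add: algebra_simps)
  also have "\<dots> \<le> (1 / R + 2 * \<epsilon>) * n"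
    using n \<epsilon> R by (intro mult_right_mono add_left_mono) (auto simp: mult_left_le)
  also have "\<dots> \<le> (1 / R + 2 * \<epsilon>) * ((1 + \<epsilon>) * u)"
  proof -
    have "n \<le> (1 + \<epsilon>) * u" using card_le_card_off[OF W(1,2)] by (simp add: n_def u_def)
    then show ?thesis using \<epsilon> R by (intro mult_left_mono) auto
  qed
  \<comment> \<open>The constant 10 is generous: it absorbs the passage from \<open>n\<close> to
    \<open>u\<close> and the division by \<open>1 - \<epsilon>\<close>.\<close>
  also have "\<dots> \<le> (1 / R + 10 * \<epsilon>) * (1 - \<epsilon>) * u"
  proof -
    define q where "q = 1 / R"
    have q: "0 \<le> q" "q \<le> 1 / 2" using R by (auto simp: q_def field_simps)
    have "(q + 10 * \<epsilon>) * (1 - \<epsilon>) - (q + 2 * \<epsilon>) * (1 + \<epsilon>) = \<epsilon> * (8 - 2 * q - 12 * \<epsilon>)"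
      by (simp add: algebra_simps)
    also have "0 \<le> \<dots>" using q \<epsilon> by (intro mult_nonneg_nonneg) auto
    finally have "(q + 2 * \<epsilon>) * (1 + \<epsilon>) \<le> (q + 10 * \<epsilon>) * (1 - \<epsilon>)" by simp
    then have "(q + 2 * \<epsilon>) * (1 + \<epsilon>) * u \<le> (q + 10 * \<epsilon>) * (1 - \<epsilon>) * u"
      by (intro mult_right_mono) (auto simp: u_def)
    then show ?thesis by (simp add: q_def mult.assoc)
  qed
  finally have "real (card M) * (1 - \<epsilon>) \<le> (1 / R + 10 * \<epsilon>) * u * (1 - \<epsilon>)" by (simp add: mult_ac)
  then have "real (card M) \<le> (1 / R + 10 * \<epsilon>) * u" using \<epsilon> by simp
  then show ?thesis by (simp add: M_def u_def R_def)
qed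

text \<open>Stated for an arbitrary small \<open>W\<close> because it is applied twice: to the cover
  by disjoint cliques, and to the set \<open>L\<close> of vertices with many neighbours in all
  parts. In the bound for the classes, one factor 2 comes from \<open>\<epsilon>\<close> and the
  other from passing from \<open>V\<close> to \<open>V - W\<close>.\<close>

lemma colouring_off:
  assumes W: "W \<subseteq> V" "card W \<le> k * Suc r" "cliques (Suc r) E (V - W) = {}"
  shows "\<exists>c. c ` (V - W) \<subseteq> {..<r} \<and>
    (\<forall>u\<in>V - W. \<forall>v\<in>V - W. c u = c v \<longrightarrow> (u, v) \<notin> E) \<and>
    (\<forall>i<r. real (card V) / (4 * real r) \<le> real (card {v \<in> V - W. c v = i})) \<and>
    (\<forall>v\<in>V - W. real (card ({w \<in> V - W. c w \<noteq> c v} - E `` {v})) \<le> 10 * real r * \<epsilon> * real (card V))"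
proof -
  define U where "U = V - W"
  define u where "u = real (card U)"
  define R where "R = real r"
  have R: "2 \<le> R" using r2 by (simp add: R_def)
  have fU: "finite U" using V by (simp add: U_def)
  define m where "m = (1 / R + 10 * \<epsilon>) * u"
  have deg: "real (card (U - E `` {v})) \<le> m" if "v \<in> U" for v
    using few_nonneighbours[OF W] that by (simp add: U_def m_def u_def R_def)
  have m0: "0 \<le> m" using R \<epsilon> by (simp add: m_def u_def)
  obtain c where c: "c ` U \<subseteq> {..<r}" "\<And>a b. a \<in> U \<Longrightarrow> b \<in> U \<Longrightarrow> c a = c b \<Longrightarrow> (a, b) \<notin> E"
    using proper_colouring_exists[OF fU E, of r "10 * \<epsilon>"] W(3) r2 \<epsilon> deg unfolding m_def u_def R_def U_def by auto
  have un: "u \<le> real (card V)" "real (card V) / 2 \<le> u"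
  proof -
    show "u \<le> real (card V)" using V card_mono[of V U] by (simp add: u_def U_def)
    have "real (card V) \<le> (1 + \<epsilon>) * u" using card_le_card_off[OF W(1,2)] by (simp add: u_def U_def)
    also have "\<dots> \<le> 2 * u" using \<epsilon> by (intro mult_right_mono) (auto simp: u_def)
    finally show "real (card V) / 2 \<le> u" by simp
  qed
  have R\<epsilon>: "10 * \<epsilon> * (R - 1) \<le> 1 / (2 * R)"
  proof -
    have "R * R * 1 \<le> R * R * R" using R by (intro mult_left_mono) auto
    moreover have "0 \<le> R * R * R" using R by simp
    moreover have "(R - 1) * (2 * R) = 2 * (R * R) - 2 * R" by (simp add: algebra_simps)
    ultimately have "(R - 1) * (2 * R) \<le> 6 * R ^ 3" using R unfolding power3_eq_cube by linarith
    then have "10 * \<epsilon> * ((R - 1) * (2 * R)) \<le> 10 * \<epsilon> * (6 * R ^ 3)"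
      using \<epsilon> by (intro mult_left_mono) auto
    also have "\<dots> \<le> 1" using \<epsilon>(3) by (simp add: R_def)
    finally have "10 * \<epsilon> * (R - 1) * (2 * R) \<le> 1" by (simp only: mult.assoc)
    then show ?thesis using R by (simp add: pos_le_divide_eq)
  qed
  have "real (card V) / (4 * R) \<le> real (card {v \<in> U. c v = i})" if "i < r" for i
  proof -
    have "real (card V) / (4 * R) = (1 / (2 * R)) * (real (card V) / 2)" by simp
    also have "\<dots> \<le> (1 / (2 * R)) * u" using un R by (intro mult_left_mono) auto
    also have "\<dots> \<le> (1 / R - 10 * \<epsilon> * (R - 1)) * u"
      using R\<epsilon> R by (intro mult_right_mono) (auto simp: u_def field_simps)
    also have "\<dots> = u - (R - 1) * m" using R by (simp add: m_def field_simps)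
    also have "\<dots> \<le> real (card {v \<in> U. c v = i})" unfolding u_def R_def
    proof (rule colouring_regularity(1)[OF fU c(1) _ _ m0 that])
      show "(a, b) \<notin> E" if "a \<in> U" "b \<in> U" "c a = c b" for a b using that by (rule c(2))
      show "real (card (U - E `` {a})) \<le> m" if "a \<in> U" for a using that by (rule deg)
    qed
    finally show ?thesis .
  qed
  moreover have "real (card ({w \<in> U. c w \<noteq> c v} - E `` {v})) \<le> 10 * R * \<epsilon> * real (card V)" if "v \<in> U" for v
  proof -
    have "real (card ({w \<in> U. c w \<noteq> c v} - E `` {v})) \<le> R * m - u" unfolding u_def R_def
    proof (rule colouring_regularity(2)[OF fU c(1) _ _ m0 that])
      show "(a, b) \<notin> E" if "a \<in> U" "b \<in> U" "c a = c b" for a b using that by (rule c(2))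
      show "real (card (U - E `` {a})) \<le> m" if "a \<in> U" for a using that by (rule deg)
    qed
    also have "\<dots> = 10 * R * \<epsilon> * u" using R by (simp add: m_def field_simps)
    also have "\<dots> \<le> 10 * R * \<epsilon> * real (card V)" using un R \<epsilon> by (intro mult_left_mono) auto
    finally show ?thesis .
  qed
  ultimately show ?thesis using c unfolding U_def R_def by (intro exI[of _ c]) simp
qed

lemma join_structure:
  assumes k2: "2 \<le> k"
  shows "\<exists>c. c ` V \<subseteq> {..r} \<and> card {v \<in> V. c v = r} = k - 1 \<and> E \<inter> V \<times> V \<subseteq> jn r V c"
proof -
  define n where "n = real (card V)"
  have n: "0 < n" using n0 by (simp add: n_def)
  define R where "R = real r"
  have R: "2 \<le> R" using r2 by (simp add: R_def)
  define w0 where "w0 = k * Suc r"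
  obtain W where W: "W \<subseteq> V" "card W \<le> k * Suc r" "cliques (Suc r) E (V - W) = {}"
    using packing_cover[OF V nopack] by blast
  have fW: "finite W" using W(1) V finite_subset by blast
  from colouring_off[OF W]
  obtain c where c': "c ` (V - W) \<subseteq> {..<r}"
    "\<forall>u\<in>V - W. \<forall>v\<in>V - W. c u = c v \<longrightarrow> (u, v) \<notin> E"
    "\<forall>i<r. real (card V) / (4 * real r) \<le> real (card {v \<in> V - W. c v = i})"
    "\<forall>v\<in>V - W. real (card ({w \<in> V - W. c w \<noteq> c v} - E `` {v})) \<le> 10 * real r * \<epsilon> * real (card V)"
    by (elim exE conjE) (rule that)
  note c = c'(1) c'(2)[rule_format] c'(3)[rule_format] c'(4)[rule_format]
  define P where "P i = {v \<in> V - W. c v = i}" for i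
  have PV: "P i \<subseteq> V - W" for i by (auto simp: P_def)
  have fP: "finite (P i)" for i using V by (simp add: P_def)
  \<comment> \<open>Twice what a transversal clique needs: half of the \<open>\<gamma> * n\<close>
    neighbours in a class may be lost to the forbidden set \<open>Z\<close>, the other half pays for
    the greedy choice through \<open>r\<close> classes.\<close>
  define \<gamma> where "\<gamma> = 20 * R\<^sup>2 * \<epsilon>"
  have \<gamma>n: "0 < \<gamma> * n" using R \<epsilon> n by (simp add: \<gamma>_def)
  define L where "L = {w \<in> V. \<forall>i<r. \<gamma> * n \<le> real (card (P i \<inter> E `` {w}))}"
  have LV: "L \<subseteq> V" by (auto simp: L_def)
  have fL: "finite L" using LV V finite_subset by blast
  \<comment> \<open>A vertex outside \<open>W\<close> has no neighbour in its own class.\<close>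
  have LW: "L \<subseteq> W"
  proof
    fix w assume w: "w \<in> L"
    show "w \<in> W"
    proof (rule ccontr)
      assume "w \<notin> W"
      then have "w \<in> V - W" using w LV by auto
      then have "c w < r" "P (c w) \<inter> E `` {w} = {}" using c(1,2) by (auto simp: P_def)
      then have "\<gamma> * n \<le> real (card ({} :: 'a set))" using w unfolding L_def by (metis (mono_tags, lifting) mem_Collect_eq)
      then show False using \<gamma>n by simp
    qed
  qed
  have robust: "\<exists>S. S \<in> cliques r E (V \<inter> E `` {w} - Z)"
    if w: "w \<in> L" and Z: "finite Z" "card Z \<le> w0" for w Z
  proof -
    define T where "T i = P i \<inter> E `` {w} - Z" for i
    define \<beta> where "\<beta> = 10 * R * \<epsilon> * n"
    have \<beta>0: "0 \<le> \<beta>" using R \<epsilon> n by (simp add: \<beta>_def)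
    have "\<exists>S. S \<in> cliques (card {..<r}) E (\<Union> (T ` {..<r}))"
    proof (rule transversal_clique[OF _ E \<beta>0])
      show "finite (T i)" for i using fP by (simp add: T_def)
      show "real (card (T j - E `` {y})) \<le> \<beta>" if "i \<in> {..<r}" "j \<in> {..<r}" "i \<noteq> j" "y \<in> T i" for i j y
      proof -
        have y: "y \<in> V - W" "c y = i" using that(4) by (auto simp: T_def P_def)
        have "T j - E `` {y} \<subseteq> {w \<in> V - W. c w \<noteq> c y} - E `` {y}" using that(3) y by (auto simp: T_def P_def)
        then have "card (T j - E `` {y}) \<le> card ({w \<in> V - W. c w \<noteq> c y} - E `` {y})" using V by (intro card_mono) auto
        then show ?thesis using c(4)[OF y(1)] unfolding \<beta>_def R_def n_def by linarith
      qed
      show "\<beta> * real (card {..<r}) < real (card (T i))" if "i \<in> {..<r}" for i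
      proof -
        have "\<gamma> * n \<le> real (card (P i \<inter> E `` {w}))" using w that by (simp add: L_def)
        moreover have "card (P i \<inter> E `` {w}) \<le> card (T i) + card Z"
          using card_Un_le[of "T i" Z] card_mono[of "T i \<union> Z" "P i \<inter> E `` {w}"] fP Z(1) by (fastforce simp: T_def)
        moreover have "real w0 < 10 * R\<^sup>2 * \<epsilon> * n" using big3 by (simp only: w0_def R_def n_def)
        ultimately have "\<gamma> * n - 10 * R\<^sup>2 * \<epsilon> * n < real (card (T i))" using Z(2) by linarith
        moreover have "\<gamma> * n - 10 * R\<^sup>2 * \<epsilon> * n = \<beta> * real (card {..<r})"
          by (simp add: \<gamma>_def \<beta>_def R_def power2_eq_square)
        ultimately show ?thesis by simp
      qed
    qed simp
    then obtain S where S: "S \<in> cliques r E (\<Union> (T ` {..<r}))" by auto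
    have "\<Union> (T ` {..<r}) \<subseteq> V \<inter> E `` {w} - Z" using PV by (fastforce simp: T_def)
    then show ?thesis using S cliques_mono[of E E "\<Union> (T ` {..<r})"] by blast
  qed
  have cL: "card L \<le> k - 1"
  proof (rule ccontr)
    assume "\<not> card L \<le> k - 1"
    then have "k \<le> card L" by simp
    then obtain L' where L': "L' \<subseteq> L" "card L' = k" using obtain_subset_with_card_n by metis
    have "packs (0 + card L') (Suc r) E V"
    proof (rule packs_of_robust[OF V E, where U = "{}" and z = w0])
      show "\<exists>S. S \<in> cliques r E (V \<inter> E `` {w} - Z)" if "w \<in> L'" "finite Z" "card Z \<le> w0" for w Z
        using robust that L' by blast
    qed (use L' LV in \<open>auto simp: w0_def\<close>)
    then show False using nopack L' by simp
  qed
  show ?thesis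
  proof (cases "card L = k - 1")
    case True
    \<comment> \<open>A clique avoiding \<open>L\<close>, together with disjoint cliques through the
      \<open>k - 1\<close> vertices of \<open>L\<close>, would complete the forbidden
      packing.\<close>
    have free: "cliques (Suc r) E (V - L) = {}"
    proof (rule ccontr)
      assume "cliques (Suc r) E (V - L) \<noteq> {}"
      then obtain S where S: "S \<in> cliques (Suc r) E (V - L)" by blast
      have "S \<in> cliques (Suc r) E S" using S by (auto simp: cliques_def)
      then have p1: "packs 1 (Suc r) E S" by auto
      have "packs (1 + card L) (Suc r) E V"
      proof (rule packs_of_robust[OF V E _ LV p1, where z = w0])
        show "\<exists>S. S \<in> cliques r E (V \<inter> E `` {w} - Z)" if "w \<in> L" "finite Z" "card Z \<le> w0" for w Z
          using robust that by blast
        have "card S + card L * Suc r = Suc (k - 1) * Suc r" using S True by (simp add: cliques_def)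
        then show "card S + card L * Suc r \<le> w0" using k2 by (simp add: w0_def)
      qed (use S in \<open>simp add: cliques_def\<close>)
      then show False using nopack True k2 by simp
    qed
    have "card L \<le> k * Suc r" using card_mono[OF fW LW] W(2) by linarith
    from colouring_off[OF LV this free]
    obtain d where d: "d ` (V - L) \<subseteq> {..<r}"
      "\<forall>u\<in>V - L. \<forall>v\<in>V - L. d u = d v \<longrightarrow> (u, v) \<notin> E"
      by (elim exE conjE) (rule that)
    define e where "e v = (if v \<in> L then r else d v)" for v
    have er: "e v = r \<longleftrightarrow> v \<in> L" if "v \<in> V" for v using d(1) that by (auto simp: e_def)
    have "e ` V \<subseteq> {..r}" using d(1) by (fastforce simp: e_def)
    moreover have "{v \<in> V. e v = r} = L" using er LV by auto
    moreover have "E \<inter> V \<times> V \<subseteq> jn r V e"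
    proof clarify
      fix a b assume ab: "(a, b) \<in> E" "a \<in> V" "b \<in> V"
      have "a \<noteq> b" using E(2) ab by (auto simp: irrefl_def)
      moreover have "e a \<noteq> e b \<or> e a = r" using d(2) ab er[of a] er[of b] by (auto simp: e_def)
      ultimately show "(a, b) \<in> jn r V e" using ab by (simp add: jn_def)
    qed
    ultimately show ?thesis using True by (intro exI[of _ e]) simp
  next
    case False
    then have cL': "card L < k - 1" using cL by simp
    have "\<exists>i<r. real (card (P i \<inter> E `` {w})) < \<gamma> * n" if "w \<in> V - L" for w
      using that by (auto simp: L_def not_le)
    then obtain d where d: "\<And>w. w \<in> V - L \<Longrightarrow> d w < r"
      "\<And>w. w \<in> V - L \<Longrightarrow> real (card (P (d w) \<inter> E `` {w})) < \<gamma> * n" by metis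
    \<comment> \<open>The remaining vertices of \<open>W\<close> join a class in which they have few
      neighbours. This colouring need not be proper, but its violations are few.\<close>
    define e where "e v = (if v \<in> L then r else if v \<in> W then d v else c v)" for v
    have eL: "e v = r \<longleftrightarrow> v \<in> L" if "v \<in> V" for v using that c(1) d(1)[of v] by (auto simp: e_def)
    have er: "e v < r" if "v \<in> V - L" for v using that c(1) d(1)[of v] by (auto simp: e_def)
    have Pe: "P i \<subseteq> {v \<in> V. e v = i}" for i using LW by (auto simp: P_def e_def)
    define J where "J = jn r V e"
    have EJ: "sym J" "irrefl J" by (auto simp: J_def)
    obtain s where s: "t = Suc (Suc s)" using t by (metis add_2_eq_Suc le_Suc_ex)
    define D where "D = wmax r t"
    text \<open>The edges of the graph inside a colour class number at most a small multiple of \<open>n\<close>,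
      because each of them meets the bounded set \<open>W - L\<close>.\<close>
    define F where "F = {(a, b). a \<in> V \<and> b \<in> V \<and> a \<noteq> b \<and> (a, b) \<in> E \<and> (a, b) \<notin> J}"
    \<comment> \<open>For \<open>w\<close> in \<open>W - L\<close> this contains all neighbours of
      \<open>w\<close> of the same colour: such a neighbour outside \<open>W\<close> lies in
      \<open>P (d w)\<close>, where \<open>w\<close> has few neighbours.\<close>
    define B where "B w = (P (d w) \<inter> E `` {w}) \<union> W" for w
    have cB: "real (card (B w)) \<le> \<gamma> * n + real w0" if "w \<in> V - L" for w
    proof -
      have "card (B w) \<le> card (P (d w) \<inter> E `` {w}) + card W" unfolding B_def by (rule card_Un_le)
      moreover have "card W \<le> w0" using W(2) by (simp add: w0_def)
      ultimately show ?thesis using d(2)[OF that] by linarith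
    qed
    have fB: "finite (B w)" for w using fP fW by (simp add: B_def)
    have "F \<subseteq> (\<Union>w\<in>W - L. {w} \<times> B w) \<union> (\<Union>w\<in>W - L. B w \<times> {w})"
    proof clarify
      fix a b assume ab: "(a, b) \<in> F" "(a, b) \<notin> (\<Union>w\<in>W - L. B w \<times> {w})"
      then have F: "a \<in> V" "b \<in> V" "a \<noteq> b" "(a, b) \<in> E" "e a = e b" "e a \<noteq> r"
        by (auto simp: F_def J_def jn_def)
      have nL: "a \<notin> L" "b \<notin> L" using eL[OF F(1)] eL[OF F(2)] F(5,6) by auto
      have ba: "(b, a) \<in> E" using F(4) E(1) by (auto dest: symD)
      have nbW: False if "b \<in> W" "a \<notin> W"
      proof -
        have "a \<in> P (d b)" using that F nL by (auto simp: P_def e_def)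
        then have "a \<in> B b" using ba by (simp add: B_def)
        then show False using ab(2) that nL by auto
      qed
      have "a \<in> W"
      proof (rule ccontr)
        assume a: "a \<notin> W"
        then have "b \<notin> W" using nbW by blast
        then have "c a = c b" using a F(5) nL by (simp add: e_def)
        then show False using c(2)[of a b] a \<open>b \<notin> W\<close> F by blast
      qed
      moreover have "b \<in> B a"
      proof (cases "b \<in> W")
        case F': False
        then have "b \<in> P (d a)" using F nL \<open>a \<in> W\<close> by (auto simp: P_def e_def)
        then show ?thesis using F(4) by (simp add: B_def)
      qed (simp add: B_def)
      ultimately show "(a, b) \<in> (\<Union>w\<in>W - L. {w} \<times> B w)" using nL by auto
    qed
    then have "card F \<le> card ((\<Union>w\<in>W - L. {w} \<times> B w) \<union> (\<Union>w\<in>W - L. B w \<times> {w}))"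
      using fW fB by (intro card_mono) auto
    also have "\<dots> \<le> card (\<Union>w\<in>W - L. {w} \<times> B w) + card (\<Union>w\<in>W - L. B w \<times> {w})"
      by (rule card_Un_le)
    also have "\<dots> \<le> (\<Sum>w\<in>W - L. card ({w} \<times> B w)) + (\<Sum>w\<in>W - L. card (B w \<times> {w}))"
      using fW by (intro add_mono card_UN_le) auto
    also have "\<dots> = 2 * (\<Sum>w\<in>W - L. card (B w))" by (simp add: card_cartesian_product)
    finally have "real (card F) \<le> 2 * (\<Sum>w\<in>W - L. real (card (B w)))"
      by (metis of_nat_le_iff of_nat_mult of_nat_numeral of_nat_sum)
    also have "(\<Sum>w\<in>W - L. real (card (B w))) \<le> (\<Sum>w\<in>W - L. \<gamma> * n + real w0)"
      using W(1) by (intro sum_mono cB) auto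
    also have "\<dots> = real (card (W - L)) * (\<gamma> * n + real w0)" by simp
    also have "\<dots> \<le> real w0 * (\<gamma> * n + real w0)"
    proof (rule mult_right_mono)
      have "card (W - L) \<le> card W" using fW by (intro card_mono) auto
      then have "card (W - L) \<le> w0" using W(2) by (simp add: w0_def)
      then show "real (card (W - L)) \<le> real w0" by simp
    qed (use \<gamma>n in simp)
    finally have cF: "real (card F) \<le> 2 * (real w0 * (\<gamma> * n + real w0))" by simp
    have loss: "kap t E x V \<le> kap t J x V + 2 * (real w0 * (\<gamma> * n + real w0)) * (D\<^sup>2 * n ^ s)"
    proof -
      have "kap t E x V \<le> kap t J x V + real (card F) * (D\<^sup>2 * n ^ s)" unfolding s using V E(1) x0 x_le sum_x_le
        by (intro kap_le_bad_edges) (auto simp: D_def n_def F_def)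
      moreover have "real (card F) * (D\<^sup>2 * n ^ s) \<le> 2 * (real w0 * (\<gamma> * n + real w0)) * (D\<^sup>2 * n ^ s)"
        using cF n by (intro mult_right_mono) auto
      ultimately show ?thesis by linarith
    qed
    \<comment> \<open>Each \<open>P i\<close> has at least \<open>2 * Q\<close> vertices of weight
      at least 1/2, so every colour class weighs at least \<open>Q\<close>.\<close>
    define Q where "Q = n / (8 * R)"
    have Q0: "1 \<le> Q" using big4 R by (simp add: Q_def n_def R_def)
    have P2Q: "2 * Q \<le> real (card (P i))" if "i < r" for i using c(3)[OF that] R by (simp add: P_def Q_def n_def R_def)
    have "1 \<le> real (card (P 0))" using P2Q[of 0] Q0 r2 by linarith
    then have "P 0 \<noteq> {}" by (metis card.empty not_one_le_zero of_nat_0 of_nat_1 of_nat_le_iff)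
    then obtain v0 where v0: "v0 \<in> P 0" by blast
    have v0': "v0 \<in> V" "v0 \<notin> L" "e v0 = 0" using v0 Pe[of 0] LW by (auto simp: P_def)
    \<comment> \<open>There is room for \<open>v0\<close> beside \<open>L\<close> because
      \<open>L\<close> has fewer than \<open>k - 1\<close> elements. Filling up to exactly
      \<open>k - 1\<close> makes the new graph comparable with the extremal one.\<close>
    obtain L1 where L1: "insert v0 L \<subseteq> L1" "L1 \<subseteq> V" "card L1 = k - 1"
    proof -
      have "card (insert v0 L) \<le> k - 1" using cL' v0' fL by simp
      moreover have "k - 1 \<le> card V" using nbig by simp
      ultimately obtain L1 where "insert v0 L \<subseteq> L1" "L1 \<subseteq> V" "card L1 = k - 1"
        using exists_subset_between[of "insert v0 L" "k - 1" V] v0' LV V by auto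
      then show thesis using that by blast
    qed
    define e1 where "e1 v = (if v \<in> L1 then r else e v)" for v
    define J1 where "J1 = jn r V e1"
    have EJ1: "sym J1" "irrefl J1" by (auto simp: J1_def)
    have inL1: "v \<in> L1" if "v \<in> V" "e v = r" for v using eL that L1(1) by auto
    have JJ1: "J \<subseteq> J1"
    proof clarify
      fix a b assume "(a, b) \<in> J"
      then have ab: "a \<in> V" "b \<in> V" "a \<noteq> b" "e a \<noteq> e b \<or> e a = r" by (auto simp: J_def jn_def)
      then have "e1 a \<noteq> e1 b \<or> e1 a = r" using inL1[of a] inL1[of b] by (auto simp: e1_def)
      then show "(a, b) \<in> J1" using ab by (simp add: J1_def jn_def)
    qed
    have e1: "e1 ` V \<subseteq> {..r}" "{v \<in> V. e1 v = r} = L1" using er eL L1 LV by (auto simp: e1_def less_imp_le le_less)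
    define C0 where "C0 = {v \<in> V. e v = 0}"
    have C0: "v0 \<in> C0" "C0 \<subseteq> V" "finite C0" using v0' V by (auto simp: C0_def)
    define K where "K j = kap j J x (V - C0)" for j
    have K0: "0 \<le> K j" for j unfolding K_def using x0 by (intro kap_nonneg)
    have half: "1 / 2 \<le> x v" if "v \<in> V" for v using low[OF that] \<epsilon> by linarith
    have k1: "kap t J x V = kap t J x (V - {v0}) + x v0 * K (Suc s)"
    proof -
      have "V \<inter> J `` {v0} = V - C0" using v0' r2 by (auto simp: J_def jn_def C0_def)
      then show ?thesis using kap_split[OF V v0'(1) EJ, of "Suc s" x] by (simp add: s K_def)
    qed
    have k2: "kap t J1 x V = kap t J1 x (V - {v0}) + x v0 * kap (Suc s) J1 x (V - {v0})"
    proof -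
      have "V \<inter> J1 `` {v0} = V - {v0}" using v0' L1 by (auto simp: J1_def jn_def e1_def)
      then show ?thesis using kap_split[OF V v0'(1) EJ1, of "Suc s" x] by (simp add: s)
    qed
    have k3: "kap (Suc s) J x (V - {v0}) = K (Suc s) + (\<Sum>v\<in>C0 - {v0}. x v) * K s"
    proof -
      have "kap (Suc s) J x (V - {v0}) = kap (Suc s) J x (V - {v0} - (C0 - {v0}))
          + (\<Sum>v\<in>C0 - {v0}. x v) * kap s J x (V - {v0} - (C0 - {v0}))"
        unfolding J_def using V r2 by (intro kap_jn_class[where p = 0]) (auto simp: C0_def)
      moreover have "V - {v0} - (C0 - {v0}) = V - C0" using C0 by blast
      ultimately show ?thesis by (simp add: K_def)
    qed
    have mono: "kap j J x (V - {v0}) \<le> kap j J1 x (V - {v0})" for j using V x0 by (intro kap_mono cliques_mono[OF JJ1]) auto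
    then have "x v0 * kap (Suc s) J x (V - {v0}) \<le> x v0 * kap (Suc s) J1 x (V - {v0})" using x0 by (intro mult_left_mono)
    \<comment> \<open>Joining \<open>v0\<close> to its own class creates cliques consisting of
      \<open>v0\<close>, another vertex of that class and \<open>s\<close> vertices from
      elsewhere.\<close>
    then have gain: "kap t J x V + x v0 * ((\<Sum>v\<in>C0 - {v0}. x v) * K s) \<le> kap t J1 x V"
      using k1 k2 k3 mono[of t] by (simp add: algebra_simps)
    have Xge: "real (card S) / 2 \<le> (\<Sum>v\<in>T. x v)" if "S \<subseteq> T" "T \<subseteq> V" for S T
    proof -
      have fT: "finite T" using that(2) V finite_subset by blast
      have "(\<Sum>v\<in>S. 1 / 2) \<le> (\<Sum>v\<in>S. x v)" using half that by (intro sum_mono) auto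
      also have "\<dots> \<le> (\<Sum>v\<in>T. x v)" using that fT x0 by (intro sum_mono2) auto
      finally show ?thesis by simp
    qed
    have XC: "Q / 2 \<le> (\<Sum>v\<in>C0 - {v0}. x v)"
    proof -
      have "real (card (P 0 - {v0})) / 2 \<le> (\<Sum>v\<in>C0 - {v0}. x v)" using Pe[of 0] C0 by (intro Xge) (auto simp: C0_def)
      moreover have "real (card (P 0 - {v0})) = real (card (P 0)) - 1" using card.remove[OF fP v0] by linarith
      ultimately show ?thesis using P2Q[of 0] Q0 r2 by simp
    qed
    have KQ: "Q ^ s \<le> K s"
    proof -
      have "Q \<le> (\<Sum>v\<in>{v \<in> V. e v = i}. x v)" if "i \<in> {1..<r}" for i
        using Xge[OF Pe[of i]] P2Q[of i] that by fastforce
      then have "real (card {1..<r} choose s) * Q ^ s \<le> kap s J x {v \<in> V. e v \<in> {1..<r}}"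
        unfolding J_def using V x0 Q0 by (intro kap_jn_classes_ge) auto
      also have "\<dots> \<le> K s" unfolding K_def using V x0 by (intro kap_mono_set) (auto simp: C0_def)
      finally have "real (r - 1 choose s) * Q ^ s \<le> K s" by simp
      moreover have "1 \<le> r - 1 choose s" using t s by (simp add: Suc_le_eq)
      then have "1 * Q ^ s \<le> real (r - 1 choose s) * Q ^ s" using Q0 by (intro mult_right_mono) auto
      ultimately show ?thesis by simp
    qed
    have "1 / 2 * (Q / 2 * Q ^ s) \<le> x v0 * ((\<Sum>v\<in>C0 - {v0}. x v) * K s)"
      using half[OF v0'(1)] XC KQ Q0 x0 by (intro mult_mono) (auto intro!: mult_nonneg_nonneg sum_nonneg K0)
    then have gain': "kap t J x V + Q ^ Suc s / 4 \<le> kap t J1 x V" using gain by simp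
    \<comment> \<open>Loss and gain are both of order \<open>n ^ (t - 1)\<close>, but the leading
      coefficient of the loss is proportional to \<open>\<epsilon>\<close>. In \<open>big5\<close>
      the base \<open>16 * R\<close> instead of \<open>8 * R\<close> covers the remaining constant
      factor.\<close>
    have "2 * (real w0 * (\<gamma> * n + real w0)) * (D\<^sup>2 * n ^ s) < Q ^ Suc s / 4"
    proof -
      define H where "H = (16 * R) ^ Suc s"
      have H: "0 < H" using R by (simp add: H_def)
      have b5: "4 * real w0 * D\<^sup>2 * (\<gamma> + real w0 / n) * H < 1"
        using big5 unfolding w0_def D_def \<gamma>_def n_def H_def R_def s by simp
      have "(2 * (real w0 * (\<gamma> * n + real w0)) * (D\<^sup>2 * n ^ s)) * 2 * H
          = (4 * real w0 * D\<^sup>2 * (\<gamma> + real w0 / n) * H) * n ^ Suc s"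
        using n by (simp add: field_simps)
      also have "\<dots> < 1 * n ^ Suc s" using b5 n by (intro mult_strict_right_mono) auto
      also have "\<dots> = Q ^ Suc s * (8 * R) ^ Suc s" using R by (simp add: Q_def power_divide)
      also have "(8 * R) ^ Suc s = H / 2 ^ Suc s" using power_divide[of "16 * R" 2 "Suc s"] by (simp add: H_def)
      also have "Q ^ Suc s * (H / 2 ^ Suc s) \<le> Q ^ Suc s * (H / 2)" using Q0 H by (intro mult_left_mono divide_left_mono) auto
      finally have "(2 * (real w0 * (\<gamma> * n + real w0)) * (D\<^sup>2 * n ^ s)) * (2 * H) < Q ^ Suc s / 4 * (2 * H)"
        by (simp add: mult_ac)
      then show ?thesis using H by (simp only: mult_less_cancel_right)
    qed
    then have "kap t E x V < kap t J1 x V" using loss gain' by linarith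
    then have "real t * kap t E x V < real t * kap t J1 x V" using t by simp
    also have "\<dots> \<le> rho t J1 V * (\<Sum>v\<in>V. x v ^ t)" using V ne EJ1 t x0 by (intro rho_upper) auto
    also have "\<dots> = rho t J1 V * real (card V)" using xsum by simp
    also have "\<dots> \<le> hrho r t k (card V) * real (card V)"
    proof (rule mult_right_mono)
      show "rho t J1 V \<le> hrho r t k (card V)" unfolding J1_def using V e1 L1 t k nbig r2 by (intro jn_le_hrho hrho_pos) auto
    qed simp
    also have "\<dots> \<le> rho t E V * real (card V)" using rho by (intro mult_right_mono) auto
    finally show ?thesis using xmax by simp
  qed
qed

end

section \<open>Deleting vertices of small weight\<close>

text \<open>The ends of the edge use at most two colours, so at least
  \<open>r - 2 \<ge> t - 2\<close> colours below \<open>r\<close> remain; the vertex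
  \<open>Inr i\<close> with \<open>i < r\<close> represents colour \<open>i\<close>, and
  \<open>n\<close> is large enough for it to exist. Thus the \<open>t\<close>-cliques determine all
  edges, as needed in the case of equality.\<close>

lemma hgraph_arc_in_clique:
  assumes t: "2 \<le> t" "t \<le> r" and n: "r \<le> n - k + 1" and ab: "(a, b) \<in> parcs (hgraph r k n)"
  shows "\<exists>S. S \<in> cliques t (parcs (hgraph r k n)) (pverts (hgraph r k n)) \<and> a \<in> S \<and> b \<in> S"
proof -
  let ?V = "pverts (hgraph r k n)"
  have r: "0 < r" using t by simp
  obtain s where s: "t = Suc (Suc s)" using t by (metis add_2_eq_Suc le_Suc_ex)
  define C where "C = {..<r} - {hcol r a, hcol r b}"
  have "r - 2 \<le> card C"
  proof -
    have "card {..<r} - card {hcol r a, hcol r b} \<le> card C" unfolding C_def by (rule diff_card_le_card_Diff) simp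
    moreover have "card {hcol r a, hcol r b} \<le> 2" by (simp add: card_insert_if)
    ultimately show ?thesis by simp
  qed
  then have "s \<le> card C" using t s by simp
  then obtain I where I: "I \<subseteq> C" "card I = s" using obtain_subset_with_card_n by metis
  have fI: "finite I" using I(1) by (rule finite_subset) (simp add: C_def)
  have col: "hcol r (Inr i) = i" "Inr i \<in> ?V" if "i < r" for i using that n by (auto simp: hcol_def pverts_hgraph)
  have Ir: "i < r" "hcol r a \<noteq> i" "hcol r b \<noteq> i" if "i \<in> I" for i using that I(1) by (auto simp: C_def)
  have ab': "a \<in> ?V" "b \<in> ?V" "a \<noteq> b" "hcol r a \<noteq> hcol r b \<or> hcol r a = r"
    using ab unfolding parcs_hgraph[OF r] by (auto simp: jn_def)
  let ?S = "insert a (insert b (Inr ` I))"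
  have nin: "a \<notin> Inr ` I" "b \<notin> Inr ` I" using Ir col(1) by auto
  have "card ?S = t" using nin ab'(3) fI I(2) s by (simp add: card_image)
  moreover have "?S \<subseteq> ?V" using ab' Ir col(2) by auto
  moreover have "(u, v) \<in> jn r ?V (hcol r)" if "u \<in> ?S" "v \<in> ?S" "u \<noteq> v" for u v
  proof -
    have "u \<in> ?V" "v \<in> ?V" using that(1,2) \<open>?S \<subseteq> ?V\<close> by auto
    moreover have "hcol r u \<noteq> hcol r v \<or> hcol r u = r" using that ab'(4) Ir col(1) by (fastforce simp del: One_nat_def)
    ultimately show ?thesis using that(3) by (simp add: jn_def)
  qed
  ultimately have "?S \<in> cliques t (jn r ?V (hcol r)) ?V" unfolding cliques_def by simp
  then show ?thesis unfolding parcs_hgraph[OF r] by (intro exI[of _ ?S]) simp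
qed

definition extremal_ok :: "nat \<Rightarrow> nat \<Rightarrow> nat \<Rightarrow> 'a set \<Rightarrow> ('a \<times> 'a) set \<Rightarrow> bool" where
  "extremal_ok r t k V E \<longleftrightarrow> rho t E V \<le> hrho r t k (card V) \<and>
    (rho t E V = hrho r t k (card V) \<longrightarrow>
      iso_on V E (pverts (hgraph r k (card V))) (parcs (hgraph r k (card V))))"

context flat_perron
begin

text \<open>\<open>E\<close> lies inside a join graph \<open>J\<close>, which is at most extremal.
  In the case of equality \<open>x\<close> gives the same clique sum for both, and all weights are
  positive, so every \<open>t\<close>-clique of \<open>J\<close> is one of \<open>E\<close>. Since
  each edge of \<open>J\<close> lies in a \<open>t\<close>-clique, the two graphs agree on
  \<open>V\<close>.\<close>

lemma extremal:
  assumes k2: "2 \<le> k"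
  shows "extremal_ok r t k V E"
proof -
  obtain c where c: "c ` V \<subseteq> {..r}" "card {v \<in> V. c v = r} = k - 1" "E \<inter> V \<times> V \<subseteq> jn r V c"
    using join_structure[OF k2] by blast
  let ?H = "hgraph r k (card V)"
  define J where "J = jn r V c"
  have EJ: "sym J" "irrefl J" by (auto simp: J_def)
  have r0: "0 < r" and kn: "k \<le> card V" using r2 nbig by auto
  note jle = jn_le_hrho[OF t(1) r0 k kn hrho_pos[OF t k nbig] V refl c(1,2), folded J_def]
  have sub: "cliques t E V \<subseteq> cliques t J V"
  proof
    fix S assume S: "S \<in> cliques t E V"
    then have SV: "S \<subseteq> V" by (simp add: cliques_def)
    have "(u, v) \<in> J" if "u \<in> S" "v \<in> S" "u \<noteq> v" for u v
    proof -
      have "(u, v) \<in> E" using S that by (simp add: cliques_def)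
      then show ?thesis using c(3) SV that unfolding J_def by blast
    qed
    then show "S \<in> cliques t J V" using S by (simp add: cliques_def)
  qed
  have kEJ: "kap t E x V \<le> kap t J x V" using V sub x0 by (intro kap_mono)
  have kJ: "real t * kap t J x V \<le> rho t J V * real (card V)" using rho_upper[OF V ne EJ t(1), of x] x0 xsum by simp
  have "rho t E V * real (card V) \<le> rho t J V * real (card V)"
    unfolding xmax[symmetric] using kEJ kJ t by (intro order_trans[OF mult_left_mono kJ]) auto
  then have rEJ: "rho t E V \<le> rho t J V" using n0 by (rule mult_right_le_imp_le)
  have "iso_on V E (pverts ?H) (parcs ?H)"
    if eq: "rho t E V = hrho r t k (card V)"
  proof -
    have eqJ: "rho t J V = hrho r t k (card V)" using jle(1) rEJ eq by linarith
    then obtain f where f: "bij_betw f V (pverts ?H)"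
      "\<And>u v. u \<in> V \<Longrightarrow> v \<in> V \<Longrightarrow> (u, v) \<in> J \<longleftrightarrow> (f u, f v) \<in> parcs ?H"
      using jle(2) unfolding iso_on_def by metis
    have "real t * kap t J x V \<le> real t * kap t E x V" using kJ eqJ eq xmax by simp
    then have "kap t J x V \<le> kap t E x V" using t by simp
    then have "(\<Sum>S\<in>cliques t J V - cliques t E V. \<Prod>i\<in>S. x i) \<le> 0" using V sub by (simp add: kap_def sum_diff)
    moreover have pos: "0 < (\<Prod>i\<in>S. x i)" if "S \<in> cliques t J V" for S
    proof (rule prod_pos)
      show "0 < x i" if "i \<in> S" for i
        using low[of i] \<epsilon> that \<open>S \<in> cliques t J V\<close> by (force simp: cliques_def)
    qed
    ultimately have same: "cliques t J V = cliques t E V"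
      using sub V sum_pos[of "cliques t J V - cliques t E V" "\<lambda>S. \<Prod>i\<in>S. x i"] by fastforce
    have "(u, v) \<in> E" if uv: "(u, v) \<in> J" for u v
    proof -
      have uvV: "u \<in> V" "v \<in> V" "u \<noteq> v" using uv by (auto simp: J_def jn_def)
      then have "(f u, f v) \<in> parcs ?H" using f(2) uv by blast
      moreover have "r \<le> card V - k + 1" using nbig by simp
      ultimately obtain S where S: "S \<in> cliques t (parcs ?H) (pverts ?H)" "f u \<in> S" "f v \<in> S"
        using hgraph_arc_in_clique[OF t] by blast
      define T where "T = {w \<in> V. f w \<in> S}"
      have inj: "inj_on f V" and im: "f ` V = pverts ?H" using f(1) by (auto simp: bij_betw_def)
      have "f ` T = S" using S(1) im by (auto simp: T_def cliques_def)
      moreover have "inj_on f T" using inj by (rule inj_on_subset) (auto simp: T_def)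
      ultimately have cT: "card T = t" using S(1) card_image[of f T] by (simp add: cliques_def)
      have "(a, b) \<in> J" if "a \<in> T" "b \<in> T" "a \<noteq> b" for a b
      proof -
        have ab: "a \<in> V" "b \<in> V" "f a \<in> S" "f b \<in> S" using that by (auto simp: T_def)
        then have "f a \<noteq> f b" using that(3) inj by (auto dest: inj_onD)
        then have "(f a, f b) \<in> parcs ?H" using S(1) ab by (simp add: cliques_def)
        then show ?thesis using f(2) ab by blast
      qed
      then have "T \<in> cliques t J V" using cT by (auto simp: cliques_def T_def)
      then have "T \<in> cliques t E V" using same by simp
      then show ?thesis using uvV S by (simp add: cliques_def T_def)
    qed
    moreover have "(u, v) \<in> J" if "(u, v) \<in> E" "u \<in> V" "v \<in> V" for u v using c(3) that unfolding J_def by blast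
    ultimately show ?thesis using f unfolding iso_on_def by (intro exI[of _ f]) blast
  qed
  then show ?thesis using jle(1) rEJ unfolding extremal_ok_def by auto
qed

end

section \<open>Descent to graphs of bounded order\<close>

lemma rho_le_trivial:
  assumes "finite V" "V \<noteq> {}" "sym E" "irrefl E" "2 \<le> t"
  shows "rho t E V \<le> real t * real (card V) ^ t"
proof -
  obtain x where x: "\<And>v. 0 \<le> x v" "(\<Sum>v\<in>V. x v ^ t) = real (card V)"
    "real t * kap t E x V = rho t E V * real (card V)"
    using perron[OF assms] by metis
  have n: "1 \<le> real (card V)" using assms(1,2) by (simp add: Suc_le_eq card_gt_0_iff)
  have "kap t E x V \<le> (\<Sum>v\<in>V. x v) ^ t" using assms x(1) by (intro kap_le_power) auto
  also have "\<dots> \<le> real (card V) ^ t" using sum_le_card_of_power_sum[of t V x] x assms(5) by (intro power_mono sum_nonneg) auto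
  finally have "real t * kap t E x V \<le> real t * real (card V) ^ t" by (intro mult_left_mono) auto
  moreover have "rho t E V * 1 \<le> rho t E V * real (card V)" using rho_nonneg[OF assms] n by (intro mult_left_mono)
  ultimately show ?thesis using x(3) by linarith
qed

text \<open>Stable under removing vertices from \<open>V\<close> while \<open>E\<close> is kept,
  which is what repeated deletion requires.\<close>

definition admissible :: "nat \<Rightarrow> nat \<Rightarrow> 'a set \<Rightarrow> ('a \<times> 'a) set \<Rightarrow> bool" where
  "admissible r k V E \<longleftrightarrow> finite V \<and> sym E \<and> irrefl E \<and> \<not> packs k (Suc r) E V"

definition shrinkable :: "nat \<Rightarrow> nat \<Rightarrow> nat \<Rightarrow> real \<Rightarrow> 'a set \<Rightarrow> ('a \<times> 'a) set \<Rightarrow> bool" where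
  "shrinkable r t k \<eta> V E \<longleftrightarrow> (\<exists>v\<in>V. rho t E V / hrho r t k (card V) * (1 + \<eta> / real (card V))
    \<le> rho t E (V - {v}) / hrho r t k (card V - 1))"

lemma eventually_le_real: "eventually (\<lambda>n. C \<le> real n) sequentially"
  using filterlim_real_sequentially unfolding filterlim_at_top by blast

lemma eventually_less_real: "eventually (\<lambda>n. C < real n) sequentially"
  using eventually_le_real[of "C + 1"] by eventually_elim simp

lemma extremal_or_delete:
  assumes t: "2 \<le> t" "t \<le> r" and k: "2 \<le> k"
  shows "\<exists>\<eta>>0. \<exists>n1. \<forall>(V :: 'a set) E. admissible r k V E \<and> n1 \<le> card V
    \<and> hrho r t k (card V) \<le> rho t E V \<longrightarrow> extremal_ok r t k V E \<or> shrinkable r t k \<eta> V E"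
proof -
  define w where "w = real (k * Suc r)"
  define D where "D = wmax r t"
  define R where "R = real r"
  define H where "H = (16 * R) ^ (t - 1)"
  define C where "C = 4 * w * D\<^sup>2 * (20 * R\<^sup>2) * H"
  have R: "2 \<le> R" using t by (simp add: R_def)
  have w0: "0 < w" unfolding w_def of_nat_0_less_iff using k by simp
  have H0: "0 < H" using R by (simp add: H_def)
  have C0: "0 \<le> C" using w0 H0 by (simp add: C_def)
  \<comment> \<open>The second bound serves the colouring, since 60 = 10 * 6. The third makes the
    part of \<open>big5\<close> that does not vanish for large \<open>n\<close>, namely
    \<open>\<epsilon> * C\<close>, at most 1/2.\<close>
  define \<epsilon> where "\<epsilon> = min (1 / 10) (min (1 / (60 * R ^ 3)) (1 / (2 * (C + 1))))"
  have R3: "0 < R ^ 3" using R by simp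
  have \<epsilon>0: "0 < \<epsilon>" using R3 C0 by (simp add: \<epsilon>_def)
  have \<epsilon>1: "\<epsilon> \<le> 1 / 10" by (simp add: \<epsilon>_def)
  have "\<epsilon> \<le> 1 / (60 * R ^ 3)" by (simp add: \<epsilon>_def)
  then have \<epsilon>2: "10 * \<epsilon> * (6 * R ^ 3) \<le> 1" using R3 by (simp add: field_simps)
  have "\<epsilon> \<le> 1 / (2 * (C + 1))" by (simp add: \<epsilon>_def)
  then have "\<epsilon> * (C + 1) \<le> 1 / 2" using C0 by (simp add: field_simps)
  then have \<epsilon>3: "\<epsilon> * C \<le> 1 / 2" using \<epsilon>0 by (simp add: algebra_simps)
  have tc: "0 < tcoef r t" by (rule tcoef_pos[OF t])
  have ev1: "eventually (\<lambda>n. tcoef r t * (1 - 2 * \<epsilon>) ^ (t - 1) + w * D / real n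
      < tcoef r t * (1 - real (k + r) / real n) ^ t * (1 - \<epsilon>) ^ (t - 1)) sequentially" (is "eventually ?low _")
  proof -
    let ?g = "\<lambda>n. tcoef r t * (1 - real (k + r) / real n) ^ t * (1 - \<epsilon>) ^ (t - 1)
      - (tcoef r t * (1 - 2 * \<epsilon>) ^ (t - 1) + w * D / real n)"
    \<comment> \<open>In the limit \<open>big1\<close> becomes the strict inequality between the
      powers of \<open>1 - 2 * \<epsilon>\<close> and \<open>1 - \<epsilon>\<close>.\<close>
    let ?l = "tcoef r t * (1 - 0) ^ t * (1 - \<epsilon>) ^ (t - 1) - (tcoef r t * (1 - 2 * \<epsilon>) ^ (t - 1) + 0)"
    have "?g \<longlonglongrightarrow> ?l" by (intro tendsto_intros lim_const_over_n)
    moreover have "(1 - 2 * \<epsilon>) ^ (t - 1) < (1 - \<epsilon>) ^ (t - 1)"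
      using \<epsilon>0 \<epsilon>1 t by (intro power_strict_mono) auto
    then have "0 < ?l" using tc by simp
    ultimately have "eventually (\<lambda>n. 0 < ?g n) sequentially" by (rule order_tendstoD(1))
    then show ?thesis by eventually_elim simp
  qed
  have "eventually (\<lambda>n. ?low n \<and>
      1 \<le> real n \<and> real (2 * (k + r) + 1) \<le> real n \<and> (1 + \<epsilon>) * w / \<epsilon> \<le> real n
      \<and> w / (10 * R\<^sup>2 * \<epsilon>) < real n \<and> 8 * R \<le> real n \<and> 2 * (4 * w * D\<^sup>2 * w * H) < real n
      \<and> real t * 2 / \<epsilon> + 1 \<le> real n \<and> 4 * (real k * D ^ t) / \<epsilon> + 1 < real n) sequentially"
    (is "eventually ?big _")
    by (intro eventually_conj ev1 eventually_le_real eventually_less_real)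
  then obtain n1 where n1: "\<And>n. n1 \<le> n \<Longrightarrow> ?big n" unfolding eventually_sequentially by blast
  \<comment> \<open>The gain of \<open>rho_ratio_delete\<close> with
    \<open>\<delta> = \<epsilon>\<close>; it depends only on \<open>r\<close>, \<open>t\<close> and
    \<open>k\<close>, not on the graph.\<close>
  define \<eta> where "\<eta> = real (t - 1) * \<epsilon> / 4"
  have \<eta>: "0 < \<eta>" using t \<epsilon>0 by (simp add: \<eta>_def)
  have "extremal_ok r t k V E \<or> shrinkable r t k \<eta> V E"
    if adm: "admissible r k V E" and nV: "n1 \<le> card V" and ge: "hrho r t k (card V) \<le> rho t E V"
    for V :: "'a set" and E
  proof -
    have V: "finite V" and E: "sym E" "irrefl E" and np: "\<not> packs k (Suc r) E V" using adm by (auto simp: admissible_def)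
    let ?n = "real (card V)"
    note N = n1[OF nV]
    have n: "0 < ?n" using N by linarith
    have ne: "V \<noteq> {}" using n by auto
    have nat: "2 * (k + r) + 1 \<le> card V" using N by (simp only: of_nat_le_iff)
    obtain x where x: "\<And>v. 0 \<le> x v" "(\<Sum>v\<in>V. x v ^ t) = ?n"
      "real t * kap t E x V = rho t E V * ?n"
      "\<And>v. v \<in> V \<Longrightarrow> rho t E V * x v ^ (t - 1) = kap (t - 1) E x (V \<inter> E `` {v})"
      using perron[OF V ne E t(1)] by metis
    show ?thesis
    proof (cases "\<forall>v\<in>V. 1 - \<epsilon> \<le> x v")
      case True
      have "flat_perron r t k \<epsilon> V E x"
      proof
        show "10 * \<epsilon> * (6 * real r ^ 3) \<le> 1" using \<epsilon>2 by (simp add: R_def)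
        show "tcoef r t * (1 - 2 * \<epsilon>) ^ (t - 1) + real (k * Suc r) * wmax r t / ?n
          < tcoef r t * (1 - real (k + r) / ?n) ^ t * (1 - \<epsilon>) ^ (t - 1)"
          using N unfolding w_def D_def by blast
        have "(1 + \<epsilon>) * w \<le> ?n * \<epsilon>" using N \<epsilon>0 by (simp add: pos_divide_le_eq)
        then show "?n \<le> (1 + \<epsilon>) * (?n - real (k * Suc r))" unfolding w_def[symmetric] by (simp add: algebra_simps)
        have "0 < 10 * R\<^sup>2 * \<epsilon>" using R \<epsilon>0 by simp
        then have "w < ?n * (10 * R\<^sup>2 * \<epsilon>)" using N by (simp add: pos_divide_less_eq)
        then show "real (k * Suc r) < 10 * real r ^ 2 * \<epsilon> * ?n"
          unfolding w_def[symmetric] R_def[symmetric] by (simp add: mult_ac)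
        show "8 * real r \<le> ?n" using N by (simp add: R_def)
        have "4 * w * D\<^sup>2 * (20 * R\<^sup>2 * \<epsilon> + w / ?n) * H = \<epsilon> * C + (4 * w * D\<^sup>2 * w * H) / ?n"
          by (simp add: C_def field_simps)
        also have "(4 * w * D\<^sup>2 * w * H) / ?n < 1 / 2" using N n by (simp add: pos_divide_less_eq)
        finally show "4 * real (k * Suc r) * (wmax r t)\<^sup>2 * (20 * real r ^ 2 * \<epsilon> + real (k * Suc r) / ?n)
            * (16 * real r) ^ (t - 1) < 1"
          using \<epsilon>3 unfolding w_def[symmetric] D_def[symmetric] R_def[symmetric] H_def[symmetric] by linarith
      qed (use t k V E x ge np nat \<epsilon>0 \<epsilon>1 True in auto)
      then have "extremal_ok r t k V E" using k by (rule flat_perron.extremal)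
      then show ?thesis ..
    next
      case False
      then obtain v where v: "v \<in> V" "x v < 1 - \<epsilon>" by (auto simp: not_le)
      have "x v ^ t \<le> x v ^ 1" using v x(1) \<epsilon>0 t by (intro power_decreasing) auto
      then have low: "x v ^ t \<le> 1 - \<epsilon>" using v(2) by simp
      have "real t * 2 / \<epsilon> \<le> ?n - 1" using N by linarith
      then have b1: "real t * 2 \<le> \<epsilon> * (?n - 1)" using \<epsilon>0 by (simp add: pos_divide_le_eq mult.commute)
      have "4 * (real k * D ^ t) / \<epsilon> < ?n - 1" using N by linarith
      then have "4 * (real k * D ^ t) < (?n - 1) * \<epsilon>" using \<epsilon>0 by (simp only: pos_divide_less_eq)
      then have b2: "real k * wmax r t ^ t < \<epsilon> / 4 * (?n - 1)" unfolding D_def by (simp add: mult.commute)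
      have "rho t E V / hrho r t k (card V) * (1 + real (t - 1) * \<epsilon> / 4 / ?n)
          \<le> rho t E (V - {v}) / hrho r t k (card V - 1)"
        using k \<epsilon>1 by (intro rho_ratio_delete[OF t _ nat V E x v(1) low \<epsilon>0 _ b1 b2]) auto
      then show ?thesis using v(1) unfolding \<eta>_def shrinkable_def by blast
    qed
  qed
  then show ?thesis using \<eta> by blast
qed

text \<open>Deleting vertices from a counterexample multiplies its ratio to the extremal value by
  \<open>1 + \<eta> / n\<close> each time; since the harmonic series diverges, a large counterexample would lead to
  a graph of bounded order with too large a ratio.\<close>

lemma extremal_eventually:
  assumes t: "2 \<le> t" "t \<le> r" and k: "2 \<le> k"
  shows "\<exists>n0\<ge>1. \<forall>(V :: 'a set) E. admissible r k V E \<and> n0 \<le> card V \<longrightarrow> extremal_ok r t k V E"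
proof -
  obtain \<eta> n1 where \<eta>: "0 < \<eta>" and del: "\<forall>(V :: 'a set) E. admissible r k V E \<and> n1 \<le> card V
    \<and> hrho r t k (card V) \<le> rho t E V \<longrightarrow> extremal_ok r t k V E \<or> shrinkable r t k \<eta> V E"
    using extremal_or_delete[OF assms, where 'a = 'a] by (elim exE conjE) (rule that)
  define m where "m = max n1 (2 * (k + r))"
  have m: "n1 \<le> m" "2 * (k + r) \<le> m" "1 \<le> m" using k by (auto simp: m_def)
  have hp: "0 < hrho r t k n" if "m \<le> n" for n using that m t k by (intro hrho_pos) auto
  \<comment> \<open>The trivial bound on the ratio of any graph of order \<open>m\<close>, where the
    descent ends.\<close>
  define B where "B = real t * real m ^ t / hrho r t k m"
  define bad where "bad V E \<longleftrightarrow> admissible r k V E \<and> \<not> extremal_ok r t k V E" for V :: "'a set" and E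
  define q where "q V E = rho t E V / hrho r t k (card V)" for V :: "'a set" and E
  have q1: "1 \<le> q V E" if "bad V E" "m \<le> card V" for V E
  proof -
    have "hrho r t k (card V) \<le> rho t E V" using that(1) by (auto simp: bad_def extremal_ok_def)
    then show ?thesis using hp[OF that(2)] by (simp add: q_def)
  qed
  have bound: "q V E * (1 + \<eta> * (harm n - harm m)) \<le> B" if "m \<le> n" "bad V E" "card V = n" for n V E using that
  proof (induction n arbitrary: V rule: dec_induct)
    case base
    then have "V \<noteq> {}" using m by auto
    then have "rho t E V \<le> real t * real (card V) ^ t" using base t by (intro rho_le_trivial) (auto simp: bad_def admissible_def)
    then show ?case using base hp[of m] by (simp add: q_def B_def divide_right_mono)
  next
    case (step n)
    have cV: "card V = Suc n" and b: "bad V E" using step by auto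
    have ge: "hrho r t k (card V) \<le> rho t E V" using b by (auto simp: bad_def extremal_ok_def)
    have "n1 \<le> card V" using m step.hyps cV by simp
    then obtain v where v: "v \<in> V"
      and ineq: "q V E * (1 + \<eta> / real (Suc n)) \<le> rho t E (V - {v}) / hrho r t k n"
      using del b ge cV unfolding bad_def q_def shrinkable_def by (metis diff_Suc_1)
    have cV': "card (V - {v}) = n" using v cV b by (simp add: bad_def admissible_def)
    have ineq': "q V E * (1 + \<eta> / real (Suc n)) \<le> q (V - {v}) E" using ineq cV' by (simp add: q_def)
    have qV: "1 \<le> q V E" using q1[OF b] cV step.hyps by simp
    \<comment> \<open>A counterexample may have ratio exactly 1 without being isomorphic to the
      extremal graph. One deletion makes the ratio strictly larger, so the smaller graph is again a
      counterexample.\<close>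
    have "1 * 1 < q V E * (1 + \<eta> / real (Suc n))" using qV \<eta> by (intro mult_le_less_imp_less) auto
    then have "1 < rho t E (V - {v}) / hrho r t k n" using ineq by linarith
    then have "hrho r t k n < rho t E (V - {v})" using hp[OF step.hyps(1)] by (simp add: less_divide_eq)
    then have "\<not> extremal_ok r t k (V - {v}) E" using cV' by (simp add: extremal_ok_def)
    moreover have "\<not> packs k (Suc r) E (V - {v})"
      using b packs_mono[of k "Suc r" E "V - {v}" V] by (auto simp: bad_def admissible_def)
    ultimately have b': "bad (V - {v}) E" using b by (simp add: bad_def admissible_def)
    define z where "z = \<eta> * (harm n - harm m)"
    have z: "0 \<le> z" using \<eta> harm_mono[OF step.hyps(1), where 'a = real] by (simp add: z_def)
    have "1 + \<eta> * (harm (Suc n) - harm m) = 1 + z + \<eta> / real (Suc n)" by (simp add: z_def harm_Suc field_simps)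
    \<comment> \<open>This bounds the product of the gains from below by a sum, a multiple of a
      difference of harmonic numbers.\<close>
    also have "\<dots> \<le> (1 + \<eta> / real (Suc n)) * (1 + z)"
    proof -
      have "1 + z + y \<le> (1 + y) * (1 + z)" if "0 \<le> y" for y using that z by (simp add: algebra_simps)
      then show ?thesis using \<eta> by simp
    qed
    finally have "q V E * (1 + \<eta> * (harm (Suc n) - harm m)) \<le> q V E * ((1 + \<eta> / real (Suc n)) * (1 + z))"
      using qV by (intro mult_left_mono) auto
    also have "\<dots> = q V E * (1 + \<eta> / real (Suc n)) * (1 + z)" by (simp only: mult.assoc)
    also have "\<dots> \<le> q (V - {v}) E * (1 + z)" using ineq' z by (intro mult_right_mono) auto
    also have "\<dots> \<le> B" using step.IH[OF b' cV'] by (simp add: z_def)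
    finally show ?case .
  qed
  have "eventually (\<lambda>n. B / \<eta> + harm m + 1 \<le> (harm n :: real)) sequentially"
    using harm_at_top unfolding filterlim_at_top by blast
  then obtain n2 where n2: "\<And>n. n2 \<le> n \<Longrightarrow> B / \<eta> + harm m + 1 \<le> (harm n :: real)"
    unfolding eventually_sequentially by blast
  show ?thesis
  proof (intro exI[of _ "max m n2"] conjI allI impI)
    show "1 \<le> max m n2" using m by simp
    fix V :: "'a set" and E
    assume A: "admissible r k V E \<and> max m n2 \<le> card V"
    show "extremal_ok r t k V E"
    proof (rule ccontr)
      assume "\<not> extremal_ok r t k V E"
      then have b: "bad V E" using A by (simp add: bad_def)
      have mV: "m \<le> card V" "n2 \<le> card V" using A by auto
      define A where "A = \<eta> * (harm (card V) - harm m)"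
      have "B / \<eta> \<le> harm (card V) - harm m" using n2[OF mV(2)] by simp
      then have BA: "B \<le> A" using \<eta> by (simp add: A_def pos_divide_le_eq mult.commute)
      have "0 \<le> A" using \<eta> harm_mono[OF mV(1), where 'a = real] by (simp add: A_def)
      then have "1 * (1 + A) \<le> q V E * (1 + A)" using q1[OF b mV(1)] by (intro mult_right_mono) auto
      also have "\<dots> \<le> B" unfolding A_def by (rule bound[OF mV(1) b refl])
      finally show False using BA by simp
    qed
  qed
qed

section \<open>Translation to pair graphs\<close>

lemma pair_graph_sym_irrefl:
  assumes "pair_graph F"
  shows "sym (parcs F)" "irrefl (parcs F)"
proof -
  interpret pair_graph F by fact
  show "sym (parcs F)" by (rule symI) (rule arcs_symmetric)
  show "irrefl (parcs F)"
  proof (rule irreflI)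
    fix a show "(a, a) \<notin> parcs F" using pair_no_loops[of "(a, a)"] by auto
  qed
qed

theorem theorem1p6:
  fixes r t k :: nat
  assumes "2 \<le> t" and "t \<le> r" and "2 \<le> k"
  shows "\<exists>n0. \<forall>n \<ge> n0. \<forall>G :: nat pair_pre_digraph.
    pair_graph G \<and> card (pverts G) = n \<and> free_of (disjoint_copies k (complete_graph (r + 1))) G \<longrightarrow>
      clique_spectral_radius t G
        \<le> clique_spectral_radius t (graph_join (complete_graph (k - 1)) (turan_graph r (n - k + 1))) \<and>
      (clique_spectral_radius t G
        = clique_spectral_radius t (graph_join (complete_graph (k - 1)) (turan_graph r (n - k + 1)))
       \<longleftrightarrow> isomorphic G (graph_join (complete_graph (k - 1)) (turan_graph r (n - k + 1))))"
proof -
  obtain n0 where n0: "1 \<le> n0" and ext: "\<forall>(V :: nat set) E. admissible r k V E \<and> n0 \<le> card V \<longrightarrow> extremal_ok r t k V E"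
    using extremal_eventually[OF assms, where 'a = nat] by (elim exE conjE) (rule that)
  show ?thesis unfolding hgraph_def[symmetric] hrho_def[symmetric]
  proof (intro exI[of _ n0] allI impI)
    fix n and G :: "nat pair_pre_digraph"
    assume n: "n0 \<le> n"
      and "pair_graph G \<and> card (pverts G) = n \<and> free_of (disjoint_copies k (complete_graph (r + 1))) G"
    then have G: "pair_graph G" "card (pverts G) = n"
      and free: "free_of (disjoint_copies k (complete_graph (Suc r))) G" by auto
    interpret pair_graph G by fact
    let ?V = "pverts G" and ?E = "parcs G"
    note E = pair_graph_sym_irrefl[OF G(1)] and EH = pair_graph_sym_irrefl[OF pair_graph_hgraph[of r k n]]
    \<comment> \<open>\<open>1 \<le> n0\<close> excludes the empty graph, which has no
      eigenvalue.\<close>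
    have ne: "?V \<noteq> {}" using G(2) n n0 by auto
    have eqG: "rho t ?E ?V = clique_spectral_radius t G" by (rule rho_pverts_parcs)
    have eqH: "rho t (parcs (hgraph r k n)) (pverts (hgraph r k n)) = hrho r t k n" unfolding hrho_def by (rule rho_pverts_parcs)
    have "extremal_ok r t k ?V ?E" using ext E G(2) n free_of_imp_not_packs[OF G(1) free] by (auto simp: admissible_def)
    then have ok: "clique_spectral_radius t G \<le> hrho r t k n"
      "clique_spectral_radius t G = hrho r t k n \<Longrightarrow> isomorphic G (hgraph r k n)"
      unfolding extremal_ok_def iso_on_def isomorphic_iff[OF G(1) pair_graph_hgraph] eqG G(2) by auto
    have "clique_spectral_radius t G = hrho r t k n" if iso: "isomorphic G (hgraph r k n)"
    proof -
      have "iso_on ?V ?E (pverts (hgraph r k n)) (parcs (hgraph r k n))"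
        using iso unfolding isomorphic_iff[OF G(1) pair_graph_hgraph] iso_on_def .
      then have "rho t ?E ?V = rho t (parcs (hgraph r k n)) (pverts (hgraph r k n))" using E EH ne assms(1) by (intro rho_iso) auto
      then show ?thesis unfolding eqG eqH .
    qed
    then show "clique_spectral_radius t G \<le> hrho r t k n \<and>
      (clique_spectral_radius t G = hrho r t k n \<longleftrightarrow> isomorphic G (hgraph r k n))"
      using ok by blast
  qed
qed

end
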